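(* Let $Q(x,y,z)$ be an irreducible complex quadratic form and $\mathcal S_Q=\{Q(x,y,z)=1\}\subset\mathbb C^3$. (1) Any holomorphic function on the complex surface $\mathcal S_Q$ is a limit, in the topology of uniform convergence on compacts, of polynomial functions in $\mathbb C^3$; the approximating polynomials each admit on $\mathcal S_Q$ a representation of the form $\lambda_0+\sum_{k=1}^d\prod_{l=1}^kL_{k,l}(x,y,z)$ with $\lambda_0\in\mathbb C$ and linear forms $L_{k,l}$. (2) The subset $\mathcal F(\mathcal S_Q)\subset\mathcal O(\mathcal S_Q)$ is dense in the space of all holomorphic functions $\mathcal O(\mathcal S_Q)$ and invariant under multiplication by scalars and the natural $O_Q(3;\mathbb C)$-action. Each function $f=\sum_{k=0}^\infty\prod_{j=1}^kL_{kj}$ from $\mathcal F(\mathcal S_Q)$ admits a canonical holomorphic extension $$f(\lambda x,\lambda y,\lambda z)=\sum_{k=0}^\infty\lambda^k\Big[\prod_{j=1}^kL_{kj}(x,y,z)\Big]$$ into the round hull $\mathcal S_Q^\bullet$, where $(x,y,z)\in\mathcal S_Q$ and $|\lambda|<1$. (3) Let $H=\Upsilon_Q$, or (for $Q$ real) $H=\mathcal S_Q^{\mathbb R}$. Any continuous function $f:H\to\mathbb C$ is a limit, in the topology of uniform convergence on compacts in $H$, of polynomial functions in $\mathbb C^3$. As a result, the set $\mathcal F(H)$ is dense in $C(H)$. Each function from $\mathcal F(H)$ admits a similar analytic extension into the open portion of the real cone over $H$ that is bounded by $H$ and contains the origin. (4) If $f=F|_H$ for a function $F$ holomorphic in a neighborhood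 of $H$ in $\mathcal S_Q$, then such an $F$ is unique (as a germ along $H$).
   Context: $\mathcal O(\mathcal S_Q)$ is the algebra of holomorphic functions on $\mathcal S_Q$ and $C(H)$ the algebra of continuous complex functions on $H$, both with the topology of uniform convergence on compacts. $\mathcal F(\mathcal S_Q)$ is the set of functions on $\mathcal S_Q$ admitting a representation as a series $\sum_{k=0}^\infty\prod_{j=1}^kL_{kj}$, where each $L_{kj}$ is a complex linear form in $x,y,z$ (the $k=0$ term being a constant) and the series converges uniformly on each compact in $\mathcal S_Q$; $\mathcal F(H)\subset C(H)$ is defined in the same way with $H$ in place of $\mathcal S_Q$. $O_Q(3;\mathbb C)$ is the group of complex linear transformations preserving $Q$. The round hull of $Y\subset\mathbb C^3$ is $Y^\bullet=\{\lambda v: v\in Y,\ \lambda\in\mathbb C,\ |\lambda|<1\}$. Writing $Q(v)=(vA)(vA)^T$ with $A$ an invertible complex matrix, $\Upsilon_Q=\{v\in\mathbb C^3:vA\in\mathbb R^3,\ |vA|=1\}$, a totally real surface in $\mathcal S_Q$. For $Q$ with real coefficients, $\mathcal S_Q^{\mathbb R}=\mathcal S_Q\cap\mathbb R^3$. The "open portion of the real cone over $H$ bounded by $H$ and containing the origin" is the set of points $\lambda v$ with $v\in H$ and $\lambda\in\mathbb R$, $|\lambda|<1$. *)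

theory Defs
  imports
    "HOL-Analysis.Analysis"
    "HOL-Library.Poly_Mapping"
    "HOL-Computational_Algebra.Factorial_Ring"
begin

text \<open>
  Polynomials in three variables are finitely supported maps from exponent vectors to
  coefficients; multiplication in \<^theory>\<open>HOL-Library.Poly_Mapping\<close> is convolution, so
  \<^const>\<open>irreducible\<close> is irreducibility in the polynomial ring.
\<close>

type_synonym polynomial3 = "(3 \<Rightarrow>\<^sub>0 nat) \<Rightarrow>\<^sub>0 complex"

definition poly_fun :: "polynomial3 \<Rightarrow> complex^3 \<Rightarrow> complex" where
  "poly_fun P v =
     (\<Sum>m\<in>Poly_Mapping.keys P. Poly_Mapping.lookup P m * (\<Prod>i\<in>UNIV. (v $ i) ^ Poly_Mapping.lookup m i))"

definition quadratic_form :: "polynomial3 \<Rightarrow> bool" where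
  "quadratic_form Q \<longleftrightarrow>
     (\<forall>m\<in>Poly_Mapping.keys Q. (\<Sum>i\<in>UNIV. Poly_Mapping.lookup m i) = 2)"

definition real_coefficients :: "polynomial3 \<Rightarrow> bool" where
  "real_coefficients Q \<longleftrightarrow> (\<forall>m. Poly_Mapping.lookup Q m \<in> \<real>)"

definition quadric :: "polynomial3 \<Rightarrow> (complex^3) set" where
  "quadric Q = {v. poly_fun Q v = 1}"

definition real_quadric :: "polynomial3 \<Rightarrow> (complex^3) set" where
  "real_quadric Q = {v \<in> quadric Q. \<forall>i. v $ i \<in> \<real>}"

text \<open>
  \<^const>\<open>scalar_product\<close> is complex bilinear (no conjugation), so it expresses both
  \<open>(v A) (v A)\<^sup>T\<close> and the complex linear form with coefficient vector \<open>a\<close>, namely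
  \<open>v \<mapsto> scalar_product a v\<close>.
\<close>

definition diagonalizes :: "complex^3^3 \<Rightarrow> polynomial3 \<Rightarrow> bool" where
  "diagonalizes A Q \<longleftrightarrow>
     invertible A \<and> (\<forall>v. poly_fun Q v = scalar_product (v v* A) (v v* A))"

definition upsilon :: "complex^3^3 \<Rightarrow> (complex^3) set" where
  "upsilon A = {v. (\<forall>i. (v v* A) $ i \<in> \<real>) \<and> norm (v v* A) = 1}"

definition orthogonal_group :: "polynomial3 \<Rightarrow> (complex^3^3) set" where
  "orthogonal_group Q = {g. invertible g \<and> (\<forall>v. poly_fun Q (g *v v) = poly_fun Q v)}"

definition round_hull :: "(complex^3) set \<Rightarrow> (complex^3) set" where
  "round_hull Y = {l *s v | l v. v \<in> Y \<and> norm l < 1}"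

definition real_cone :: "(complex^3) set \<Rightarrow> (complex^3) set" where
  "real_cone H = {complex_of_real t *s v | t v. v \<in> H \<and> \<bar>t\<bar> < 1}"

text \<open>
  Functions on a subset \<open>Y\<close> of \<open>\<complex>\<^sup>3\<close> are represented by total functions whose values outside
  \<open>Y\<close> are irrelevant.

  A function on \<open>Y\<close> is holomorphic if it is locally the restriction of a holomorphic function
  on an open subset of \<open>\<complex>\<^sup>3\<close>.  On a relatively open part of a complex submanifold these are the
  holomorphic functions of the submanifold; on a subset of the real span of a complex basis,
  such as \<open>\<real>\<^sup>3\<close>, they are the complex-valued real analytic functions.
\<close>

definition ambient_holomorphic_on :: "(complex^'n \<Rightarrow> complex) \<Rightarrow> (complex^'n) set \<Rightarrow> bool" where
  "ambient_holomorphic_on F W \<longleftrightarrow> open W \<and>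
     (\<forall>w\<in>W. \<exists>D. (F has_derivative D) (at w) \<and> (\<forall>c u. D (c *s u) = c * D u))"

definition hol_on :: "(complex^'n \<Rightarrow> complex) \<Rightarrow> (complex^'n) set \<Rightarrow> bool" where
  "hol_on f Y \<longleftrightarrow>
     (\<forall>p\<in>Y. \<exists>W F. p \<in> W \<and> ambient_holomorphic_on F W \<and> (\<forall>v\<in>W \<inter> Y. F v = f v))"

definition hol_functions :: "(complex^'n) set \<Rightarrow> (complex^'n \<Rightarrow> complex) set" where
  "hol_functions Y = {f. hol_on f Y}"

definition cont_functions :: "(complex^'n) set \<Rightarrow> (complex^'n \<Rightarrow> complex) set" where
  "cont_functions Y = {f. continuous_on Y f}"

text \<open>
  The topology of uniform convergence on compact subsets of \<open>Y\<close>.  As functions are total, it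
  does not separate functions that agree on \<open>Y\<close>.
\<close>

definition compact_convergence :: "'a::topological_space set \<Rightarrow> ('a \<Rightarrow> 'b::metric_space) topology" where
  "compact_convergence Y = topology (\<lambda>U. \<forall>f\<in>U. \<exists>K e. compact K \<and> K \<subseteq> Y \<and> e > 0 \<and>
      {g. \<forall>v\<in>K. dist (g v) (f v) < e} \<subseteq> U)"

lemma openin_compact_convergence:
  "openin (compact_convergence Y) U \<longleftrightarrow>
     (\<forall>f\<in>U. \<exists>K e. compact K \<and> K \<subseteq> Y \<and> e > 0 \<and> {g. \<forall>v\<in>K. dist (g v) (f v) < e} \<subseteq> U)"
proof -
  have "istopology (\<lambda>U::('a \<Rightarrow> 'b) set. \<forall>f\<in>U. \<exists>K e. compact K \<and> K \<subseteq> Y \<and> e > 0 \<and>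
      {g. \<forall>v\<in>K. dist (g v) (f v) < e} \<subseteq> U)" (is "istopology ?P")
    unfolding istopology_def
  proof (intro conjI allI impI)
    fix S T assume S: "?P S" and T: "?P T"
    show "?P (S \<inter> T)"
    proof
      fix f assume "f \<in> S \<inter> T"
      then have "f \<in> S" "f \<in> T" by simp_all
      obtain K1 e1 where 1: "compact K1" "K1 \<subseteq> Y" "e1 > 0"
        "{g. \<forall>v\<in>K1. dist (g v) (f v) < e1} \<subseteq> S"
        using bspec[OF S \<open>f \<in> S\<close>] by (elim exE conjE)
      obtain K2 e2 where 2: "compact K2" "K2 \<subseteq> Y" "e2 > 0"
        "{g. \<forall>v\<in>K2. dist (g v) (f v) < e2} \<subseteq> T"
        using bspec[OF T \<open>f \<in> T\<close>] by (elim exE conjE)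
      show "\<exists>K e. compact K \<and> K \<subseteq> Y \<and> e > 0 \<and>
          {g. \<forall>v\<in>K. dist (g v) (f v) < e} \<subseteq> S \<inter> T"
      proof (rule exI[of _ "K1 \<union> K2"], rule exI[of _ "min e1 e2"], intro conjI)
        show "{g. \<forall>v\<in>K1 \<union> K2. dist (g v) (f v) < min e1 e2} \<subseteq> S \<inter> T"
        proof
          fix g assume g: "g \<in> {g. \<forall>v\<in>K1 \<union> K2. dist (g v) (f v) < min e1 e2}"
          then have "g \<in> S" using subsetD[OF 1(4), of g] by simp
          moreover have "g \<in> T" using g subsetD[OF 2(4), of g] by simp
          ultimately show "g \<in> S \<inter> T" by simp
        qed
      qed (use 1 2 in \<open>simp_all add: compact_Un\<close>)
    qed
  next
    fix \<K> assume \<K>: "\<forall>K\<in>\<K>. ?P K"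
    show "?P (\<Union>\<K>)"
    proof
      fix f assume "f \<in> \<Union>\<K>"
      then obtain U where U: "U \<in> \<K>" "f \<in> U" by (rule UnionE)
      obtain K e where K: "compact K" "K \<subseteq> Y" "e > 0"
        "{g. \<forall>v\<in>K. dist (g v) (f v) < e} \<subseteq> U"
        using bspec[OF bspec[OF \<K> U(1)] U(2)] by (elim exE conjE)
      have "{g. \<forall>v\<in>K. dist (g v) (f v) < e} \<subseteq> \<Union>\<K>"
        using K(4) Union_upper[OF U(1)] by (rule order_trans)
      with K(1-3) show "\<exists>K e. compact K \<and> K \<subseteq> Y \<and> e > 0 \<and>
          {g. \<forall>v\<in>K. dist (g v) (f v) < e} \<subseteq> \<Union>\<K>"
        by (intro exI conjI)
    qed
  qed
  then show ?thesis
    by (simp add: compact_convergence_def)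
qed

lemma topspace_compact_convergence [simp]: "topspace (compact_convergence Y) = UNIV"
proof -
  have "openin (compact_convergence Y) UNIV"
    unfolding openin_compact_convergence
    by (auto intro!: exI[of _ "{}"] exI[of _ "1::real"])
  then show ?thesis
    using openin_subset by blast
qed

lemma limitin_compact_convergence:
  "limitin (compact_convergence Y) s f F \<longleftrightarrow> (\<forall>K. compact K \<and> K \<subseteq> Y \<longrightarrow> uniform_limit K s f F)"
proof (intro iffI allI impI)
  fix K assume lim: "limitin (compact_convergence Y) s f F" and K: "compact K \<and> K \<subseteq> Y"
  show "uniform_limit K s f F"
  proof (rule uniform_limitI)
    fix e :: real assume e: "e > 0"
    let ?U = "{g. \<exists>d>0. \<forall>v\<in>K. dist (g v) (f v) \<le> e - d}"
    have "openin (compact_convergence Y) ?U"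
      unfolding openin_compact_convergence
    proof
      fix g assume "g \<in> ?U"
      then obtain d where d: "d > 0" "\<forall>v\<in>K. dist (g v) (f v) \<le> e - d" by blast
      have "{h. \<forall>v\<in>K. dist (h v) (g v) < d/2} \<subseteq> ?U"
      proof
        fix h assume h: "h \<in> {h. \<forall>v\<in>K. dist (h v) (g v) < d/2}"
        have "dist (h v) (f v) \<le> e - d/2" if "v \<in> K" for v
        proof -
          have "dist (h v) (f v) \<le> dist (h v) (g v) + dist (g v) (f v)"
            by (rule dist_triangle)
          also have "\<dots> \<le> d/2 + (e - d)" using h d that by (intro add_mono) (auto intro: less_imp_le)
          finally show ?thesis by simp
        qed
        then show "h \<in> ?U" using d by (auto intro!: exI[of _ "d/2"])
      qed
      then show "\<exists>K' e'. compact K' \<and> K' \<subseteq> Y \<and> e' > 0 \<and>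
          {h. \<forall>v\<in>K'. dist (h v) (g v) < e'} \<subseteq> ?U"
        using K d(1) by (intro exI[of _ K] exI[of _ "d/2"] conjI) simp_all
    qed
    moreover have "f \<in> ?U" using e by (simp add: exI[of _ e])
    ultimately have "eventually (\<lambda>n. s n \<in> ?U) F"
      using lim unfolding limitin_def by blast
    then show "\<forall>\<^sub>F n in F. \<forall>v\<in>K. dist (s n v) (f v) < e"
    proof (rule eventually_mono)
      fix n assume "s n \<in> ?U"
      then obtain d where "d > 0" "\<forall>v\<in>K. dist (s n v) (f v) \<le> e - d" by auto
      then show "\<forall>v\<in>K. dist (s n v) (f v) < e"
        by (meson diff_less_eq le_less_trans less_add_same_cancel1)
    qed
  qed
next
  assume *: "\<forall>K. compact K \<and> K \<subseteq> Y \<longrightarrow> uniform_limit K s f F"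
  show "limitin (compact_convergence Y) s f F"
    unfolding limitin_def
  proof (intro conjI allI impI)
    fix U assume U: "openin (compact_convergence Y) U \<and> f \<in> U"
    obtain K e where K: "compact K" "K \<subseteq> Y" "e > 0"
      "{g. \<forall>v\<in>K. dist (g v) (f v) < e} \<subseteq> U"
      using bspec[OF U[THEN conjunct1, unfolded openin_compact_convergence] U[THEN conjunct2]]
      by (elim exE conjE)
    have "uniform_limit K s f F" using * K(1,2) by simp
    then have "\<forall>\<^sub>F n in F. \<forall>v\<in>K. dist (s n v) (f v) < e"
      using K(3) by (rule uniform_limitD)
    then show "\<forall>\<^sub>F n in F. s n \<in> U"
    proof (rule eventually_mono)
      fix n assume "\<forall>v\<in>K. dist (s n v) (f v) < e"
      then show "s n \<in> U" using subsetD[OF K(4), of "s n"] by simp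
    qed
  qed simp
qed

definition dense_subset :: "'a topology \<Rightarrow> 'a set \<Rightarrow> 'a set \<Rightarrow> bool" where
  "dense_subset T X F \<longleftrightarrow> F \<subseteq> X \<and> subtopology T X closure_of F = X"

text \<open>
  The term of degree \<open>k\<close> is a product of \<open>k\<close> linear forms \<open>L k 1, \<dots>, L k k\<close>, given by their
  coefficient vectors; the term of degree \<open>0\<close> is the arbitrary constant \<open>c\<close>.
\<close>

definition multipole_term ::
    "complex \<Rightarrow> (nat \<Rightarrow> nat \<Rightarrow> complex^3) \<Rightarrow> nat \<Rightarrow> complex^3 \<Rightarrow> complex" where
  "multipole_term c L k v = (if k = 0 then c else (\<Prod>j=1..k. scalar_product (L k j) v))"

definition multipole_series ::
    "(complex^3) set \<Rightarrow> complex \<Rightarrow> (nat \<Rightarrow> nat \<Rightarrow> complex^3) \<Rightarrow> (complex^3 \<Rightarrow> complex) \<Rightarrow> bool" where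
  "multipole_series Y c L f \<longleftrightarrow>
     limitin (compact_convergence Y) (\<lambda>n v. \<Sum>k<n. multipole_term c L k v) f sequentially"

definition multipole_functions :: "(complex^3) set \<Rightarrow> (complex^3 \<Rightarrow> complex) set" where
  "multipole_functions Y = {f. \<exists>c L. multipole_series Y c L f}"

end

theory Submission
  imports Defs "HOL-Complex_Analysis.Complex_Analysis" "HOL-Computational_Algebra.Fundamental_Theorem_Algebra"
begin

text \<open>
  An irreducible ternary quadratic form is nondegenerate, so linear coordinates \<open>a, b, c\<close> exist in which
  the surface is \<open>c\<^sup>2 = 1 + a b\<close> (\<open>irreducible_quadratic_form_null_coordinates\<close>).  Everything rests
  on two features of this equation and on homogeneity.
  
  The null cone \<open>c\<^sup>2 = a b\<close> is parametrized by \<open>(s\<^sup>2, t\<^sup>2, s t)\<close>, so a form of degree \<open>k\<close> restricts to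
  a binary form of degree \<open>2 k\<close> on it.  Over the complex numbers a binary form is a product of \<open>2 k\<close>
  linear factors, and two linear factors together are the restriction of a linear form in \<open>a, b, c\<close>.
  On the surface itself this computation is off by terms of lower degree only; induction on the degree
  writes each polynomial function as \<open>\<lambda>\<^sub>0\<close> plus one product of \<open>k\<close> linear forms for each \<open>k\<close>
  (\<open>polynomial_sylvester\<close>).
  
  The surface is invariant under \<open>(a, b, c) \<mapsto> (t a, b / t, c)\<close> for \<open>t \<noteq> 0\<close>.  Expanding a holomorphic
  function \<open>f\<close> along the orbits in a Laurent series in \<open>t\<close>, the coefficient of index \<open>n \<ge> 0\<close> is \<open>a\<^sup>n\<close> times
  an entire function of \<open>c\<close>, and that of index \<open>- n\<close> is \<open>b\<^sup>n\<close> times such a function.  The Laurent series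
  converges geometrically, uniformly on compacts, and Taylor polynomials of the entire functions turn
  its partial sums into polynomials (\<open>hol_on_quadric_polynomial_approximation\<close>).  Conversely, limits of
  polynomials are holomorphic by Weierstrass' theorem in three variables, applied after composition with
  the radial projection \<open>v \<mapsto> v / sqrt (Q v)\<close> onto the surface.  This gives density.
  
  The extension of a series is the sum of the same terms at points off the surface.  Where
  \<open>Q w = s\<^sup>2 \<noteq> 0\<close>, the point \<open>w\<close> is \<open>s\<close> times a point of the surface, and the term of degree \<open>k\<close> at \<open>w\<close> is
  \<open>O(\<bar>s\<bar>\<^sup>k)\<close>, locally uniformly (\<open>growth_near_quadric\<close>).  Near the origin, where null vectors
  accumulate, the maximum principle on small circles does the same (\<open>growth_near_zero\<close>).  Over a totally
  real surface \<open>H\<close> the bound is known at real points only, and Bernstein's inequality carries it to nearby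
  complex points with an arbitrarily small loss in the rate (\<open>growth_near_real\<close>).  Convergence to the
  boundary values is Abel's theorem.
  
  Both \<open>\<Upsilon>\<^sub>Q\<close> and the real quadric consist of the points of the surface in a real form of \<open>\<complex>\<^sup>3\<close> on which
  \<open>Q\<close> is real.  There density of polynomials in \<open>C(H)\<close> is the Stone--Weierstrass theorem, and
  uniqueness of the germ follows because a holomorphic function vanishing at the real points near \<open>p\<close>
  vanishes on the complexifications of real lines, and these fill a neighbourhood of \<open>p\<close>
  (\<open>totally_real_identity\<close>).
\<close>

section \<open>Polynomial functions\<close>

lemma poly_fun_superset:
  assumes "finite A" "Poly_Mapping.keys P \<subseteq> A"
  shows "poly_fun P v =
    (\<Sum>m\<in>A. Poly_Mapping.lookup P m * (\<Prod>i\<in>UNIV. (v $ i) ^ Poly_Mapping.lookup m i))"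
  unfolding poly_fun_def
  by (rule sum.mono_neutral_left) (use assms in \<open>auto simp: in_keys_iff\<close>)

lemma poly_fun_add: "poly_fun (P + R) v = poly_fun P v + poly_fun R v"
proof -
  let ?A = "Poly_Mapping.keys P \<union> Poly_Mapping.keys R"
  have "Poly_Mapping.keys (P + R) \<subseteq> ?A" by (rule Poly_Mapping.keys_add)
  then show ?thesis
    by (simp add: poly_fun_superset[of ?A] lookup_add distrib_right sum.distrib)
qed

lemma poly_fun_zero [simp]: "poly_fun 0 v = 0"
  by (simp add: poly_fun_def)

lemma poly_fun_sum: "poly_fun (sum P I) v = (\<Sum>i\<in>I. poly_fun (P i) v)"
  by (induction I rule: infinite_finite_induct) (auto simp: poly_fun_add)

lemma poly_fun_single:
  "poly_fun (Poly_Mapping.single m c) v = c * (\<Prod>i\<in>UNIV. (v $ i) ^ Poly_Mapping.lookup m i)"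
  by (subst poly_fun_superset[of "{m}"]) auto

lemma poly_mapping_sum_single:
  "P = (\<Sum>m\<in>Poly_Mapping.keys P. Poly_Mapping.single m (Poly_Mapping.lookup P m))"
proof (rule poly_mapping_eqI)
  fix k
  show "Poly_Mapping.lookup P k =
    Poly_Mapping.lookup (\<Sum>m\<in>Poly_Mapping.keys P. Poly_Mapping.single m (Poly_Mapping.lookup P m)) k"
    by (simp add: lookup_sum lookup_single when_def in_keys_iff)
qed

lemma poly_fun_mult: "poly_fun (P * R) v = poly_fun P v * poly_fun R v"
proof -
  have "poly_fun (P * R) v = poly_fun
     ((\<Sum>m\<in>Poly_Mapping.keys P. Poly_Mapping.single m (Poly_Mapping.lookup P m)) *
      (\<Sum>m\<in>Poly_Mapping.keys R. Poly_Mapping.single m (Poly_Mapping.lookup R m))) v"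
    using poly_mapping_sum_single[of P] poly_mapping_sum_single[of R] by simp
  also have "\<dots> = (\<Sum>m\<in>Poly_Mapping.keys P. \<Sum>n\<in>Poly_Mapping.keys R.
      poly_fun (Poly_Mapping.single m (Poly_Mapping.lookup P m)) v *
      poly_fun (Poly_Mapping.single n (Poly_Mapping.lookup R n)) v)"
    unfolding sum_product poly_fun_sum
    by (intro sum.cong refl)
       (simp add: mult_single poly_fun_single lookup_add power_add prod.distrib)
  also have "\<dots> = poly_fun P v * poly_fun R v"
    unfolding sum_product[symmetric] poly_fun_single by (simp add: poly_fun_def)
  finally show ?thesis .
qed

definition polynomial_functions :: "(complex^3 \<Rightarrow> complex) set" where
  "polynomial_functions = range poly_fun"

lemma polynomial_functions_const: "(\<lambda>v. c) \<in> polynomial_functions"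
proof -
  have "poly_fun (Poly_Mapping.single 0 c) = (\<lambda>v. c)"
    by (auto simp: poly_fun_single)
  then show ?thesis by (metis polynomial_functions_def rangeI)
qed

lemma polynomial_functions_add:
  assumes "f \<in> polynomial_functions" "g \<in> polynomial_functions"
  shows "(\<lambda>v. f v + g v) \<in> polynomial_functions"
proof -
  obtain P R where "f = poly_fun P" "g = poly_fun R"
    using assms by (auto simp: polynomial_functions_def)
  then have "(\<lambda>v. f v + g v) = poly_fun (P + R)" by (auto simp: poly_fun_add)
  then show ?thesis by (auto simp: polynomial_functions_def)
qed

lemma polynomial_functions_mult:
  assumes "f \<in> polynomial_functions" "g \<in> polynomial_functions"
  shows "(\<lambda>v. f v * g v) \<in> polynomial_functions"
proof -
  obtain P R where "f = poly_fun P" "g = poly_fun R"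
    using assms by (auto simp: polynomial_functions_def)
  then have "(\<lambda>v. f v * g v) = poly_fun (P * R)" by (auto simp: poly_fun_mult)
  then show ?thesis by (auto simp: polynomial_functions_def)
qed

lemma polynomial_functions_sum:
  assumes "\<And>i. i \<in> I \<Longrightarrow> f i \<in> polynomial_functions"
  shows "(\<lambda>v. \<Sum>i\<in>I. f i v) \<in> polynomial_functions"
  using assms
  by (induction I rule: infinite_finite_induct)
     (auto intro: polynomial_functions_const polynomial_functions_add)

lemma polynomial_functions_power:
  assumes "f \<in> polynomial_functions"
  shows "(\<lambda>v. f v ^ n) \<in> polynomial_functions"
  by (induction n) (auto intro: polynomial_functions_const polynomial_functions_mult assms)

text \<open>
  The degrees are recorded because being a quadratic form is a condition on exponents: the product of
  two such polynomials satisfies it.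
\<close>

lemma linear_polynomial_exists:
  fixes a :: "complex^3"
  obtains P :: polynomial3
  where "poly_fun P = scalar_product a"
    "\<And>m. m \<in> Poly_Mapping.keys P \<Longrightarrow> (\<Sum>i\<in>UNIV. Poly_Mapping.lookup m i) = 1"
proof
  define P :: polynomial3 where
    "P = (\<Sum>i\<in>UNIV. Poly_Mapping.single (Poly_Mapping.single i 1) (a $ i))"
  show "poly_fun P = scalar_product a"
  proof
    fix v :: "complex^3"
    have "(\<Prod>j\<in>UNIV. (v $ j) ^ Poly_Mapping.lookup (Poly_Mapping.single i (1::nat)) j) = v $ i"
      for i :: 3
    proof -
      have "(\<Prod>j\<in>UNIV. (v $ j) ^ Poly_Mapping.lookup (Poly_Mapping.single i (1::nat)) j)
          = (\<Prod>j\<in>UNIV. if i = j then v $ j else 1)"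
        by (rule prod.cong) (auto simp: lookup_single when_def)
      then show ?thesis by simp
    qed
    then show "poly_fun P v = scalar_product a v"
      by (simp add: P_def poly_fun_sum poly_fun_single scalar_product_def)
  qed
  fix m assume "m \<in> Poly_Mapping.keys P"
  then obtain i where "m = Poly_Mapping.single i 1"
    unfolding P_def using Poly_Mapping.keys_sum by (fastforce split: if_splits)
  then have "(\<Sum>j\<in>UNIV. Poly_Mapping.lookup m j) = (\<Sum>j\<in>UNIV. if i = j then 1 else 0)"
    by (intro sum.cong) (auto simp: lookup_single when_def)
  then show "(\<Sum>i\<in>UNIV. Poly_Mapping.lookup m i) = 1" by simp
qed

lemma polynomial_functions_linear: "scalar_product a \<in> polynomial_functions"
  by (rule linear_polynomial_exists[of a]) (metis polynomial_functions_def rangeI)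

lemmas polynomial_functions_intros =
  polynomial_functions_const polynomial_functions_add
  polynomial_functions_mult polynomial_functions_sum polynomial_functions_power
  polynomial_functions_linear

section \<open>The normal form of an irreducible quadratic form\<close>

lemma scalar_product_add_left: "scalar_product (a + b) v = scalar_product a v + scalar_product b v"
  by (simp add: scalar_product_def distrib_right sum.distrib)

lemma scalar_product_add_right: "scalar_product a (v + w) = scalar_product a v + scalar_product a w"
  by (simp add: scalar_product_def distrib_left sum.distrib)

lemma scalar_product_scale_left:
  "scalar_product (c *s a) v = c * scalar_product a (v :: 'a::comm_semiring_1^'n)"
  by (simp add: scalar_product_def sum_distrib_left mult_ac)

lemma scalar_product_scale_right:
  "scalar_product a (c *s v) = c * scalar_product a (v :: 'a::comm_semiring_1^'n)"
  by (simp add: scalar_product_def sum_distrib_left mult_ac)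

lemma scalar_product_commute: "scalar_product a v = scalar_product v (a :: 'a::comm_semiring_1^'n)"
  by (simp add: scalar_product_def mult.commute)

lemma scalar_product_transpose:
  "scalar_product a (M *v v) = scalar_product (transpose M *v a) (v :: 'a::comm_semiring_1^'n)"
  unfolding scalar_product_def matrix_vector_mult_def transpose_def
  by (simp add: sum_distrib_left sum_distrib_right)
     (subst sum.swap, simp add: mult_ac)

lemma scalar_product_axis: "scalar_product (axis i 1) v = (v $ i :: 'a::comm_semiring_1)"
  by (simp add: scalar_product_def axis_def if_distrib[where f = "\<lambda>x. x * _"] cong: if_cong)

lemma exponent_eqI:
  fixes m n :: "3 \<Rightarrow>\<^sub>0 nat"
  assumes "Poly_Mapping.lookup m 1 = Poly_Mapping.lookup n 1"
    "Poly_Mapping.lookup m 2 = Poly_Mapping.lookup n 2"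
    "Poly_Mapping.lookup m 3 = Poly_Mapping.lookup n 3"
  shows "m = n"
proof (rule poly_mapping_eqI)
  fix i :: 3
  show "Poly_Mapping.lookup m i = Poly_Mapping.lookup n i"
    using exhaust_3[of i] assms by auto
qed

text \<open>
  The substitution \<open>(x, x\<^sup>3, x\<^sup>9)\<close> sends distinct monomials of degree 2 to distinct powers of
  \<open>x\<close>, so a quadratic form can be read off from its values.
\<close>

lemma quadratic_form_zero:
  assumes "quadratic_form D" "\<And>v. poly_fun D v = 0"
  shows "D = 0"
proof -
  define \<kappa> where "\<kappa> m = Poly_Mapping.lookup m (1::3) + 3 * Poly_Mapping.lookup m 2
    + 9 * Poly_Mapping.lookup m 3" for m :: "3 \<Rightarrow>\<^sub>0 nat"
  have deg: "Poly_Mapping.lookup m 1 + Poly_Mapping.lookup m 2 + Poly_Mapping.lookup m 3 = 2"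
    if "m \<in> Poly_Mapping.keys D" for m
    using assms(1) that by (auto simp: quadratic_form_def sum_3)
  have inj: "m = n" if "m \<in> Poly_Mapping.keys D" "n \<in> Poly_Mapping.keys D" "\<kappa> m = \<kappa> n" for m n
    
  proof -
    have "a = a' \<and> b = b' \<and> c = c'"
      if "a + b + c = 2" "a' + b' + c' = 2" "a + 3 * b + 9 * c = a' + 3 * b' + 9 * c'"
      for a b c a' b' c' :: nat
    proof -
      have "c = 0 \<or> c = 1 \<or> c = 2" "c' = 0 \<or> c' = 1 \<or> c' = 2" using that by linarith+
      then show ?thesis using that by (elim disjE) linarith+
    qed
    from this[OF deg[OF that(1)] deg[OF that(2)] that(3)[unfolded \<kappa>_def]]
    show ?thesis by (intro exponent_eqI) auto
  qed
  define p where "p = (\<Sum>m\<in>Poly_Mapping.keys D. monom (Poly_Mapping.lookup D m) (\<kappa> m))"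
  have "poly p x = 0" for x
  proof -
    have "poly p x = poly_fun D (vector [x, x ^ 3, x ^ 9])"
      unfolding p_def poly_fun_def poly_sum
    proof (rule sum.cong[OF refl])
      fix m
      have "x ^ \<kappa> m = (\<Prod>i\<in>UNIV. (vector [x, x ^ 3, x ^ 9] :: complex^3) $ i ^ Poly_Mapping.lookup m i)"
        unfolding UNIV_3 \<kappa>_def by (simp add: power_add flip: power_mult)
      then show "poly (monom (Poly_Mapping.lookup D m) (\<kappa> m)) x = Poly_Mapping.lookup D m *
          (\<Prod>i\<in>UNIV. (vector [x, x ^ 3, x ^ 9] :: complex^3) $ i ^ Poly_Mapping.lookup m i)"
        by (simp add: poly_monom)
    qed
    then show ?thesis by (simp add: assms(2))
  qed
  then have "p = 0" using poly_all_0_iff_0 by blast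
  show ?thesis
  proof (rule poly_mapping_eqI)
    fix m
    show "Poly_Mapping.lookup D m = Poly_Mapping.lookup 0 m"
    proof (cases "m \<in> Poly_Mapping.keys D")
      case True
      have "coeff p (\<kappa> m) = (\<Sum>n\<in>Poly_Mapping.keys D. if n = m then Poly_Mapping.lookup D n else 0)"
        unfolding p_def coeff_sum by (rule sum.cong) (use inj True in auto)
      then show ?thesis using \<open>p = 0\<close> True by simp
    qed (simp add: in_keys_iff)
  qed
qed

lemma quadratic_form_eqI:
  assumes "quadratic_form P" "quadratic_form R" "\<And>v. poly_fun P v = poly_fun R v"
  shows "P = R"
proof -
  have m: "Poly_Mapping.keys (- R) = Poly_Mapping.keys R" by (auto simp: in_keys_iff)
  have "Poly_Mapping.keys (P + - R) \<subseteq> Poly_Mapping.keys P \<union> Poly_Mapping.keys R"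
    using Poly_Mapping.keys_add[of P "- R"] m by simp
  then have "quadratic_form (P + - R)"
    using assms(1,2) unfolding quadratic_form_def by blast
  moreover have "poly_fun (P + - R) v = 0" for v
    using assms(3)[of v] poly_fun_add[of "P + - R" R v] by simp
  ultimately have "P + - R = 0" by (rule quadratic_form_zero)
  then show ?thesis by simp
qed

text \<open>
  A factorization of the values is a factorization in the polynomial ring, because a quadratic form is
  determined by its values.  Neither factor is a unit, because both vanish at the origin.
\<close>

lemma irreducible_quadratic_form_not_product:
  assumes "quadratic_form Q" "irreducible Q"
  shows "\<not> (\<forall>v. poly_fun Q v = scalar_product a v * scalar_product b v)"
proof
  assume Q: "\<forall>v. poly_fun Q v = scalar_product a v * scalar_product b v"
  obtain A where A: "poly_fun A = scalar_product a"
    "\<And>m. m \<in> Poly_Mapping.keys A \<Longrightarrow> (\<Sum>i\<in>UNIV. Poly_Mapping.lookup m i) = 1"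
    by (rule linear_polynomial_exists) blast
  obtain B where B: "poly_fun B = scalar_product b"
    "\<And>m. m \<in> Poly_Mapping.keys B \<Longrightarrow> (\<Sum>i\<in>UNIV. Poly_Mapping.lookup m i) = 1"
    by (rule linear_polynomial_exists) blast
  have "quadratic_form (A * B)"
    unfolding quadratic_form_def
  proof
    fix m assume "m \<in> Poly_Mapping.keys (A * B)"
    then obtain k l where "m = k + l" "k \<in> Poly_Mapping.keys A" "l \<in> Poly_Mapping.keys B"
      using Poly_Mapping.keys_mult[of A B] by blast
    then show "(\<Sum>i\<in>UNIV. Poly_Mapping.lookup m i) = 2"
      using A(2)[of k] B(2)[of l] by (simp add: lookup_add sum.distrib)
  qed
  then have "Q = A * B"
    by (rule quadratic_form_eqI[OF assms(1)]) (simp add: poly_fun_mult A B Q)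
  then have "A dvd 1 \<or> B dvd 1" using assms(2) by (rule irreducibleD[rotated])
  moreover have "\<not> X dvd 1" if "poly_fun X = scalar_product c" for X c
  proof
    assume "X dvd 1"
    then obtain Y where "1 = X * Y" by (rule dvdE)
    then have "poly_fun 1 0 = scalar_product c 0 * poly_fun Y 0"
      using poly_fun_mult[of X Y 0] that by simp
    moreover have "poly_fun 1 0 = 1"
      using poly_fun_single[of 0 1 0] by simp
    ultimately show False by (simp add: scalar_product_def)
  qed
  ultimately show False using A(1) B(1) by blast
qed

lemma monomial_of_degree_two:
  assumes "(\<Sum>i\<in>UNIV. Poly_Mapping.lookup m i) = 2"
  shows "\<exists>i j. \<forall>v :: complex^3. (\<Prod>k\<in>UNIV. (v $ k) ^ Poly_Mapping.lookup m k) = v $ i * v $ j"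
proof -
  let ?a = "Poly_Mapping.lookup m (1 :: 3)" and ?b = "Poly_Mapping.lookup m (2 :: 3)"
    and ?c = "Poly_Mapping.lookup m (3 :: 3)"
  have sum: "?a + ?b + ?c = 2" using assms by (simp add: sum_3)
  then have "?a = 0 \<or> ?a = 1 \<or> ?a = 2" "?b = 0 \<or> ?b = 1 \<or> ?b = 2" by linarith+
  with sum consider "?a = 2" "?b = 0" "?c = 0" | "?a = 0" "?b = 2" "?c = 0" | "?a = 0" "?b = 0" "?c = 2"
    | "?a = 1" "?b = 1" "?c = 0" | "?a = 1" "?b = 0" "?c = 1" | "?a = 0" "?b = 1" "?c = 1"
    by (elim disjE) simp_all
  then have "\<exists>i j. \<forall>v :: complex^3. (v $ 1) ^ ?a * ((v $ 2) ^ ?b * (v $ 3) ^ ?c) = v $ i * v $ j"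
  proof cases
    case 1 then show ?thesis by (intro exI[of _ 1]) (simp add: power2_eq_square)
  next
    case 2 then show ?thesis by (intro exI[of _ 2]) (simp add: power2_eq_square)
  next
    case 3 then show ?thesis by (intro exI[of _ 3]) (simp add: power2_eq_square)
  next
    case 4 then show ?thesis by (intro exI[of _ 1] exI[of _ 2]) simp
  next
    case 5 then show ?thesis by (intro exI[of _ 1] exI[of _ 3]) simp
  next
    case 6 then show ?thesis by (intro exI[of _ 2] exI[of _ 3]) simp
  qed
  then show ?thesis unfolding UNIV_3 by simp
qed

lemma quadratic_form_symmetric_matrix:
  assumes "quadratic_form Q"
  obtains G :: "complex^3^3"
  where "transpose G = G" "\<And>v. poly_fun Q v = scalar_product v (G *v v)"
proof -
  define rep where "rep f \<longleftrightarrow> (\<exists>g :: 3 \<Rightarrow> 3 \<Rightarrow> complex. (\<forall>k l. g k l = g l k) \<and>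
    (\<forall>v :: complex^3. f v = (\<Sum>k\<in>UNIV. \<Sum>l\<in>UNIV. g k l * (v $ k * v $ l))))" for f
  have rep_add: "rep (\<lambda>v. f v + h v)" if f: "rep f" and h: "rep h" for f h
  proof -
    obtain g1 where g1: "\<forall>k l. g1 k l = g1 l k"
      "\<forall>v. f v = (\<Sum>k\<in>UNIV. \<Sum>l\<in>UNIV. g1 k l * (v $ k * v $ l))"
      using f unfolding rep_def by blast
    obtain g2 where g2: "\<forall>k l. g2 k l = g2 l k"
      "\<forall>v. h v = (\<Sum>k\<in>UNIV. \<Sum>l\<in>UNIV. g2 k l * (v $ k * v $ l))"
      using h unfolding rep_def by blast
    show ?thesis
      unfolding rep_def
      by (rule exI[of _ "\<lambda>k l. g1 k l + g2 k l"]) (use g1 g2 in \<open>simp add: distrib_right sum.distrib\<close>)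
  qed
  have rep_zero: "rep (\<lambda>v. 0)"
    unfolding rep_def by (rule exI[of _ "\<lambda>k l. 0"]) simp
  have rep_monomial: "rep (\<lambda>v. c * (v $ i * v $ j))" for c i j
  proof -
    have pick: "(\<Sum>k\<in>UNIV. \<Sum>l\<in>UNIV. (if k = i \<and> l = j then c / 2 else 0) * ((v::complex^3) $ k * v $ l))
        = c / 2 * (v $ i * v $ j)" for i j v
    proof -
      have "(\<Sum>l\<in>UNIV. (if k = i \<and> l = j then c / 2 else 0) * (v $ k * v $ l))
          = (if k = i then c / 2 * (v $ i * v $ j) else 0)" for k
        by (cases "k = i") (simp_all add: if_distrib[where f = "\<lambda>x. x * _"] cong: if_cong)
      then show ?thesis by simp
    qed
    show ?thesis
      unfolding rep_def
      by (rule exI[of _ "\<lambda>k l. (if k = i \<and> l = j then c / 2 else 0) + (if k = j \<and> l = i then c / 2 else 0)"])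
         (simp only: distrib_right sum.distrib pick, simp add: conj_commute mult.commute)
  qed
  have "rep (\<lambda>v. \<Sum>m\<in>K. Poly_Mapping.lookup Q m * (\<Prod>i\<in>UNIV. (v $ i) ^ Poly_Mapping.lookup m i))"
    if "finite K" "K \<subseteq> Poly_Mapping.keys Q" for K
    using that
  proof (induction K)
    case (insert m K)
    then obtain i j where "\<forall>v :: complex^3. (\<Prod>k\<in>UNIV. (v $ k) ^ Poly_Mapping.lookup m k) = v $ i * v $ j"
      using monomial_of_degree_two[of m] assms by (auto simp: quadratic_form_def)
    then show ?case using insert by (simp add: rep_add rep_monomial)
  qed (simp add: rep_zero)
  then have "rep (poly_fun Q)"
    unfolding poly_fun_def[abs_def] by simp
  then obtain g where g: "\<forall>k l. g k l = g l k"
    "\<And>v. poly_fun Q v = (\<Sum>k\<in>UNIV. \<Sum>l\<in>UNIV. g k l * (v $ k * v $ l))"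
    unfolding rep_def by blast
  show ?thesis
  proof (rule that[of "\<chi> k l. g k l"])
    show "transpose (\<chi> k l. g k l) = (\<chi> k l. g k l)"
      using g(1) by (simp add: transpose_def vec_eq_iff)
    show "poly_fun Q v = scalar_product v ((\<chi> k l. g k l) *v v)" for v
      by (simp add: g(2) scalar_product_def matrix_vector_mult_def sum_distrib_left mult_ac)
  qed
qed

text \<open>
  Gram--Schmidt: as long as the form does not vanish on the orthogonal complement of the vectors
  found so far, a further unit vector can be split off.  Stopping after at most two steps exhibits
  the form as a product of two linear forms.
\<close>

lemma bilinear_form_product_or_orthonormal:
  fixes G :: "complex^3^3"
  assumes sym: "transpose G = G"
  defines "B \<equiv> \<lambda>v w. scalar_product v (G *v w)"
  obtains
    (product) a b where "\<And>v. B v v = scalar_product a v * scalar_product b v"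
  | (orthonormal) e :: "3 \<Rightarrow> complex^3"
    where "\<And>i j. B (e i) (e j) = (if i = j then 1 else 0)"
proof -
  have B_add: "B (u + v) w = B u w + B v w" "B w (u + v) = B w u + B w v" for u v w
    by (simp_all add: B_def scalar_product_add_left scalar_product_add_right matrix_vector_right_distrib)
  have B_scale: "B (c *s v) w = c * B v w" "B v (c *s w) = c * B v w" for c v w
    by (simp_all add: B_def scalar_product_scale_left scalar_product_scale_right
        matrix_vector_mult_scaleR vector_scalar_commute)
  have B_sym: "B v w = B w v" for v w
    unfolding B_def by (subst scalar_product_transpose) (simp add: sym scalar_product_commute)
  have B_lin: "B u v = scalar_product (G *v u) v" for u v
    using B_sym[of u v] by (simp add: B_def scalar_product_commute)
  have B_diff: "B (u - v) w = B u w - B v w" "B w (u - v) = B w u - B w v" for u v w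
    using B_add(1)[of "u - v" v w] B_add(2)[of w "u - v" v] by simp_all
  note B_simps = B_add B_diff B_scale
  have unit: "B ((1 / csqrt (B u u)) *s u) ((1 / csqrt (B u u)) *s u) = 1" if "B u u \<noteq> 0" for u
  proof -
    have "csqrt (B u u) * csqrt (B u u) = B u u" by (metis power2_csqrt power2_eq_square)
    then show ?thesis using that by (simp add: B_scale divide_simps)
  qed
  show ?thesis
  proof (cases "\<forall>v. B v v = 0")
    case True
    then show ?thesis by (intro product[of 0 0]) (simp add: scalar_product_def)
  next
    case False
    then obtain v0 where v0: "B v0 v0 = 1" using unit by blast
    show ?thesis
    proof (cases "\<forall>v. B v0 v = 0 \<longrightarrow> B v v = 0")
      case True
      have "B v v = scalar_product (G *v v0) v * scalar_product (G *v v0) v" for v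
      proof -
        let ?w = "v - B v0 v *s v0"
        have "B v0 ?w = 0" by (simp add: B_simps v0)
        then have "B ?w ?w = 0" using True by blast
        then have "B v v = B v0 v * B v0 v"
          using v0 B_sym[of v v0] by (simp add: B_simps algebra_simps)
        then show ?thesis by (simp add: B_lin)
      qed
      then show ?thesis by (rule product)
    next
      case False
      then obtain u1 where u1: "B v0 u1 = 0" "B u1 u1 \<noteq> 0" by blast
      define v1 where "v1 = (1 / csqrt (B u1 u1)) *s u1"
      have v1: "B v1 v1 = 1" "B v0 v1 = 0" "B v1 v0 = 0"
        using unit[OF u1(2)] u1(1) B_sym[of u1 v0] by (simp_all add: v1_def B_scale)
      show ?thesis
      proof (cases "\<forall>v. B v0 v = 0 \<and> B v1 v = 0 \<longrightarrow> B v v = 0")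
        case True
        have "B v v = scalar_product (G *v (v0 + \<i> *s v1)) v * scalar_product (G *v (v0 - \<i> *s v1)) v" for v
        proof -
          let ?w = "v - B v0 v *s v0 - B v1 v *s v1"
          have "B v0 ?w = 0" "B v1 ?w = 0" by (simp_all add: B_simps v0 v1)
          then have "B ?w ?w = 0" using True by blast
          then have "B v v = B v0 v * B v0 v + B v1 v * B v1 v"
            using v0 v1 B_sym[of v v0] B_sym[of v v1] by (simp add: B_simps algebra_simps)
          then have "B v v = B (v0 + \<i> *s v1) v * B (v0 - \<i> *s v1) v"
            by (simp add: B_simps algebra_simps)
          then show ?thesis by (simp add: B_lin)
        qed
        then show ?thesis by (rule product)
      next
        case False
        then obtain u2 where u2: "B v0 u2 = 0" "B v1 u2 = 0" "B u2 u2 \<noteq> 0" by blast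
        define v2 where "v2 = (1 / csqrt (B u2 u2)) *s u2"
        have v2: "B v2 v2 = 1" "B v0 v2 = 0" "B v2 v0 = 0" "B v1 v2 = 0" "B v2 v1 = 0"
          using unit[OF u2(3)] u2 B_sym[of u2 v0] B_sym[of u2 v1] by (simp_all add: v2_def B_scale)
        define e :: "3 \<Rightarrow> complex^3" where "e i = (if i = 1 then v0 else if i = 2 then v1 else v2)" for i
        have "B (e i) (e j) = (if i = j then 1 else 0)" for i j
          using exhaust_3[of i] exhaust_3[of j] v0 v1 v2 by (auto simp: e_def)
        then show ?thesis by (rule orthonormal)
      qed
    qed
  qed
qed

text \<open>
  With the vectors as rows of \<open>N\<close>, orthonormality says that \<open>transpose N\<close> is a right inverse of
  \<open>N ** G\<close>.  The number of vectors is the dimension, so it is a left inverse as well, and this is the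
  expansion.
\<close>

lemma bilinear_form_orthonormal_expansion:
  fixes G :: "complex^3^3" and e :: "3 \<Rightarrow> complex^3"
  assumes "\<And>i j. scalar_product (e i) (G *v e j) = (if i = j then 1 else 0)"
  shows "v = (\<Sum>i\<in>UNIV. scalar_product (e i) (G *v v) *s e i)"
proof -
  define N :: "complex^3^3" where "N = (\<chi> i. e i)"
  have "(N ** G) ** transpose N = mat 1"
  proof -
    have "((N ** G) ** transpose N) $ i $ j = scalar_product (e i) (G *v e j)" for i j
    proof -
      have "((N ** G) ** transpose N) = N ** (G ** transpose N)"
        by (simp add: matrix_mul_assoc)
      then show ?thesis
        by (simp add: N_def matrix_matrix_mult_def transpose_def matrix_vector_mult_def
            scalar_product_def)
    qed
    then show ?thesis by (simp add: vec_eq_iff mat_def assms)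
  qed
  then have "transpose N ** (N ** G) = mat 1" by (simp add: matrix_left_right_inverse)
  then have "v = (transpose N ** (N ** G)) *v v" by simp
  also have "\<dots> = transpose N *v (N *v (G *v v))" by (simp add: matrix_vector_mul_assoc matrix_mul_assoc)
  also have "\<dots> = (\<Sum>i\<in>UNIV. scalar_product (e i) (G *v v) *s e i)"
    by (simp add: vec_eq_iff N_def transpose_def matrix_vector_mult_def scalar_product_def mult.commute)
  finally show ?thesis .
qed

text \<open>
  The linear forms \<open>\<alpha>, \<beta>, \<gamma>\<close> give the coordinates \<open>a, b, c\<close> of a point, and \<open>m1, m2, m3\<close> is the
  dual basis.
\<close>

locale null_coordinates =
  fixes Q :: polynomial3 and \<alpha> \<beta> \<gamma> m1 m2 m3 :: "complex^3"
  assumes value_eq: "poly_fun Q v = scalar_product \<gamma> v ^ 2 - scalar_product \<alpha> v * scalar_product \<beta> v"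
    and expansion: "v = scalar_product \<alpha> v *s m1 + scalar_product \<beta> v *s m2 + scalar_product \<gamma> v *s m3"
    and dual:
      "scalar_product \<alpha> m1 = 1" "scalar_product \<alpha> m2 = 0" "scalar_product \<alpha> m3 = 0"
      "scalar_product \<beta> m1 = 0" "scalar_product \<beta> m2 = 1" "scalar_product \<beta> m3 = 0"
      "scalar_product \<gamma> m1 = 0" "scalar_product \<gamma> m2 = 0" "scalar_product \<gamma> m3 = 1"

text \<open>
  In an orthonormal basis the form is \<open>x\<^sup>2 + y\<^sup>2 + z\<^sup>2\<close>, and \<open>- (y\<^sup>2 + z\<^sup>2)\<close> is the product of \<open>y + \<i> z\<close>
  and \<open>\<i> z - y\<close>.
\<close>

lemma irreducible_quadratic_form_null_coordinates:
  assumes "quadratic_form Q" "irreducible Q"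
  obtains \<alpha> \<beta> \<gamma> m1 m2 m3 where "null_coordinates Q \<alpha> \<beta> \<gamma> m1 m2 m3"
proof -
  obtain G where G: "transpose G = G" "\<And>v. poly_fun Q v = scalar_product v (G *v v)"
    using quadratic_form_symmetric_matrix[OF assms(1)] by blast
  from G(1) show ?thesis
  proof (cases rule: bilinear_form_product_or_orthonormal)
    case (product a b)
    then show ?thesis using irreducible_quadratic_form_not_product[OF assms] G(2) by metis
  next
    case (orthonormal e)
    define x where "x i v = scalar_product (e i) (G *v v)" for i v
    have x: "x i v = scalar_product (G *v e i) v" for i v
      unfolding x_def by (subst scalar_product_transpose) (simp add: G(1))
    have xe: "scalar_product (G *v e i) (e j) = (if i = j then 1 else 0)" for i j
      using orthonormal[of i j] x[of i "e j"] by (simp add: x_def)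
    have ex: "v = x 1 v *s e 1 + x 2 v *s e 2 + x 3 v *s e 3" for v
      using bilinear_form_orthonormal_expansion[OF orthonormal, of v] by (simp add: x_def sum_3)
    have Q: "poly_fun Q v = x 1 v ^ 2 + x 2 v ^ 2 + x 3 v ^ 2" for v
    proof -
      have "poly_fun Q v = scalar_product (x 1 v *s e 1 + x 2 v *s e 2 + x 3 v *s e 3) (G *v v)"
        using G(2)[of v] ex[of v] by simp
      then show ?thesis
        by (simp add: scalar_product_add_left scalar_product_scale_left x_def power2_eq_square)
    qed
    let ?\<alpha> = "G *v e 2 + \<i> *s (G *v e 3)" and ?\<beta> = "\<i> *s (G *v e 3) + (-1) *s (G *v e 2)"
    let ?m1 = "(1/2) *s e 2 + (- \<i>/2) *s e 3" and ?m2 = "(-1/2) *s e 2 + (- \<i>/2) *s e 3"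
    have ab: "scalar_product ?\<alpha> v = x 2 v + \<i> * x 3 v" "scalar_product ?\<beta> v = \<i> * x 3 v - x 2 v" for v
      by (simp_all only: x scalar_product_add_left scalar_product_scale_left) simp
    have "null_coordinates Q ?\<alpha> ?\<beta> (G *v e 1) ?m1 ?m2 (e 1)"
    proof
      fix v
      show "poly_fun Q v = scalar_product (G *v e 1) v ^ 2 - scalar_product ?\<alpha> v * scalar_product ?\<beta> v"
        unfolding ab Q x[symmetric] by (simp add: algebra_simps power2_eq_square)
      show "v = scalar_product ?\<alpha> v *s ?m1 + scalar_product ?\<beta> v *s ?m2 + scalar_product (G *v e 1) v *s e 1"
        unfolding ab x[symmetric]
        by (subst ex[of v]) (simp add: vec_eq_iff field_simps)
    qed (simp_all only: scalar_product_add_left scalar_product_add_right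
         scalar_product_scale_left scalar_product_scale_right xe, simp_all)
    then show ?thesis by (rule that)
  qed
qed

section \<open>Sylvester's representation\<close>

text \<open>
  Quadratic factors, rather than linear ones, are split off because a linear form in \<open>a, b, c\<close> becomes
  a binary quadratic form on the null cone.
\<close>

lemma poly_factor_degree_two:
  fixes p :: "complex poly"
  obtains q r where "p = q * r" "degree q \<le> 2" "degree r \<le> degree p - 2"
proof (cases "degree p \<le> 2")
  case True
  then show ?thesis by (intro that[of p 1]) auto
next
  case False
  then have p0: "\<not> constant (poly p)" by (simp add: constant_degree)
  then obtain z where "poly p z = 0" using fundamental_theorem_of_algebra by blast
  then obtain r where r: "p = [:- z, 1:] * r" by (auto simp: poly_eq_0_iff_dvd elim: dvdE)
  then have r0: "r \<noteq> 0" using False by auto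
  then have "degree p = Suc (degree r)" unfolding r by (subst degree_mult_eq) auto
  with False have "\<not> constant (poly r)" by (simp add: constant_degree)
  then obtain w where "poly r w = 0" using fundamental_theorem_of_algebra by blast
  then obtain s where s: "r = [:- w, 1:] * s" by (auto simp: poly_eq_0_iff_dvd elim: dvdE)
  then have s0: "s \<noteq> 0" using r0 by auto
  then have "degree r = Suc (degree s)" unfolding s by (subst degree_mult_eq) auto
  show ?thesis
  proof (rule that[of "[:- z, 1:] * [:- w, 1:]" s])
    show "p = [:- z, 1:] * [:- w, 1:] * s" using r s by (simp only: mult.assoc)
    show "degree ([:- z, 1:] * [:- w, 1:]) \<le> 2" by simp
    show "degree s \<le> degree p - 2"
      using \<open>degree p = Suc (degree r)\<close> \<open>degree r = Suc (degree s)\<close> by simp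
  qed
qed

lemma poly_factors_degree_two:
  fixes p :: "complex poly"
  assumes "degree p \<le> 2 * Suc d"
  shows "\<exists>q. (\<forall>l. degree (q l) \<le> 2) \<and> p = (\<Prod>l=1..Suc d. q l)"
  using assms
proof (induction d arbitrary: p)
  case 0
  then show ?case by (intro exI[of _ "\<lambda>_. p"]) auto
next
  case (Suc d)
  obtain q r where qr: "p = q * r" "degree q \<le> 2" "degree r \<le> degree p - 2"
    by (rule poly_factor_degree_two)
  then have "degree r \<le> 2 * Suc d" using Suc.prems by simp
  then obtain u where u: "\<forall>l. degree (u l) \<le> 2" "r = (\<Prod>l=1..Suc d. u l)"
    using Suc.IH by blast
  have "(\<Prod>l=1..Suc d. (u(Suc (Suc d) := q)) l) = (\<Prod>l=1..Suc d. u l)"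
    by (rule prod.cong) auto
  then have "p = (\<Prod>l=1..Suc (Suc d). (u(Suc (Suc d) := q)) l)"
    using qr(1) u(2) by (simp add: mult.commute)
  then show ?case using u(1) qr(2) by (intro exI[of _ "u(Suc (Suc d) := q)"]) auto
qed

context null_coordinates
begin

text \<open>
  For \<open>i \<le> 2 k\<close> this is a monomial of degree \<open>k\<close> in the coordinates, of degree at most one in \<open>c\<close>.  At
  the point \<open>(s\<^sup>2, t\<^sup>2, s t)\<close> of the null cone it takes the value \<open>s\<^sup>i t\<^bsup>2 k - i\<^esup>\<close>.
\<close>

definition cone_monomial :: "nat \<Rightarrow> nat \<Rightarrow> complex^3 \<Rightarrow> complex" where
  "cone_monomial k i v = (if even i
     then scalar_product \<alpha> v ^ (i div 2) * scalar_product \<beta> v ^ (k - i div 2)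
     else scalar_product \<gamma> v * (scalar_product \<alpha> v ^ (i div 2) * scalar_product \<beta> v ^ (k - 1 - i div 2)))"

text \<open>
  The polynomial \<open>p\<close> stands for the binary form of degree \<open>2 k\<close> whose coefficients it has.
\<close>

definition from_symbol :: "nat \<Rightarrow> complex poly \<Rightarrow> complex^3 \<Rightarrow> complex" where
  "from_symbol k p v = (\<Sum>i\<le>2*k. coeff p i * cone_monomial k i v)"

text \<open>
  The functions that agree on the quadric with a polynomial of degree at most \<open>d\<close>: there \<open>c\<^sup>2\<close> can be
  eliminated from a polynomial.
\<close>

definition quadric_polys :: "nat \<Rightarrow> (complex^3 \<Rightarrow> complex) set" where
  "quadric_polys d = {f. \<exists>c. \<forall>v\<in>quadric Q. f v = (\<Sum>k\<le>d. \<Sum>i\<le>2*k. c k i * cone_monomial k i v)}"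

lemma quadric_polys_cong:
  "\<lbrakk>f \<in> quadric_polys d; \<And>v. v \<in> quadric Q \<Longrightarrow> g v = f v\<rbrakk> \<Longrightarrow> g \<in> quadric_polys d"
  unfolding quadric_polys_def by auto

lemma quadric_polys_add:
  assumes "f \<in> quadric_polys d" "g \<in> quadric_polys d"
  shows "(\<lambda>v. f v + g v) \<in> quadric_polys d"
proof -
  obtain c b where "\<forall>v\<in>quadric Q. f v = (\<Sum>k\<le>d. \<Sum>i\<le>2*k. c k i * cone_monomial k i v)"
    "\<forall>v\<in>quadric Q. g v = (\<Sum>k\<le>d. \<Sum>i\<le>2*k. b k i * cone_monomial k i v)"
    using assms unfolding quadric_polys_def by blast
  then have "\<forall>v\<in>quadric Q. f v + g v = (\<Sum>k\<le>d. \<Sum>i\<le>2*k. (c k i + b k i) * cone_monomial k i v)"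
    by (simp add: distrib_right sum.distrib)
  then show ?thesis
    unfolding quadric_polys_def by (intro CollectI exI[of _ "\<lambda>k i. c k i + b k i"])
qed

lemma quadric_polys_scale:
  assumes "f \<in> quadric_polys d"
  shows "(\<lambda>v. a * f v) \<in> quadric_polys d"
proof -
  obtain c where "\<forall>v\<in>quadric Q. f v = (\<Sum>k\<le>d. \<Sum>i\<le>2*k. c k i * cone_monomial k i v)"
    using assms unfolding quadric_polys_def by blast
  then have "\<forall>v\<in>quadric Q. a * f v = (\<Sum>k\<le>d. \<Sum>i\<le>2*k. (a * c k i) * cone_monomial k i v)"
    by (simp add: sum_distrib_left mult.assoc)
  then show ?thesis
    unfolding quadric_polys_def by (intro CollectI exI[of _ "\<lambda>k i. a * c k i"])
qed

lemma quadric_polys_zero: "(\<lambda>v. 0) \<in> quadric_polys d"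
  unfolding quadric_polys_def by (auto intro!: exI[of _ "\<lambda>_ _. 0"])

lemma quadric_polys_sum:
  assumes "\<And>i. i \<in> I \<Longrightarrow> f i \<in> quadric_polys d"
  shows "(\<lambda>v. \<Sum>i\<in>I. f i v) \<in> quadric_polys d"
  using assms
  by (induction I rule: infinite_finite_induct) (auto intro: quadric_polys_zero quadric_polys_add)

lemma cone_monomial_in_quadric_polys:
  assumes "k \<le> d" "i \<le> 2 * k"
  shows "cone_monomial k i \<in> quadric_polys d"
proof -
  have "(\<Sum>l\<le>d. \<Sum>j\<le>2*l. (if l = k \<and> j = i then 1 else 0) * cone_monomial l j v) = cone_monomial k i v" for v
  proof -
    have "(\<Sum>j\<le>2*l. (if l = k \<and> j = i then 1 else 0) * cone_monomial l j v)
        = (if l = k then cone_monomial k i v else 0)" for l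
      using assms(2) by (cases "l = k") (simp_all add: if_distrib[where f = "\<lambda>x. x * _"] cong: if_cong)
    then show ?thesis using assms(1) by simp
  qed
  then show ?thesis unfolding quadric_polys_def by (auto intro!: exI[of _ "\<lambda>l j. if l = k \<and> j = i then 1 else 0"])
qed

lemma quadric_polys_mono: "d \<le> d' \<Longrightarrow> quadric_polys d \<subseteq> quadric_polys d'"
proof
  fix f assume "d \<le> d'" "f \<in> quadric_polys d"
  then obtain c where c: "\<forall>v\<in>quadric Q. f v = (\<Sum>k\<le>d. \<Sum>i\<le>2*k. c k i * cone_monomial k i v)"
    unfolding quadric_polys_def by blast
  have "(\<lambda>v. \<Sum>k\<le>d. \<Sum>i\<le>2*k. c k i * cone_monomial k i v) \<in> quadric_polys d'"
    using \<open>d \<le> d'\<close> by (intro quadric_polys_sum quadric_polys_scale cone_monomial_in_quadric_polys) auto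
  then show "f \<in> quadric_polys d'" by (rule quadric_polys_cong) (use c in auto)
qed

lemma quadric_equation:
  "v \<in> quadric Q \<longleftrightarrow> scalar_product \<gamma> v ^ 2 = 1 + scalar_product \<alpha> v * scalar_product \<beta> v"
  by (auto simp: quadric_def value_eq algebra_simps)

text \<open>
  On the null cone the monomials multiply by adding indices.  Only the product of two monomials with a
  factor \<open>c\<close> behaves differently on the quadric: \<open>c\<^sup>2 = 1 + a b\<close> leaves a remainder two degrees lower.
\<close>

lemma cone_monomial_mult:
  assumes v: "v \<in> quadric Q" and i: "i \<le> 2" and j: "j \<le> 2 * k"
  shows "cone_monomial 1 i v * cone_monomial k j v =
    cone_monomial (Suc k) (i + j) v + (if i = 1 \<and> odd j then cone_monomial (k - 1) (j - 1) v else 0)"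
proof -
  let ?a = "scalar_product \<alpha> v" and ?b = "scalar_product \<beta> v" and ?c = "scalar_product \<gamma> v"
  define n where "n = j div 2"
  consider (even) "j = 2 * n" "n \<le> k" | (odd) m where "j = Suc (2 * n)" "k = Suc (n + m)"
  proof (cases "even j")
    case True then show ?thesis using j even by (auto simp: n_def)
  next
    case False
    then have "j = Suc (2 * n)" by (simp add: n_def)
    moreover from this j have "n < k" by simp
    ultimately show ?thesis using odd[of "k - Suc n"] by simp
  qed
  note cases_j = this
  consider "i = 0" | "i = 1" | "i = 2" using i by linarith
  then show ?thesis
  proof cases
    case 1
    from cases_j show ?thesis
    proof cases
      case even then show ?thesis using 1 by (simp add: cone_monomial_def Suc_diff_le)
    next
      case odd then show ?thesis using 1 by (simp add: cone_monomial_def)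
    qed
  next
    case 2
    from cases_j show ?thesis
    proof cases
      case even then show ?thesis using 2 by (simp add: cone_monomial_def)
    next
      case (odd m)
      have "?c * ?c = 1 + ?a * ?b" using v by (simp add: quadric_equation power2_eq_square)
      then have "?c * (?c * (?a ^ n * ?b ^ m)) = (1 + ?a * ?b) * (?a ^ n * ?b ^ m)"
        by (simp flip: mult.assoc)
      then show ?thesis using 2 odd by (simp add: cone_monomial_def algebra_simps)
    qed
  next
    case 3
    from cases_j show ?thesis
    proof cases
      case even then show ?thesis using 3 by (simp add: cone_monomial_def)
    next
      case odd then show ?thesis using 3 by (simp add: cone_monomial_def)
    qed
  qed
qed

lemma cone_monomial_mult_in_quadric_polys:
  assumes "i \<le> 2" "j \<le> 2 * k" "k \<le> d"
  shows "(\<lambda>v. cone_monomial 1 i v * cone_monomial k j v) \<in> quadric_polys (Suc d)"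
proof (rule quadric_polys_cong)
  show "(\<lambda>v. cone_monomial (Suc k) (i + j) v + (if i = 1 \<and> odd j then cone_monomial (k - 1) (j - 1) v else 0))
      \<in> quadric_polys (Suc d)"
  proof (intro quadric_polys_add)
    show "cone_monomial (Suc k) (i + j) \<in> quadric_polys (Suc d)"
      using assms by (intro cone_monomial_in_quadric_polys) auto
    show "(\<lambda>v. if i = 1 \<and> odd j then cone_monomial (k - 1) (j - 1) v else 0) \<in> quadric_polys (Suc d)"
    proof (cases "i = 1 \<and> odd j")
      case True
      then have "j - 1 \<le> 2 * (k - 1)" using assms by (auto elim!: oddE)
      then show ?thesis using True assms by (auto intro!: cone_monomial_in_quadric_polys)
    qed (auto intro!: quadric_polys_zero)
  qed
qed (use assms cone_monomial_mult in auto)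

lemma linear_form_cone_monomial:
  "scalar_product a v = (\<Sum>i\<le>2. [scalar_product a m2, scalar_product a m3, scalar_product a m1] ! i * cone_monomial 1 i v)"
proof -
  have "scalar_product a v = scalar_product \<alpha> v * scalar_product a m1 +
      scalar_product \<beta> v * scalar_product a m2 + scalar_product \<gamma> v * scalar_product a m3"
    by (subst expansion[of v]) (simp only: scalar_product_add_right scalar_product_scale_right)
  then show ?thesis
    by (simp add: numeral_2_eq_2 cone_monomial_def mult.commute)
qed

lemma linear_form_mult_quadric_polys:
  assumes "f \<in> quadric_polys d"
  shows "(\<lambda>v. scalar_product a v * f v) \<in> quadric_polys (Suc d)"
proof -
  obtain c where c: "\<forall>v\<in>quadric Q. f v = (\<Sum>k\<le>d. \<Sum>j\<le>2*k. c k j * cone_monomial k j v)"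
    using assms unfolding quadric_polys_def by blast
  let ?l = "[scalar_product a m2, scalar_product a m3, scalar_product a m1]"
  have "(\<lambda>v. \<Sum>i\<le>2. \<Sum>k\<le>d. \<Sum>j\<le>2*k. ?l ! i * (c k j * (cone_monomial 1 i v * cone_monomial k j v))) \<in> quadric_polys (Suc d)"
    by (intro quadric_polys_sum quadric_polys_scale cone_monomial_mult_in_quadric_polys) auto
  then show ?thesis
  proof (rule quadric_polys_cong)
    fix v assume "v \<in> quadric Q"
    then have "scalar_product a v * f v = (\<Sum>i\<le>2. ?l ! i * cone_monomial 1 i v) *
        (\<Sum>k\<le>d. \<Sum>j\<le>2*k. c k j * cone_monomial k j v)"
      using c linear_form_cone_monomial[of a v] by simp
    also have "\<dots> = (\<Sum>i\<le>2. \<Sum>k\<le>d. \<Sum>j\<le>2*k. ?l ! i * (c k j * (cone_monomial 1 i v * cone_monomial k j v)))"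
      by (simp only: sum_product sum_distrib_left sum_distrib_right mult_ac)
    finally show "scalar_product a v * f v =
        (\<Sum>i\<le>2. \<Sum>k\<le>d. \<Sum>j\<le>2*k. ?l ! i * (c k j * (cone_monomial 1 i v * cone_monomial k j v)))" .
  qed
qed

lemma polynomial_in_quadric_polys: "\<exists>d. poly_fun P \<in> quadric_polys d"
proof -
  define V where "V = (\<Union>d. quadric_polys d)"
  have V_add: "(\<lambda>v. f v + g v) \<in> V" if f: "f \<in> V" and g: "g \<in> V" for f g
  proof -
    obtain d1 d2 where "f \<in> quadric_polys d1" "g \<in> quadric_polys d2"
      using f g unfolding V_def by blast
    then have "f \<in> quadric_polys (max d1 d2)" "g \<in> quadric_polys (max d1 d2)"
      using quadric_polys_mono[of d1 "max d1 d2"] quadric_polys_mono[of d2 "max d1 d2"] by auto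
    then show ?thesis unfolding V_def using quadric_polys_add by blast
  qed
  have V_coordinate: "(\<lambda>v. (v $ i) ^ n * f v) \<in> V" if "f \<in> V" for f i n
  proof (induction n)
    case (Suc n)
    then obtain d where "(\<lambda>v. (v $ i) ^ n * f v) \<in> quadric_polys d" unfolding V_def by blast
    then have "(\<lambda>v. scalar_product (axis i 1) v * ((v $ i) ^ n * f v)) \<in> quadric_polys (Suc d)"
      by (rule linear_form_mult_quadric_polys)
    then show ?case unfolding V_def by (auto simp: mult.assoc scalar_product_axis)
  qed (use that in simp)
  have V_const: "(\<lambda>v. c) \<in> V" for c
  proof -
    have "cone_monomial 0 0 \<in> quadric_polys 0" by (rule cone_monomial_in_quadric_polys) auto
    then have "(\<lambda>v. c * cone_monomial 0 0 v) \<in> quadric_polys 0" by (rule quadric_polys_scale)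
    then show ?thesis unfolding V_def by (auto simp: cone_monomial_def)
  qed
  have "(\<lambda>v. \<Sum>m\<in>K. Poly_Mapping.lookup P m * (\<Prod>i\<in>UNIV. (v $ i) ^ Poly_Mapping.lookup m i)) \<in> V"
    if "finite K" for K
    using that
  proof (induction K)
    case (insert m K)
    have "(\<lambda>v. (v $ 1) ^ Poly_Mapping.lookup m 1 * ((v $ 2) ^ Poly_Mapping.lookup m 2 *
        ((v $ 3) ^ Poly_Mapping.lookup m 3 * Poly_Mapping.lookup P m))) \<in> V"
      by (intro V_coordinate V_const)
    moreover have "(\<Prod>i\<in>UNIV. ((v :: complex^3) $ i) ^ Poly_Mapping.lookup m i) =
      (v $ 1) ^ Poly_Mapping.lookup m 1 * ((v $ 2) ^ Poly_Mapping.lookup m 2 *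
        (v $ 3) ^ Poly_Mapping.lookup m 3)" for v
      unfolding UNIV_3 by simp
    ultimately have "(\<lambda>v. Poly_Mapping.lookup P m * (\<Prod>i\<in>UNIV. (v $ i) ^ Poly_Mapping.lookup m i)) \<in> V"
      by (simp add: mult_ac)
    then show ?case using insert V_add by simp
  qed (simp add: V_const)
  then have "poly_fun P \<in> V" unfolding poly_fun_def[abs_def] by simp
  then show ?thesis unfolding V_def by blast
qed

text \<open>The linear form whose symbol is the polynomial \<open>q\<close> of degree at most 2.\<close>

definition linear_form_of_symbol :: "complex poly \<Rightarrow> complex^3" where
  "linear_form_of_symbol q = coeff q 0 *s \<beta> + coeff q 1 *s \<gamma> + coeff q 2 *s \<alpha>"

lemma linear_form_of_symbol:
  "scalar_product (linear_form_of_symbol q) v = from_symbol 1 q v"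
  by (simp add: linear_form_of_symbol_def from_symbol_def numeral_2_eq_2 cone_monomial_def
      scalar_product_add_left scalar_product_scale_left)

text \<open>
  The remainders have degree \<open>k\<close>, hence do not affect the leading part.
\<close>

lemma symbol_mult:
  assumes q: "degree q \<le> 2" and p: "degree p \<le> 2 * Suc k"
  shows "(\<lambda>v. from_symbol 1 q v * from_symbol (Suc k) p v - from_symbol (Suc (Suc k)) (q * p) v) \<in> quadric_polys (Suc k)"
proof (rule quadric_polys_cong)
  show "(\<lambda>v. \<Sum>i\<le>2. \<Sum>j\<le>2 * Suc k. (coeff q i * coeff p j) *
      (if i = 1 \<and> odd j then cone_monomial k (j - 1) v else 0)) \<in> quadric_polys (Suc k)" (is "?R \<in> _")
  proof (intro quadric_polys_sum quadric_polys_scale)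
    fix i j :: nat assume "i \<in> {..2}" "j \<in> {..2 * Suc k}"
    then show "(\<lambda>v. if i = 1 \<and> odd j then cone_monomial k (j - 1) v else 0) \<in> quadric_polys (Suc k)"
    proof (cases "i = 1 \<and> odd j")
      case True
      then have "j - 1 \<le> 2 * k" using \<open>j \<in> {..2 * Suc k}\<close> by (auto elim!: oddE)
      then show ?thesis using True by (auto intro!: cone_monomial_in_quadric_polys)
    qed (auto intro!: quadric_polys_zero)
  qed
  fix v assume v: "v \<in> quadric Q"
  have "from_symbol 1 q v * from_symbol (Suc k) p v = (\<Sum>i\<le>2. \<Sum>j\<le>2 * Suc k.
      (coeff q i * coeff p j) * (cone_monomial 1 i v * cone_monomial (Suc k) j v))"
    unfolding from_symbol_def sum_product by (simp add: mult_ac)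
  also have "\<dots> = (\<Sum>i\<le>2. \<Sum>j\<le>2 * Suc k. (coeff q i * coeff p j) * cone_monomial (Suc (Suc k)) (i + j) v) + ?R v"
    unfolding sum.distrib[symmetric] distrib_left[symmetric]
  proof (intro sum.cong refl)
    fix i j :: nat assume "i \<in> {..2}" "j \<in> {..2 * Suc k}"
    then have "cone_monomial 1 i v * cone_monomial (Suc k) j v = cone_monomial (Suc (Suc k)) (i + j) v +
        (if i = 1 \<and> odd j then cone_monomial k (j - 1) v else 0)"
      using cone_monomial_mult[OF v, of i j "Suc k"] by simp
    then show "coeff q i * coeff p j * (cone_monomial 1 i v * cone_monomial (Suc k) j v) =
        coeff q i * coeff p j * (cone_monomial (Suc (Suc k)) (i + j) v +
        (if i = 1 \<and> odd j then cone_monomial k (j - 1) v else 0))"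
      by (simp only:)
  qed
  also have "(\<Sum>i\<le>2. \<Sum>j\<le>2 * Suc k. (coeff q i * coeff p j) * cone_monomial (Suc (Suc k)) (i + j) v)
      = from_symbol (Suc (Suc k)) (q * p) v"
  proof -
    let ?h = "\<lambda>n. cone_monomial (Suc (Suc k)) n v"
    have "from_symbol (Suc (Suc k)) (q * p) v =
        (\<Sum>n\<le>2 + 2 * Suc k. \<Sum>i\<le>n. coeff q i * coeff p (n - i) * ?h n)"
      by (simp add: from_symbol_def coeff_mult sum_distrib_right)
    also have "\<dots> = (\<Sum>n\<le>2 + 2 * Suc k. \<Sum>i\<in>{i. i \<le> n}. coeff q i * coeff p (n - i) * ?h (i + (n - i)))"
      by (intro sum.cong) auto
    also have "\<dots> = (\<Sum>(i, j) | i + j \<le> 2 + 2 * Suc k. coeff q i * coeff p j * ?h (i + j))"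
      by (subst sum.triangle_reindex_eq) (auto simp: atMost_def)
    also have "\<dots> = (\<Sum>(i, j) \<in> {..2} \<times> {..2 * Suc k}. coeff q i * coeff p j * ?h (i + j))"
    proof (rule sum.mono_neutral_right)
      show "finite {(i, j). i + j \<le> 2 + 2 * Suc k}"
        by (rule finite_subset[of _ "{..2 + 2 * Suc k} \<times> {..2 + 2 * Suc k}"]) auto
      show "\<forall>x\<in>{(i, j). i + j \<le> 2 + 2 * Suc k} - {..2} \<times> {..2 * Suc k}.
          (case x of (i, j) \<Rightarrow> coeff q i * coeff p j * ?h (i + j)) = 0"
        using q p by (auto dest!: le_degree)
    qed auto
    finally show ?thesis by (simp only: sum.cartesian_product)
  qed
  finally show "from_symbol 1 q v * from_symbol (Suc k) p v - from_symbol (Suc (Suc k)) (q * p) v = ?R v" by simp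
qed

text \<open>
  Multiplying by one linear form after the other produces remainders of lower degree at each stage.
\<close>

lemma prod_linear_forms_symbol:
  assumes "\<And>l. degree (q l) \<le> 2"
  shows "(\<lambda>v. (\<Prod>l=1..Suc d. scalar_product (linear_form_of_symbol (q l)) v) -
      from_symbol (Suc d) (\<Prod>l=1..Suc d. q l) v) \<in> quadric_polys d"
proof (induction d)
  case 0
  then show ?case by (simp add: linear_form_of_symbol quadric_polys_zero)
next
  case (Suc d)
  let ?p = "\<Prod>l=1..Suc d. q l" and ?q = "q (Suc (Suc d))"
  have "degree ?p \<le> 2 * Suc d"
  proof -
    have "degree ?p \<le> (\<Sum>l=1..Suc d. degree (q l))" using degree_prod_sum_le[of "{1..Suc d}" q] by (simp add: o_def)
    also have "\<dots> \<le> (\<Sum>l=1..Suc d. 2)" by (rule sum_mono) (rule assms)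
    finally show ?thesis by simp
  qed
  then have "(\<lambda>v. from_symbol 1 ?q v * from_symbol (Suc d) ?p v - from_symbol (Suc (Suc d)) (?q * ?p) v) \<in> quadric_polys (Suc d)"
    by (rule symbol_mult[OF assms])
  from quadric_polys_add[OF this linear_form_mult_quadric_polys[OF Suc.IH, of "linear_form_of_symbol ?q"]]
  show ?case
    by (rule quadric_polys_cong) (simp add: linear_form_of_symbol algebra_simps)
qed

text \<open>
  The symbol of the leading part is a binary form of degree \<open>2 d\<close>; its quadratic factors give \<open>d\<close> linear forms whose
  product has the same leading part.  The difference has smaller degree.
\<close>

lemma quadric_polys_sylvester:
  assumes "f \<in> quadric_polys d"
  shows "\<exists>c0 (L :: nat \<Rightarrow> nat \<Rightarrow> complex^3). \<forall>v\<in>quadric Q. f v = c0 + (\<Sum>k=1..d. \<Prod>l=1..k. scalar_product (L k l) v)"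
  using assms
proof (induction d arbitrary: f)
  case 0
  then obtain c where "\<forall>v\<in>quadric Q. f v = (\<Sum>k\<le>0. \<Sum>i\<le>2*k. c k i * cone_monomial k i v)"
    unfolding quadric_polys_def by blast
  then show ?case by (auto simp: cone_monomial_def)
next
  case (Suc d)
  then obtain c where c: "\<forall>v\<in>quadric Q. f v = (\<Sum>k\<le>Suc d. \<Sum>i\<le>2*k. c k i * cone_monomial k i v)"
    unfolding quadric_polys_def by blast
  define p where "p = (\<Sum>i\<le>2 * Suc d. monom (c (Suc d) i) i)"
  have p_coeff: "coeff p i = c (Suc d) i" if "i \<le> 2 * Suc d" for i
    unfolding p_def coeff_sum using that by simp
  have "degree p \<le> 2 * Suc d" unfolding p_def
    by (intro degree_sum_le) (auto intro: order_trans[OF degree_monom_le])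
  then obtain q where q: "\<And>l. degree (q l) \<le> 2" "p = (\<Prod>l=1..Suc d. q l)"
    using poly_factors_degree_two by blast
  define g where "g v = f v - (\<Prod>l=1..Suc d. scalar_product (linear_form_of_symbol (q l)) v)" for v
  have "(\<lambda>v. (\<Sum>k\<le>d. \<Sum>i\<le>2*k. c k i * cone_monomial k i v) +
    (-1) * ((\<Prod>l=1..Suc d. scalar_product (linear_form_of_symbol (q l)) v) -
      from_symbol (Suc d) (\<Prod>l=1..Suc d. q l) v)) \<in> quadric_polys d"
    by (intro quadric_polys_add quadric_polys_scale prod_linear_forms_symbol q(1))
       (auto simp: quadric_polys_def)
  then have "g \<in> quadric_polys d"
  proof (rule quadric_polys_cong)
    fix v assume "v \<in> quadric Q"
    moreover have "from_symbol (Suc d) (\<Prod>l=1..Suc d. q l) v = (\<Sum>i\<le>2 * Suc d. c (Suc d) i * cone_monomial (Suc d) i v)"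
      unfolding q(2)[symmetric] from_symbol_def by (intro sum.cong) (auto simp: p_coeff)
    ultimately show "g v = (\<Sum>k\<le>d. \<Sum>i\<le>2*k. c k i * cone_monomial k i v) +
      (-1) * ((\<Prod>l=1..Suc d. scalar_product (linear_form_of_symbol (q l)) v) -
        from_symbol (Suc d) (\<Prod>l=1..Suc d. q l) v)"
      using c unfolding g_def by simp
  qed
  then obtain c0 L where L: "\<forall>v\<in>quadric Q. g v = c0 + (\<Sum>k=1..d. \<Prod>l=1..k. scalar_product (L k l) v)"
    using Suc.IH by blast
  define L' where "L' = L(Suc d := \<lambda>l. linear_form_of_symbol (q l))"
  have "f v = c0 + (\<Sum>k=1..Suc d. \<Prod>l=1..k. scalar_product (L' k l) v)" if v: "v \<in> quadric Q" for v
  proof -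
    have "(\<Sum>k=1..d. \<Prod>l=1..k. scalar_product (L' k l) v) = (\<Sum>k=1..d. \<Prod>l=1..k. scalar_product (L k l) v)"
      by (intro sum.cong) (auto simp: L'_def)
    moreover have "(\<Prod>l=1..Suc d. scalar_product (L' (Suc d) l) v) = f v - g v"
      by (simp add: L'_def g_def)
    ultimately show ?thesis using L v by (simp del: prod.cl_ivl_Suc)
  qed
  then show ?case by blast
qed

lemma polynomial_sylvester:
  "\<exists>c0 d (L :: nat \<Rightarrow> nat \<Rightarrow> complex^3). \<forall>v\<in>quadric Q. poly_fun P v = c0 + (\<Sum>k=1..d. \<Prod>l=1..k. scalar_product (L k l) v)"
proof -
  obtain d where "poly_fun P \<in> quadric_polys d" using polynomial_in_quadric_polys by blast
  from quadric_polys_sylvester[OF this] show ?thesis by (elim exE) (intro exI, assumption)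
qed

end

section \<open>Holomorphic functions of several variables\<close>

lemma norm_vector_scalar_mult: "norm (c *s v) = norm c * norm (v :: complex^'n)"
  by (simp add: norm_vec_def norm_mult L2_set_right_distrib)

lemma bounded_bilinear_vector_scalar_mult:
  "bounded_bilinear (\<lambda>c (v :: complex^'n). c *s v)"
proof
  show "\<exists>K. \<forall>c (v :: complex^'n). norm (c *s v) \<le> norm c * norm v * K"
    by (rule exI[of _ 1]) (simp add: norm_vector_scalar_mult)
qed (simp_all add: vec_eq_iff algebra_simps)

lemma bounded_linear_scalar_product: "bounded_linear (scalar_product (a :: complex^'n))"
proof -
  have "linear (scalar_product a)"
    by (rule linearI) (simp_all add: scalar_product_def sum.distrib distrib_left scaleR_sum_right)
  then show ?thesis by (simp add: linear_conv_bounded_linear)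
qed

lemma continuous_on_scalar_product [continuous_intros]:
  "continuous_on S f \<Longrightarrow> continuous_on S (\<lambda>x. scalar_product (a :: complex^'n) (f x))"
  by (rule bounded_linear.continuous_on[OF bounded_linear_scalar_product])

lemma continuous_on_vector_scalar_mult [continuous_intros]:
  "\<lbrakk>continuous_on S f; continuous_on S g\<rbrakk> \<Longrightarrow> continuous_on S (\<lambda>x. f x *s (g x :: complex^'n))"
  by (rule bounded_bilinear.continuous_on[OF bounded_bilinear_vector_scalar_mult])

definition complex_differentiable :: "(complex^'n \<Rightarrow> complex) \<Rightarrow> complex^'n \<Rightarrow> bool" where
  "complex_differentiable F w \<longleftrightarrow>
     (\<exists>D. (F has_derivative D) (at w) \<and> (\<forall>c u. D (c *s u) = c * D u))"

lemma ambient_holomorphic_on_iff: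
  "ambient_holomorphic_on F W \<longleftrightarrow> open W \<and> (\<forall>w\<in>W. complex_differentiable F w)"
  by (simp add: ambient_holomorphic_on_def complex_differentiable_def)

lemma complex_differentiable_const: "complex_differentiable (\<lambda>w. c) w"
  unfolding complex_differentiable_def by (rule exI[of _ "\<lambda>_. 0"]) simp

lemma complex_differentiable_scalar_product: "complex_differentiable (scalar_product a) w"
  unfolding complex_differentiable_def
  by (rule exI[of _ "scalar_product a"])
     (simp add: bounded_linear_imp_has_derivative bounded_linear_scalar_product scalar_product_scale_right)

lemma complex_differentiable_add:
  assumes "complex_differentiable F w" "complex_differentiable G w"
  shows "complex_differentiable (\<lambda>w. F w + G w) w"
proof -
  obtain D E where "(F has_derivative D) (at w)" "\<forall>c u. D (c *s u) = c * D u"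
    "(G has_derivative E) (at w)" "\<forall>c u. E (c *s u) = c * E u"
    using assms unfolding complex_differentiable_def by blast
  then show ?thesis unfolding complex_differentiable_def
    by (intro exI[of _ "\<lambda>u. D u + E u"]) (auto intro: has_derivative_add simp: algebra_simps)
qed

lemma complex_differentiable_mult:
  assumes "complex_differentiable F w" "complex_differentiable G w"
  shows "complex_differentiable (\<lambda>w. F w * G w) w"
proof -
  obtain D E where "(F has_derivative D) (at w)" "\<forall>c u. D (c *s u) = c * D u"
    "(G has_derivative E) (at w)" "\<forall>c u. E (c *s u) = c * E u"
    using assms unfolding complex_differentiable_def by blast
  then show ?thesis unfolding complex_differentiable_def
    by (intro exI[of _ "\<lambda>u. F w * E u + D u * G w"] conjI has_derivative_mult)
       (auto simp: algebra_simps)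
qed

lemma complex_differentiable_diff:
  assumes "complex_differentiable F w" "complex_differentiable G w"
  shows "complex_differentiable (\<lambda>w. F w - G w) w"
  using complex_differentiable_add[OF assms(1)
      complex_differentiable_mult[OF complex_differentiable_const[of "-1"] assms(2)]]
  by simp

lemma complex_differentiable_sum:
  assumes "\<And>i. i \<in> I \<Longrightarrow> complex_differentiable (F i) w"
  shows "complex_differentiable (\<lambda>w. \<Sum>i\<in>I. F i w) w"
  using assms by (induction I rule: infinite_finite_induct)
    (auto intro: complex_differentiable_const complex_differentiable_add)

lemma complex_differentiable_prod:
  assumes "\<And>i. i \<in> I \<Longrightarrow> complex_differentiable (F i) w"
  shows "complex_differentiable (\<lambda>w. \<Prod>i\<in>I. F i w) w"
  using assms by (induction I rule: infinite_finite_induct)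
    (auto intro: complex_differentiable_const complex_differentiable_mult)

lemma complex_differentiable_compose:
  assumes "complex_differentiable F w" "(h has_field_derivative h') (at (F w))"
  shows "complex_differentiable (\<lambda>w. h (F w)) w"
proof -
  obtain D where D: "(F has_derivative D) (at w)" "\<forall>c u. D (c *s u) = c * D u"
    using assms unfolding complex_differentiable_def by blast
  have "((\<lambda>w. h (F w)) has_derivative (\<lambda>u. h' * D u)) (at w)"
    using has_derivative_compose[OF D(1)] assms(2) unfolding has_field_derivative_def by blast
  then show ?thesis unfolding complex_differentiable_def
    using D(2) by (intro exI[of _ "\<lambda>u. h' * D u"]) (auto simp: mult_ac)
qed

lemma complex_differentiable_rescale:
  fixes F :: "complex^'n \<Rightarrow> complex"
  assumes "complex_differentiable g w" "complex_differentiable F (g w *s w)"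
  shows "complex_differentiable (\<lambda>w. F (g w *s w)) w"
proof -
  obtain D E where D: "(g has_derivative D) (at w)" "\<forall>c u. D (c *s u) = c * D u"
    and E: "(F has_derivative E) (at (g w *s w))" "\<forall>c u. E (c *s u) = c * E u"
    using assms unfolding complex_differentiable_def by blast
  have "((\<lambda>w. g w *s w) has_derivative (\<lambda>u. g w *s u + D u *s w)) (at w)"
    by (rule bounded_bilinear.FDERIV[OF bounded_bilinear_vector_scalar_mult D(1) has_derivative_ident])
  from has_derivative_compose[OF this E(1)]
  have *: "((\<lambda>w. F (g w *s w)) has_derivative (\<lambda>u. E (g w *s u + D u *s w))) (at w)" .
  have "g w *s (c *s u) + D (c *s u) *s w = c *s (g w *s u + D u *s w)" for c u
    using D(2) by (simp add: vec_eq_iff algebra_simps)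
  then show ?thesis unfolding complex_differentiable_def
    using * E(2) by (intro exI[of _ "\<lambda>u. E (g w *s u + D u *s w)"]) (simp only:, simp)
qed

lemma complex_differentiable_transform:
  assumes "complex_differentiable F w" "open W" "w \<in> W" "\<And>v. v \<in> W \<Longrightarrow> F v = G v"
  shows "complex_differentiable G w"
proof -
  obtain D where D: "(F has_derivative D) (at w)" "\<forall>c u. D (c *s u) = c * D u"
    using assms(1) unfolding complex_differentiable_def by blast
  have "(G has_derivative D) (at w)"
    by (rule has_derivative_transform_within_open[OF D(1) assms(2-4)])
  with D(2) show ?thesis unfolding complex_differentiable_def by blast
qed

lemma complex_differentiable_isCont: "complex_differentiable F w \<Longrightarrow> isCont F w"
  unfolding complex_differentiable_def using has_derivative_continuous by blast

lemma polynomial_functions_complex_differentiable: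
  assumes "f \<in> polynomial_functions"
  shows "complex_differentiable f w"
proof -
  have coord: "complex_differentiable (\<lambda>v. v $ i) w" for i :: 3
  proof -
    have "(\<lambda>v :: complex^3. v $ i) = scalar_product (axis i 1)"
      by (rule ext) (rule scalar_product_axis[symmetric])
    then show ?thesis by (simp only: complex_differentiable_scalar_product)
  qed
  have pow: "complex_differentiable (\<lambda>v. (v $ i) ^ n) w" for i :: 3 and n
    by (induction n) (auto intro: complex_differentiable_const complex_differentiable_mult coord)
  obtain P where "f = poly_fun P" using assms by (auto simp: polynomial_functions_def)
  then show ?thesis unfolding poly_fun_def[abs_def]
    by (auto intro!: complex_differentiable_sum complex_differentiable_mult
        complex_differentiable_const complex_differentiable_prod pow)
qed

lemma polynomial_functions_continuous_on:
  "f \<in> polynomial_functions \<Longrightarrow> continuous_on S f"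
  by (meson polynomial_functions_complex_differentiable complex_differentiable_isCont
      continuous_at_imp_continuous_on)

lemma has_field_derivative_along_line:
  fixes F :: "complex^'n \<Rightarrow> complex"
  assumes "(F has_derivative D) (at (x + z *s u))" "\<And>c u. D (c *s u) = c * D u"
  shows "((\<lambda>z. F (x + z *s u)) has_field_derivative D u) (at z)"
proof -
  have "((\<lambda>z. x + z *s u) has_derivative (\<lambda>h. h *s u)) (at z)"
    by (intro has_derivative_add[OF has_derivative_const, of _ _ _ x, simplified]
        bounded_linear_imp_has_derivative
        bounded_bilinear.bounded_linear_left[OF bounded_bilinear_vector_scalar_mult])
  from has_derivative_compose[OF this assms(1)] show ?thesis
    unfolding has_field_derivative_def using assms(2) by (simp add: mult.commute[of _ "D u"])
qed

lemma complex_differentiable_line: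
  fixes F :: "complex^'n \<Rightarrow> complex"
  assumes "complex_differentiable F (x + z *s u)"
  shows "(\<lambda>z. F (x + z *s u)) field_differentiable at z"
  using assms has_field_derivative_along_line
  unfolding complex_differentiable_def field_differentiable_def by blast

text \<open>Cauchy's inequality on complex lines bounds the derivative by the function.\<close>

lemma complex_derivative_bound:
  fixes F :: "complex^'n \<Rightarrow> complex"
  assumes hol: "\<And>w. w \<in> ball x r \<Longrightarrow> complex_differentiable F w"
    and bound: "\<And>w. w \<in> ball x r \<Longrightarrow> norm (F w) \<le> B" and "r > 0"
    and D: "(F has_derivative D) (at x)" "\<And>c u. D (c *s u) = c * D u"
  shows "norm (D u) \<le> 2 * B / r * norm u"
proof (cases "u = 0")
  case True
  then show ?thesis using D(2)[of 0 0] by simp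
next
  case False
  define \<rho> where "\<rho> = r / (2 * norm u)"
  have \<rho>: "\<rho> > 0" using False \<open>r > 0\<close> by (simp add: \<rho>_def)
  let ?f = "\<lambda>z. F (x + z *s u)"
  have in_ball: "x + z *s u \<in> ball x r" if "norm z \<le> \<rho>" for z
  proof -
    have "norm z * norm u \<le> \<rho> * norm u" using that by (intro mult_right_mono) auto
    also have "\<dots> < r" using False \<open>r > 0\<close> by (simp add: \<rho>_def)
    finally show ?thesis by (simp add: dist_norm norm_vector_scalar_mult)
  qed
  have diff: "?f field_differentiable at z" if "norm z \<le> \<rho>" for z
    using complex_differentiable_line hol in_ball that by blast
  have "norm ((deriv ^^ 1) ?f 0) \<le> fact 1 * B / \<rho> ^ 1"
  proof (rule Cauchy_inequality)
    show "?f holomorphic_on ball 0 \<rho>"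
      unfolding holomorphic_on_def using diff by (auto intro: field_differentiable_at_within)
    show "continuous_on (cball 0 \<rho>) ?f"
      by (rule continuous_at_imp_continuous_on)
         (use field_differentiable_imp_continuous_at[OF diff] in simp)
    show "norm (?f z) \<le> B" if "norm (0 - z) = \<rho>" for z
      using bound in_ball that by simp
  qed (rule \<rho>)
  moreover have "deriv ?f 0 = D u"
    by (rule DERIV_imp_deriv, rule has_field_derivative_along_line) (use D in auto)
  ultimately show ?thesis using False by (simp add: \<rho>_def field_simps)
qed

text \<open>
  By Cauchy's inequality the derivatives of a locally uniformly convergent sequence are uniformly Cauchy
  near each point, so the limit may be differentiated term by term.
\<close>

theorem weierstrass_convergence:
  fixes f :: "nat \<Rightarrow> complex^'n \<Rightarrow> complex"
  assumes hol: "\<And>n. ambient_holomorphic_on (f n) W" and W: "open W"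
    and lim: "uniform_limit W f F sequentially"
  shows "ambient_holomorphic_on F W"
  unfolding ambient_holomorphic_on_iff
proof (intro conjI ballI)
  fix p assume "p \<in> W"
  then obtain r where r: "r > 0" "ball p r \<subseteq> W" using W openE by blast
  define S where "S = ball p (r / 2)"
  have ball_sub: "ball x (r / 2) \<subseteq> W" if "x \<in> S" for x
  proof -
    have "ball x (r / 2) \<subseteq> ball p r"
    proof
      fix y assume "y \<in> ball x (r / 2)"
      then show "y \<in> ball p r" using that dist_triangle[of p y x] by (simp add: S_def dist_commute)
    qed
    then show ?thesis using r by blast
  qed
  have S_W: "x \<in> W" if "x \<in> S" for x
    using ball_sub[OF that] r(1) by force
  have cd: "complex_differentiable (f n) w" if "w \<in> W" for n w
    using hol that by (auto simp: ambient_holomorphic_on_iff)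
  define f' where "f' n w = (SOME D. (f n has_derivative D) (at w) \<and> (\<forall>c u. D (c *s u) = c * D u))" for n w
  have f'_props: "(f n has_derivative f' n w) (at w) \<and> (\<forall>c u. f' n w (c *s u) = c * f' n w u)"
    if "w \<in> W" for n w
    unfolding f'_def by (rule someI_ex[OF cd[OF that, unfolded complex_differentiable_def]])
  note f' = f'_props[THEN conjunct1] f'_props[THEN conjunct2, rule_format]
  have Cauchy_bound: "\<exists>N. \<forall>n\<ge>N. \<forall>m\<ge>N. \<forall>x\<in>S. \<forall>h. norm (f' n x h - f' m x h) \<le> e * norm h"
    if "e > 0" for e
  proof -
    \<comment> \<open>With this \<open>b\<close>, the bound \<open>2 * (2 * b) / (r / 2)\<close> on the derivatives is \<open>e\<close>.\<close>
    define b where "b = e * r / 8"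
    have b: "b > 0" using r(1) that by (simp add: b_def)
    obtain N where N: "\<And>n w. n \<ge> N \<Longrightarrow> w \<in> W \<Longrightarrow> dist (f n w) (F w) < b"
      using uniform_limitD[OF lim b] unfolding eventually_sequentially by blast
    have "norm (f' n x h - f' m x h) \<le> e * norm h" if nm: "n \<ge> N" "m \<ge> N" and x: "x \<in> S" for n m x h
    proof -
      have "norm (f' n x h - f' m x h) \<le> 2 * (2 * b) / (r / 2) * norm h"
      proof (rule complex_derivative_bound[where F = "\<lambda>w. f n w - f m w" and D = "\<lambda>h. f' n x h - f' m x h"])
        fix w assume "w \<in> ball x (r / 2)"
        then have w: "w \<in> W" using ball_sub[OF x] by blast
        then show "complex_differentiable (\<lambda>w. f n w - f m w) w"
          by (intro complex_differentiable_diff cd)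
        show "norm (f n w - f m w) \<le> 2 * b"
          using N[OF nm(1) w] N[OF nm(2) w] dist_triangle2[of "f n w" "f m w" "F w"]
          by (simp add: dist_norm)
      next
        show "((\<lambda>w. f n w - f m w) has_derivative (\<lambda>h. f' n x h - f' m x h)) (at x)"
          using S_W[OF x] f'(1) by (intro has_derivative_diff) auto
      qed (use r(1) f'(2)[OF S_W[OF x]] in \<open>auto simp: algebra_simps\<close>)
      also have "\<dots> = e * norm h" using r(1) by (simp add: b_def)
      finally show ?thesis .
    qed
    then show ?thesis by blast
  qed
  have "convergent (\<lambda>n. f' n x h)" if x: "x \<in> S" for x h
  proof -
    have "Cauchy (\<lambda>n. f' n x h)"
    proof (rule metric_CauchyI)
      fix e :: real assume e: "e > 0"
      define e' where "e' = e / (norm h + 1)"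
      have n1: "norm h + 1 > 0" by (rule add_nonneg_pos) auto
      have "e' > 0" using e n1 by (simp add: e'_def)
      then obtain N where N: "\<forall>n\<ge>N. \<forall>m\<ge>N. \<forall>x\<in>S. \<forall>h. norm (f' n x h - f' m x h) \<le> e' * norm h"
        using Cauchy_bound by blast
      have "e' * norm h < e' * (norm h + 1)" using \<open>e' > 0\<close> by simp
      also have "\<dots> = e" using n1 by (simp add: e'_def)
      finally have small: "e' * norm h < e" .
      have "dist (f' m x h) (f' n x h) < e" if "m \<ge> N" "n \<ge> N" for m n
      proof -
        have "norm (f' m x h - f' n x h) \<le> e' * norm h" using N x that by blast
        with small show ?thesis by (simp add: dist_norm)
      qed
      then show "\<exists>N. \<forall>m\<ge>N. \<forall>n\<ge>N. dist (f' m x h) (f' n x h) < e" by blast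
    qed
    then show ?thesis by (simp add: Cauchy_convergent_iff)
  qed
  then have g': "(\<lambda>n. f' n x h) \<longlonglongrightarrow> lim (\<lambda>n. f' n x h)" if "x \<in> S" for x h
    using that by (simp add: convergent_LIMSEQ_iff)
  define g' where "g' x h = lim (\<lambda>n. f' n x h)" for x h
  note g' = g'[folded g'_def]
  have p: "p \<in> S" using r(1) by (simp add: S_def)
  have "\<exists>g. \<forall>x\<in>S. (\<lambda>n. f n x) \<longlonglongrightarrow> g x \<and> (g has_derivative g' x) (at x within S)"
  proof (rule has_derivative_sequence)
    show "convex S" by (simp add: S_def)
    show "(f n has_derivative f' n x) (at x within S)" if "x \<in> S" for n x
      using f'(1)[OF S_W[OF that]] by (rule has_derivative_at_withinI)
    show "\<forall>\<^sub>F n in sequentially. \<forall>x\<in>S. \<forall>h. norm (f' n x h - g' x h) \<le> e * norm h" if e: "e > 0" for e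
    proof -
      obtain N where N: "\<forall>n\<ge>N. \<forall>m\<ge>N. \<forall>x\<in>S. \<forall>h. norm (f' n x h - f' m x h) \<le> e * norm h"
        using Cauchy_bound[OF e] by blast
      have "norm (f' n x h - g' x h) \<le> e * norm h" if "n \<ge> N" "x \<in> S" for n x h
      proof (rule tendsto_upperbound)
        show "(\<lambda>m. norm (f' n x h - f' m x h)) \<longlonglongrightarrow> norm (f' n x h - g' x h)"
          by (intro tendsto_intros g' that)
        show "\<forall>\<^sub>F m in sequentially. norm (f' n x h - f' m x h) \<le> e * norm h"
          using N that unfolding eventually_sequentially by blast
      qed simp
      then show ?thesis unfolding eventually_sequentially by blast
    qed
    show "(\<lambda>n. f n p) \<longlonglongrightarrow> F p"
      using tendsto_uniform_limitI[OF lim \<open>p \<in> W\<close>] .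
  qed (rule p)
  then obtain g where g: "\<And>x. x \<in> S \<Longrightarrow> (\<lambda>n. f n x) \<longlonglongrightarrow> g x"
    "\<And>x. x \<in> S \<Longrightarrow> (g has_derivative g' x) (at x within S)" by blast
  have "g x = F x" if "x \<in> S" for x
    using LIMSEQ_unique[OF g(1)[OF that] tendsto_uniform_limitI[OF lim S_W[OF that]]] .
  moreover have "(g has_derivative g' p) (at p)"
  proof -
    have "at p within S = at p" by (rule at_within_open[OF p]) (simp add: S_def)
    then show ?thesis using g(2)[OF p] by (simp only:)
  qed
  moreover have "open S" by (simp add: S_def)
  ultimately have D: "(F has_derivative g' p) (at p)"
    using has_derivative_transform_within_open[of g "g' p" p UNIV S F] p by blast
  moreover have "g' p (c *s u) = c * g' p u" for c u
  proof (rule LIMSEQ_unique[OF g'[OF p]])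
    show "(\<lambda>n. f' n p (c *s u)) \<longlonglongrightarrow> c * g' p u"
      using tendsto_mult[OF tendsto_const g'[OF p], of c u] by (simp add: f'(2)[OF \<open>p \<in> W\<close>])
  qed
  ultimately show "complex_differentiable F p"
    unfolding complex_differentiable_def by blast
qed (rule W)

section \<open>Radial projection onto the quadric\<close>

lemma poly_fun_complex_differentiable: "complex_differentiable (poly_fun P) w"
  by (rule polynomial_functions_complex_differentiable) (simp add: polynomial_functions_def)

lemma continuous_on_poly_fun: "continuous_on S (poly_fun P)"
  by (rule polynomial_functions_continuous_on) (simp add: polynomial_functions_def)

lemma closed_quadric: "closed (quadric Q)"
proof -
  have "closed (poly_fun Q -` {1})"
    by (intro continuous_closed_vimage closed_singleton)
       (simp add: complex_differentiable_isCont poly_fun_complex_differentiable)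
  then show ?thesis by (simp add: quadric_def vimage_def)
qed

lemma quadratic_form_scale:
  assumes "quadratic_form Q"
  shows "poly_fun Q (c *s v) = c^2 * poly_fun Q v"
proof -
  have "(\<Prod>i\<in>UNIV. ((c *s v) $ i) ^ Poly_Mapping.lookup m i) =
      c^2 * (\<Prod>i\<in>UNIV. (v $ i) ^ Poly_Mapping.lookup m i)" if "m \<in> Poly_Mapping.keys Q" for m
  proof -
    have "(\<Sum>i\<in>UNIV. Poly_Mapping.lookup m i) = 2"
      using assms that by (auto simp: quadratic_form_def)
    then show ?thesis
      by (simp add: power_mult_distrib prod.distrib flip: power_sum)
  qed
  then show ?thesis
    unfolding poly_fun_def sum_distrib_left
    by (intro sum.cong refl) (simp add: mult_ac)
qed

text \<open>
  A holomorphic projection of a neighbourhood of the quadric onto the quadric.  It replaces local charts.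
\<close>

definition radial_projection :: "polynomial3 \<Rightarrow> complex^3 \<Rightarrow> complex^3" where
  "radial_projection Q w = inverse (csqrt (poly_fun Q w)) *s w"

text \<open>
  On the right half-plane the principal square root is holomorphic and does not vanish.
\<close>

definition radial_domain :: "polynomial3 \<Rightarrow> (complex^3) set" where
  "radial_domain Q = {w. Re (poly_fun Q w) > 0}"

lemma open_radial_domain: "open (radial_domain Q)"
proof -
  have "open {w. 0 < Re (poly_fun Q w)}"
    by (intro open_Collect_less continuous_intros continuous_on_poly_fun)
  then show ?thesis by (simp add: radial_domain_def)
qed

lemma quadric_subset_radial_domain: "quadric Q \<subseteq> radial_domain Q"
  by (auto simp: quadric_def radial_domain_def)

lemma radial_projection_eq_self: "v \<in> quadric Q \<Longrightarrow> radial_projection Q v = v"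
  by (simp add: quadric_def radial_projection_def)

lemma radial_projection_in_quadric:
  assumes "quadratic_form Q" "w \<in> radial_domain Q"
  shows "radial_projection Q w \<in> quadric Q"
proof -
  have "poly_fun Q w \<noteq> 0" using assms(2) by (auto simp: radial_domain_def)
  then show ?thesis
    by (simp add: quadric_def radial_projection_def quadratic_form_scale[OF assms(1)] power_inverse)
qed

lemma complex_differentiable_radial_factor:
  assumes "w \<in> radial_domain Q"
  shows "complex_differentiable (\<lambda>w. inverse (csqrt (poly_fun Q w))) w"
proof -
  have nz: "poly_fun Q w \<notin> \<real>\<^sub>\<le>\<^sub>0" using assms by (auto simp: radial_domain_def complex_nonpos_Reals_iff)
  then have "csqrt (poly_fun Q w) \<noteq> 0" by auto
  from DERIV_inverse_fun[OF has_field_derivative_csqrt[OF nz] this] show ?thesis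
    by (rule complex_differentiable_compose[OF poly_fun_complex_differentiable])
qed

lemma continuous_on_radial_projection: "continuous_on (radial_domain Q) (radial_projection Q)"
  unfolding radial_projection_def[abs_def]
  by (intro continuous_on_vector_scalar_mult continuous_on_id continuous_at_imp_continuous_on ballI
      complex_differentiable_isCont complex_differentiable_radial_factor)

lemma complex_differentiable_radial_projection:
  assumes "w \<in> radial_domain Q" "complex_differentiable F (radial_projection Q w)"
  shows "complex_differentiable (\<lambda>w. F (radial_projection Q w)) w"
  using complex_differentiable_rescale[OF complex_differentiable_radial_factor[OF assms(1)]] assms(2)
  unfolding radial_projection_def by blast

lemma open_radial_projection_preimage:
  assumes "open T"
  shows "open {w \<in> radial_domain Q. radial_projection Q w \<in> T}"
proof -
  have "open (radial_domain Q \<inter> radial_projection Q -` T)"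
    by (rule continuous_open_preimage[OF continuous_on_radial_projection open_radial_domain assms])
  then show ?thesis by (simp add: vimage_def Int_def)
qed

text \<open>
  Composing with the radial projection turns holomorphy on a relatively open part of the quadric into
  holomorphy on an open subset of the ambient space.
\<close>

lemma hol_on_quadric_iff:
  assumes "quadratic_form Q" "open T"
  shows "hol_on f (quadric Q \<inter> T) \<longleftrightarrow>
    ambient_holomorphic_on (\<lambda>w. f (radial_projection Q w)) {w \<in> radial_domain Q. radial_projection Q w \<in> T}"
    (is "_ \<longleftrightarrow> ambient_holomorphic_on ?g ?N")
proof
  assume hol: "hol_on f (quadric Q \<inter> T)"
  have "complex_differentiable ?g w" if w: "w \<in> ?N" for w
  proof -
    have "radial_projection Q w \<in> quadric Q \<inter> T"
      using w radial_projection_in_quadric[OF assms(1)] by auto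
    then obtain W F where W: "radial_projection Q w \<in> W" "ambient_holomorphic_on F W"
      "\<And>v. v \<in> W \<inter> (quadric Q \<inter> T) \<Longrightarrow> F v = f v"
      using hol unfolding hol_on_def by metis
    have "open W" using W(2) by (simp add: ambient_holomorphic_on_def)
    show ?thesis
    proof (rule complex_differentiable_transform)
      show "complex_differentiable (\<lambda>w. F (radial_projection Q w)) w"
        using w W(1,2) by (intro complex_differentiable_radial_projection) (auto simp: ambient_holomorphic_on_iff)
      show "open {w \<in> radial_domain Q. radial_projection Q w \<in> W \<inter> T}"
        using \<open>open W\<close> assms(2) by (intro open_radial_projection_preimage open_Int)
      show "w \<in> {w \<in> radial_domain Q. radial_projection Q w \<in> W \<inter> T}" using w W(1) by simp
      show "F (radial_projection Q v) = f (radial_projection Q v)"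
        if "v \<in> {w \<in> radial_domain Q. radial_projection Q w \<in> W \<inter> T}" for v
        using that radial_projection_in_quadric[OF assms(1), of v] by (intro W(3)) auto
    qed
  qed
  then show "ambient_holomorphic_on ?g ?N"
    unfolding ambient_holomorphic_on_iff using open_radial_projection_preimage[OF assms(2)] by blast
next
  assume "ambient_holomorphic_on ?g ?N"
  then show "hol_on f (quadric Q \<inter> T)"
    unfolding hol_on_def
    using quadric_subset_radial_domain radial_projection_eq_self by (intro ballI exI[of _ ?N] exI[of _ ?g]) auto
qed

lemma hol_on_quadric_iff_UNIV:
  assumes "quadratic_form Q"
  shows "hol_on f (quadric Q) \<longleftrightarrow> ambient_holomorphic_on (\<lambda>w. f (radial_projection Q w)) (radial_domain Q)"
  using hol_on_quadric_iff[OF assms open_UNIV] by simp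

text \<open>
  Composed with the projection, the polynomials converge locally uniformly on an open subset of \<open>\<complex>\<^sup>3\<close>.
\<close>

lemma limit_of_polynomials_hol_on_quadric:
  assumes Q: "quadratic_form Q" and p: "\<And>n. p n \<in> polynomial_functions"
    and lim: "limitin (compact_convergence (quadric Q)) p f sequentially"
  shows "hol_on f (quadric Q)"
proof -
  have "complex_differentiable (\<lambda>w. f (radial_projection Q w)) w" if "w \<in> radial_domain Q" for w
  proof -
    obtain r where r: "r > 0" "cball w r \<subseteq> radial_domain Q"
      using open_radial_domain \<open>w \<in> radial_domain Q\<close> unfolding open_contains_cball by blast
    have "compact (radial_projection Q ` cball w r)"
      by (rule compact_continuous_image[OF continuous_on_subset[OF continuous_on_radial_projection r(2)]]) simp
    moreover have "radial_projection Q ` cball w r \<subseteq> quadric Q"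
      using radial_projection_in_quadric[OF Q] r(2) by blast
    ultimately have "uniform_limit (radial_projection Q ` cball w r) p f sequentially"
      using lim unfolding limitin_compact_convergence by blast
    then have "uniform_limit (ball w r) (\<lambda>n x. p n (radial_projection Q x)) (\<lambda>x. f (radial_projection Q x)) sequentially"
      unfolding uniform_limit_iff by (fastforce elim!: eventually_mono)
    then have "ambient_holomorphic_on (\<lambda>x. f (radial_projection Q x)) (ball w r)"
    proof (rule weierstrass_convergence[rotated 2])
      show "ambient_holomorphic_on (\<lambda>x. p n (radial_projection Q x)) (ball w r)" for n
        unfolding ambient_holomorphic_on_iff
      proof (intro conjI ballI)
        fix x assume "x \<in> ball w r"
        then have "x \<in> radial_domain Q" using r(2) by auto
        then show "complex_differentiable (\<lambda>x. p n (radial_projection Q x)) x"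
          by (rule complex_differentiable_radial_projection) (rule polynomial_functions_complex_differentiable[OF p])
      qed simp
    qed simp
    then show ?thesis using r(1) by (simp add: ambient_holomorphic_on_iff)
  qed
  then show ?thesis
    unfolding hol_on_quadric_iff_UNIV[OF Q] ambient_holomorphic_on_iff using open_radial_domain by blast
qed

section \<open>Growth of the terms and extension of the series\<close>

lemma multipole_term_scale: "multipole_term c L k (a *s v) = a ^ k * multipole_term c L k v"
  by (auto simp: multipole_term_def scalar_product_scale_right prod.distrib)

lemma multipole_term_polynomial: "multipole_term c L k \<in> polynomial_functions"
proof (cases "k = 0")
  case True
  then have "multipole_term c L k = (\<lambda>v. c)" by (auto simp: multipole_term_def)
  then show ?thesis by (simp add: polynomial_functions_const)
next
  case False
  have "(\<lambda>v. \<Prod>j\<in>J. scalar_product (L k j) v) \<in> polynomial_functions" if "finite J" for J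
    using that by (induction J) (auto intro: polynomial_functions_intros)
  moreover have "multipole_term c L k = (\<lambda>v. \<Prod>j=1..k. scalar_product (L k j) v)"
    using False by (auto simp: multipole_term_def)
  ultimately show ?thesis by simp
qed

lemma multipole_term_holomorphic_on_curve:
  "(\<lambda>u. multipole_term c L k (f u *s a + g u *s b)) holomorphic_on S"
  if "f holomorphic_on S" "g holomorphic_on S"
proof (cases "k = 0")
  case False
  then show ?thesis
    using that by (simp add: multipole_term_def scalar_product_add_right scalar_product_scale_right)
      (intro holomorphic_intros)
qed (simp add: multipole_term_def)

text \<open>
  Each term is a difference of consecutive partial sums, so from some index on all terms are at most \<open>2\<close>
  on \<open>K\<close>; finitely many remain, and these are continuous.
\<close>

lemma multipole_terms_bounded:
  assumes ser: "multipole_series Y c L f" and K: "compact K" "K \<subseteq> Y"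
  obtains M where "M > 0" "\<And>k v. v \<in> K \<Longrightarrow> norm (multipole_term c L k v) \<le> M"
proof -
  let ?T = "multipole_term c L"
  have "uniform_limit K (\<lambda>n v. \<Sum>k<n. ?T k v) f sequentially"
    using ser K unfolding multipole_series_def limitin_compact_convergence by blast
  from uniform_limitD[OF this zero_less_one]
  obtain N where N: "\<And>n v. n \<ge> N \<Longrightarrow> v \<in> K \<Longrightarrow> dist (\<Sum>k<n. ?T k v) (f v) < 1"
    unfolding eventually_sequentially by blast
  have big: "norm (?T k v) \<le> 2" if "k \<ge> N" "v \<in> K" for k v
  proof -
    have "?T k v = (\<Sum>k<Suc k. ?T k v) - (\<Sum>k<k. ?T k v)" by simp
    then show ?thesis
      using N[of k v] N[of "Suc k" v] that dist_triangle2[of "\<Sum>k<Suc k. ?T k v" "\<Sum>k<k. ?T k v" "f v"]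
      by (simp add: dist_norm)
  qed
  have "\<exists>B. \<forall>v\<in>K. norm (?T k v) \<le> B" for k
  proof -
    have "compact (?T k ` K)"
      by (intro compact_continuous_image K polynomial_functions_continuous_on multipole_term_polynomial)
    then show ?thesis using compact_imp_bounded[of "?T k ` K"] unfolding bounded_iff by blast
  qed
  then obtain B where B: "\<And>k v. v \<in> K \<Longrightarrow> norm (?T k v) \<le> B k" by metis
  define M where "M = 2 + (\<Sum>k<N. \<bar>B k\<bar>)"
  have s0: "(\<Sum>k<N. \<bar>B k\<bar>) \<ge> 0" by (simp add: sum_nonneg)
  show ?thesis
  proof (rule that)
    show "M > 0" using s0 unfolding M_def by linarith
    fix k v assume v: "v \<in> K"
    show "norm (?T k v) \<le> M"
    proof (cases "k < N")
      case True
      then have "\<bar>B k\<bar> \<le> (\<Sum>k<N. \<bar>B k\<bar>)" by (intro member_le_sum) auto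
      then show ?thesis using B[OF v, of k] by (simp add: M_def)
    next
      case False
      then have "norm (?T k v) \<le> 2" by (intro big v) simp
      then show ?thesis using s0 unfolding M_def by linarith
    qed
  qed
qed

text \<open>
  A rate \<open>t < 1\<close> makes the series converge uniformly near \<open>p\<close>.
\<close>

definition growth_near :: "complex \<Rightarrow> (nat \<Rightarrow> nat \<Rightarrow> complex^3) \<Rightarrow> complex^3 \<Rightarrow> real \<Rightarrow> bool" where
  "growth_near c L p t \<longleftrightarrow> (\<exists>r>0. \<exists>M. \<forall>w\<in>ball p r. \<forall>k. norm (multipole_term c L k w) \<le> M * t ^ k)"

lemma extension_by_series:
  assumes "\<And>p. p \<in> Y \<Longrightarrow> \<exists>t<1. 0 \<le> t \<and> growth_near c L p t"
  shows "hol_on (\<lambda>w. suminf (\<lambda>k. multipole_term c L k w)) Y"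
    and "\<And>p. p \<in> Y \<Longrightarrow> summable (\<lambda>k. multipole_term c L k p)"
proof -
  let ?T = "multipole_term c L" and ?F = "\<lambda>w. suminf (\<lambda>k. multipole_term c L k w)"
  have main: "\<exists>r>0. ambient_holomorphic_on ?F (ball p r) \<and> summable (\<lambda>k. ?T k p)" if p: "p \<in> Y" for p
  proof -
    obtain t r M where t: "0 \<le> t" "t < 1" "r > 0"
      "\<And>w k. w \<in> ball p r \<Longrightarrow> norm (?T k w) \<le> M * t ^ k"
      using assms[OF p] unfolding growth_near_def by blast
    have sm: "summable (\<lambda>k. M * t ^ k)" using t by (intro summable_mult summable_geometric) auto
    have "uniform_limit (ball p r) (\<lambda>n w. \<Sum>k<n. ?T k w) ?F sequentially"
      by (rule Weierstrass_m_test[OF t(4) sm])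
    then have "ambient_holomorphic_on ?F (ball p r)"
      by (rule weierstrass_convergence[rotated 2])
         (simp_all add: ambient_holomorphic_on_iff polynomial_functions_complex_differentiable
           polynomial_functions_sum multipole_term_polynomial)
    moreover have "summable (\<lambda>k. ?T k p)"
      by (rule summable_comparison_test'[OF sm, of 0]) (use t in auto)
    ultimately show ?thesis using t(3) by blast
  qed
  show "hol_on ?F Y"
    unfolding hol_on_def
  proof
    fix p assume "p \<in> Y"
    then obtain r where "r > 0" "ambient_holomorphic_on ?F (ball p r)" using main by blast
    then show "\<exists>W F. p \<in> W \<and> ambient_holomorphic_on F W \<and> (\<forall>v\<in>W \<inter> Y. F v = ?F v)"
      by (intro exI[of _ "ball p r"] exI[of _ ?F]) auto
  qed
  show "summable (\<lambda>k. ?T k p)" if "p \<in> Y" for p using main[OF that] by blast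
qed

text \<open>
  By the maximum principle the value of a term at \<open>w\<close> is at most its largest value at the points
  \<open>w + z u\<close> with \<open>\<bar>z\<bar> = 1\<close>.  By homogeneity that is a value near \<open>u\<close>, since \<open>w + z u = z (u + w / z)\<close>.
  Thus any bound near \<open>u\<close> gives one near the origin, and homogeneity again improves the rate on a
  smaller ball.
\<close>

lemma growth_near_zero:
  assumes "growth_near c L u t" "t \<ge> 0"
  shows "growth_near c L 0 (1/2)"
proof -
  let ?T = "multipole_term c L"
  obtain r M where r: "r > 0" and M: "\<And>w k. w \<in> ball u r \<Longrightarrow> norm (?T k w) \<le> M * t ^ k"
    using assms(1) unfolding growth_near_def by blast
  have near: "norm (?T k w) \<le> M * t ^ k" if w: "norm w < r" for w k
  proof -
    have "norm (?T k (1 *s w + 0 *s u)) \<le> M * t ^ k"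
    proof (rule maximum_modulus_frontier[of "\<lambda>z. ?T k (1 *s w + z *s u)" "cball 0 1"])
      show "(\<lambda>z. ?T k (1 *s w + z *s u)) holomorphic_on interior (cball 0 1)"
        by (intro multipole_term_holomorphic_on_curve holomorphic_intros)
      have "(\<lambda>z. ?T k (1 *s w + z *s u)) holomorphic_on closure (cball 0 1)"
        by (intro multipole_term_holomorphic_on_curve holomorphic_intros)
      then show "continuous_on (closure (cball 0 1)) (\<lambda>z. ?T k (1 *s w + z *s u))"
        by (rule holomorphic_on_imp_continuous_on)
      fix z :: complex assume "z \<in> frontier (cball 0 1)"
      then have z: "norm z = 1" by (simp add: frontier_cball)
      then have "z \<noteq> 0" by auto
      then have "1 *s w + z *s u = z *s (u + inverse z *s w)"
        by (simp add: vec_eq_iff algebra_simps)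
      then have "norm (?T k (1 *s w + z *s u)) = norm (?T k (u + inverse z *s w))"
        by (simp only: multipole_term_scale norm_mult norm_power z power_one mult_1)
      also have "\<dots> \<le> M * t ^ k"
        using w z by (intro M) (simp add: dist_norm norm_vector_scalar_mult norm_inverse)
      finally show "norm (?T k (1 *s w + z *s u)) \<le> M * t ^ k" .
    qed auto
    then show ?thesis by simp
  qed
  define a where "a = 1 / (2 * (t + 1))"
  have a: "a > 0" "a * t \<le> 1/2" using assms(2) by (auto simp: a_def divide_simps)
  have "norm (?T 0 u) \<le> M * t ^ 0" by (rule M) (simp add: r)
  then have "norm (?T 0 u) \<le> M" by simp
  then have M0: "M \<ge> 0" using norm_ge_zero[of "?T 0 u"] by linarith
  show ?thesis
    unfolding growth_near_def
  proof (rule exI[of _ "a * r"], intro conjI exI[of _ M] ballI allI)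
    fix w k assume "w \<in> ball (0 :: complex^3) (a * r)"
    then have "norm (complex_of_real (1/a) *s w) < r"
      using a by (simp add: norm_vector_scalar_mult norm_divide divide_simps mult.commute)
    then have 1: "norm (?T k (complex_of_real (1/a) *s w)) \<le> M * t ^ k" by (rule near)
    have "w = complex_of_real a *s (complex_of_real (1/a) *s w)" using a by (simp add: vec_eq_iff)
    then have "norm (?T k w) = a ^ k * norm (?T k (complex_of_real (1/a) *s w))"
      using a multipole_term_scale[of c L k "complex_of_real a" "complex_of_real (1/a) *s w"]
      by (simp add: norm_mult norm_power)
    also have "\<dots> \<le> a ^ k * (M * t ^ k)" using 1 a by (intro mult_left_mono) auto
    also have "\<dots> = M * (a * t) ^ k" by (simp add: power_mult_distrib)
    also have "\<dots> \<le> M * (1/2) ^ k"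
      using M0 a assms(2) by (intro mult_left_mono power_mono) auto
    finally show "norm (?T k w) \<le> M * (1/2) ^ k" .
  qed (use a r in simp)
qed

text \<open>
  If \<open>s\<close> is a square root of \<open>Q w\<close>, then \<open>w / s\<close> lies on the quadric and stays bounded for \<open>w\<close> near \<open>p\<close>.
  Either square root will do, because only \<open>\<bar>s\<bar>\<close> enters.
\<close>

lemma growth_near_quadric:
  assumes Q: "quadratic_form Q" and ser: "multipole_series (quadric Q) c L f"
    and p: "poly_fun Q p \<noteq> 0" "norm (poly_fun Q p) < t^2" and t: "t > 0"
  shows "growth_near c L p t"
proof -
  let ?T = "multipole_term c L" and ?q = "poly_fun Q"
  define m where "m = norm (?q p) / 2"
  have m: "m > 0" "m < norm (?q p)" using p(1) by (auto simp: m_def)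
  have "open {w. m < norm (?q w)}" "open {w. norm (?q w) < t^2}"
    by (intro open_Collect_less continuous_intros continuous_on_poly_fun)+
  then have "open ({w. m < norm (?q w)} \<inter> {w. norm (?q w) < t^2})" by (rule open_Int)
  moreover have "p \<in> {w. m < norm (?q w)} \<inter> {w. norm (?q w) < t^2}" using m p(2) by simp
  ultimately obtain r where r: "r > 0" "ball p r \<subseteq> {w. m < norm (?q w)} \<inter> {w. norm (?q w) < t^2}"
    by (rule openE)
  define R where "R = (norm p + r) / sqrt m"
  have "compact (quadric Q \<inter> cball 0 R)" by (simp add: closed_quadric closed_Int_compact)
  then obtain M where M: "M > 0" "\<And>k v. v \<in> quadric Q \<inter> cball 0 R \<Longrightarrow> norm (?T k v) \<le> M"
    using multipole_terms_bounded[OF ser, of "quadric Q \<inter> cball 0 R"] by blast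
  have "norm (?T k w) \<le> M * t ^ k" if w: "w \<in> ball p r" for w k
  proof -
    have qw: "m < norm (?q w)" "norm (?q w) < t^2" using r(2) w by auto
    define s where "s = csqrt (?q w)"
    have s2: "s^2 = ?q w" by (simp add: s_def)
    then have ns2: "norm s ^ 2 = norm (?q w)" by (metis norm_power)
    have s0: "s \<noteq> 0" using qw m by (auto simp: s_def)
    have st: "norm s \<le> t" 
      by (rule power2_le_imp_le) (use ns2 qw(2) t in linarith)+
    have sm: "sqrt m \<le> norm s" 
      by (rule real_le_lsqrt) (use ns2 qw(1) norm_ge_zero[of s] in linarith)+
    have "inverse s *s w \<in> quadric Q"
      using s0 by (simp add: quadric_def quadratic_form_scale[OF Q] power_inverse s2[symmetric])
    moreover have "inverse s *s w \<in> cball 0 R"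
    proof -
      have "norm w \<le> norm p + r"
        using w norm_triangle_ineq2[of w p] by (simp add: dist_norm norm_minus_commute)
      then have "norm w / norm s \<le> R"
        unfolding R_def using sm m r(1) by (intro frac_le) auto
      then show ?thesis by (simp add: norm_vector_scalar_mult norm_inverse divide_inverse mult.commute)
    qed
    ultimately have 1: "norm (?T k (inverse s *s w)) \<le> M" by (intro M) auto
    have "w = s *s (inverse s *s w)" using s0 by (simp add: vec_eq_iff)
    then have "norm (?T k w) = norm s ^ k * norm (?T k (inverse s *s w))"
      using multipole_term_scale[of c L k s "inverse s *s w"] by (simp add: norm_mult norm_power)
    also have "\<dots> \<le> t ^ k * M" using 1 st t by (intro mult_mono power_mono) auto
    finally show ?thesis by (simp add: mult.commute)
  qed
  then show ?thesis unfolding growth_near_def using r(1) by blast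
qed

text \<open>
  After the Joukowski substitution, \<open>u\<^sup>k\<close> times the term at \<open>a + ((u + 1/u) / 2) b\<close> is a polynomial in
  \<open>u\<close>, by homogeneity.  On the unit circle \<open>(u + 1/u) / 2 = Re u\<close> runs through the segment where the
  bound is assumed, and the maximum principle extends the bound to the disc.
\<close>

lemma bernstein_inequality:
  assumes bound: "\<And>\<xi>. \<lbrakk>-1 \<le> \<xi>; \<xi> \<le> 1\<rbrakk> \<Longrightarrow> norm (multipole_term c L k (a + complex_of_real \<xi> *s b)) \<le> B"
    and s: "0 < s" "s \<le> 1"
  shows "s ^ k * norm (multipole_term c L k (a + (\<i> * of_real ((1/s - s) / 2)) *s b)) \<le> B"
proof -
  let ?T = "multipole_term c L k"
  define g where "g u = ?T (u *s a + ((u^2 + 1) / 2) *s b)" for u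
  have g: "g u = u ^ k * ?T (a + ((u + 1/u) / 2) *s b)" if "u \<noteq> 0" for u
  proof -
    have "u *s a + ((u^2 + 1) / 2) *s b = u *s (a + ((u + 1/u) / 2) *s b)"
    proof -
      have "(u^2 + 1) / 2 = u * ((u + 1/u) / 2)" using that by (simp add: field_simps power2_eq_square)
      then show ?thesis by (simp only: vector_add_ldistrib vector_smult_assoc)
    qed
    then show ?thesis by (simp only: g_def multipole_term_scale)
  qed
  \<comment> \<open>The point of the disc with \<open>(u + 1/u) / 2 = \<i> (1/s - s) / 2\<close>.\<close>
  define u0 where "u0 = - (\<i> * complex_of_real s)"
  have hol: "g holomorphic_on X" for X
    unfolding g_def by (intro multipole_term_holomorphic_on_curve holomorphic_intros) auto
  have "norm (g u0) \<le> B"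
  proof (rule maximum_modulus_frontier[of g "cball 0 1"])
    show "continuous_on (closure (cball 0 1)) g" by (rule holomorphic_on_imp_continuous_on[OF hol])
    fix u :: complex assume "u \<in> frontier (cball 0 1)"
    then have u: "norm u = 1" by (simp add: frontier_cball)
    then have "u \<noteq> 0" by auto
    have "1 / u = cnj u" using u by (simp add: divide_eq_eq complex_norm_square[symmetric] mult.commute \<open>u \<noteq> 0\<close>)
    then have "(u + 1/u) / 2 = complex_of_real (Re u)" by (simp add: complex_add_cnj)
    moreover have "\<bar>Re u\<bar> \<le> 1" using abs_Re_le_cmod[of u] u by simp
    ultimately show "norm (g u) \<le> B"
      unfolding g[OF \<open>u \<noteq> 0\<close>] using bound[of "Re u"] u by (simp add: norm_mult norm_power abs_le_iff)
  qed (use s hol in \<open>auto simp: u0_def norm_mult\<close>)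
  moreover have "(u0 + 1/u0) / 2 = \<i> * of_real ((1/s - s) / 2)"
    using s by (simp add: u0_def field_simps)
  moreover have "u0 \<noteq> 0" "norm u0 = s" using s by (auto simp: u0_def norm_mult)
  ultimately show ?thesis using g[of u0] by (simp add: norm_mult norm_power)
qed

section \<open>Abel's limit theorem\<close>

text \<open>
  Summation by parts turns the difference of the two sides into \<open>1 - t\<close> times a power series in \<open>t\<close> whose
  coefficients \<open>A n\<close>, the errors of the partial sums, tend to zero.
\<close>

lemma abel_limit_theorem:
  fixes a :: "nat \<Rightarrow> complex"
  assumes "a sums s"
  shows "((\<lambda>t. suminf (\<lambda>k. of_real t ^ k * a k)) \<longlongrightarrow> s) (at_left (1 :: real))"
proof -
  define A where "A n = (\<Sum>k\<le>n. a k) - s" for n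
  have A_lim: "A \<longlonglongrightarrow> 0"
    using assms unfolding sums_def_le A_def by (simp add: LIM_zero)
  then obtain B where B: "\<And>n. norm (A n) \<le> B"
    using convergent_imp_Bseq[of A] unfolding Bseq_def convergent_def by blast
  have rep: "suminf (\<lambda>k. of_real t ^ k * a k) - s = (1 - of_real t) * suminf (\<lambda>n. A n * of_real t ^ n)"
    and sumA: "summable (\<lambda>n. norm (A n * of_real t ^ n))" if t: "0 \<le> t" "t < 1" for t :: real
  proof -
    let ?t = "complex_of_real t"
    show sm: "summable (\<lambda>n. norm (A n * ?t ^ n))"
    proof (rule summable_comparison_test')
      show "summable (\<lambda>n. B * t ^ n)" using t by (intro summable_mult summable_geometric) auto
      show "norm (norm (A n * ?t ^ n)) \<le> B * t ^ n" if "n \<ge> 0" for n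
        using B[of n] t by (simp add: norm_mult norm_power mult_right_mono)
    qed
    define X where "X = suminf (\<lambda>n. A n * ?t ^ n)"
    have X: "(\<lambda>n. A n * ?t ^ n) sums X"
      unfolding X_def by (rule summable_sums[OF summable_norm_cancel[OF sm]])
    have "(\<lambda>n. A (Suc n) * ?t ^ Suc n) sums (X - A 0)"
      using sums_Suc_iff[of "\<lambda>n. A n * ?t ^ n" "X - A 0"] X by simp
    moreover have "(\<lambda>n. A n * ?t ^ Suc n) sums (?t * X)"
      using sums_mult[OF X, of ?t] by (simp add: mult_ac)
    ultimately have "(\<lambda>n. A (Suc n) * ?t ^ Suc n - A n * ?t ^ Suc n) sums (X - A 0 - ?t * X)"
      by (rule sums_diff)
    moreover have "A (Suc n) * ?t ^ Suc n - A n * ?t ^ Suc n = ?t ^ Suc n * a (Suc n)" for n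
      by (simp add: A_def algebra_simps)
    ultimately have "(\<lambda>n. ?t ^ Suc n * a (Suc n)) sums (X - A 0 - ?t * X)" by simp
    then have "(\<lambda>n. ?t ^ n * a n) sums (X - A 0 - ?t * X + ?t ^ 0 * a 0)"
      using sums_Suc_iff[of "\<lambda>n. ?t ^ n * a n"] by simp
    then have "suminf (\<lambda>n. ?t ^ n * a n) = X - A 0 - ?t * X + a 0" by (simp add: sums_iff)
    then show "suminf (\<lambda>k. ?t ^ k * a k) - s = (1 - ?t) * suminf (\<lambda>n. A n * ?t ^ n)"
      by (simp add: A_def X_def algebra_simps)
  qed
  show ?thesis
  proof (rule tendstoI)
    fix e :: real assume e: "e > 0"
    obtain N where N: "\<And>n. n \<ge> N \<Longrightarrow> norm (A n) < e / 2"
      using LIMSEQ_D[OF A_lim, of "e/2"] e by auto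
    define C where "C = (\<Sum>n<N. norm (A n))"
    have "((\<lambda>t. (1 - t) * C + e / 2) \<longlongrightarrow> (1 - 1) * C + e / 2) (at_left 1)"
      by (intro tendsto_intros)
    then have "\<forall>\<^sub>F t in at_left 1. (1 - t) * C + e / 2 < e"
      by (rule order_tendstoD(2)) (use e in simp)
    moreover have "\<forall>\<^sub>F t in at_left (1::real). 0 < t \<and> t < 1"
      using eventually_at_left_real[of 0 1] by (rule eventually_mono) auto
    ultimately show "\<forall>\<^sub>F t in at_left 1. dist (suminf (\<lambda>k. of_real t ^ k * a k)) s < e"
    proof eventually_elim
      case (elim t)
      then have t: "0 \<le> t" "t < 1" by auto
      let ?f = "\<lambda>n. norm (A n * complex_of_real t ^ n)"
      have "norm (suminf (\<lambda>n. A n * of_real t ^ n)) \<le> suminf (\<lambda>n. ?f n)"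
        by (rule summable_norm[OF sumA[OF t]])
      also have "\<dots> = suminf (\<lambda>n. ?f (n + N)) + (\<Sum>n<N. ?f n)"
        by (rule suminf_split_initial_segment[OF sumA[OF t]])
      also have "(\<Sum>n<N. ?f n) \<le> C"
        unfolding C_def
      proof (rule sum_mono)
        fix n
        have "norm (A n) * t ^ n \<le> norm (A n) * 1"
          using t by (intro mult_left_mono power_le_one) auto
        then show "?f n \<le> norm (A n)" using t by (simp add: norm_mult norm_power)
      qed
      also have "suminf (\<lambda>n. ?f (n + N)) \<le> suminf (\<lambda>n. e / 2 * t ^ n)"
      proof (rule suminf_le)
        show "?f (n + N) \<le> e / 2 * t ^ n" for n
        proof -
          have "t ^ (n + N) \<le> t ^ n" using t by (intro power_decreasing) auto
          then have "norm (A (n + N)) * t ^ (n + N) \<le> e / 2 * t ^ n"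
            using N[of "n + N"] t e by (intro mult_mono) auto
          then show ?thesis using t by (simp add: norm_mult norm_power)
        qed
        show "summable (\<lambda>n. ?f (n + N))" using sumA[OF t] by (subst summable_iff_shift)
        show "summable (\<lambda>n. e / 2 * t ^ n)" using t by (intro summable_mult summable_geometric) auto
      qed
      also have "suminf (\<lambda>n. e / 2 * t ^ n) = e / 2 / (1 - t)"
        using t by (subst suminf_mult) (auto simp: suminf_geometric summable_geometric)
      finally have "norm (suminf (\<lambda>n. A n * of_real t ^ n)) \<le> e / 2 / (1 - t) + C" by simp
      then have "(1 - t) * norm (suminf (\<lambda>n. A n * of_real t ^ n)) \<le> (1 - t) * (e / 2 / (1 - t) + C)"
        using t by (intro mult_left_mono) auto
      also have "\<dots> = (1 - t) * C + e / 2" using t by (simp add: field_simps)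
      also have "\<dots> < e" using elim by simp
      finally have "(1 - t) * norm (suminf (\<lambda>n. A n * of_real t ^ n)) < e" .
      moreover have "norm (1 - complex_of_real t) = 1 - t"
        using t by (metis abs_of_nonneg diff_ge_0_iff_ge less_imp_le norm_of_real of_real_1 of_real_diff)
      ultimately show ?case unfolding dist_norm rep[OF t] by (simp add: norm_mult)
    qed
  qed
qed

section \<open>Laurent expansion on the punctured plane\<close>

text \<open>
  In the coordinate \<open>t = exp \<zeta>\<close> the integral over the unit circle becomes an integral over a
  period, which a primitive evaluates independently of the starting point.
\<close>

lemma contour_integral_unit_circle_primitive:
  assumes P: "\<And>\<zeta>. (P has_field_derivative F (exp \<zeta>) * exp \<zeta>) (at \<zeta>)"
  shows "contour_integral (circlepath 0 1) F = P (\<zeta> + 2 * of_real pi * \<i>) - P \<zeta>"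
proof -
  have "\<exists>d. \<forall>\<zeta>\<in>UNIV. P (\<zeta> + 2 * of_real pi * \<i>) - P \<zeta> = d"
  proof (rule has_field_derivative_zero_constant)
    fix \<zeta> :: complex
    have "((\<lambda>\<zeta>. P (\<zeta> + 2 * of_real pi * \<i>) - P \<zeta>) has_field_derivative
        F (exp (\<zeta> + 2 * of_real pi * \<i>)) * exp (\<zeta> + 2 * of_real pi * \<i>) * 1 - F (exp \<zeta>) * exp \<zeta>) (at \<zeta>)"
      by (intro DERIV_diff P DERIV_chain2[OF P]) (auto intro!: derivative_eq_intros)
    then show "((\<lambda>\<zeta>. P (\<zeta> + 2 * of_real pi * \<i>) - P \<zeta>) has_field_derivative 0) (at \<zeta>)"
      by (simp add: exp_add)
  qed simp
  then have const: "P (\<zeta> + 2 * of_real pi * \<i>) - P \<zeta> = P (2 * of_real pi * \<i>) - P 0"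
    by (metis UNIV_I add_0)
  let ?e = "\<lambda>x. exp (2 * of_real pi * \<i> * complex_of_real x)"
  have "((\<lambda>x. F (?e x) * (2 * of_real pi * \<i> * ?e x)) has_integral
      (P (2 * of_real pi * \<i> * of_real 1) - P (2 * of_real pi * \<i> * of_real 0))) {0..1}"
  proof (rule fundamental_theorem_of_calculus)
    fix x :: real
    have "((\<lambda>x. 2 * of_real pi * \<i> * complex_of_real x) has_vector_derivative 2 * of_real pi * \<i>) (at x within {0..1})"
      by (auto intro!: derivative_eq_intros)
    from field_vector_diff_chain_within[OF this has_field_derivative_at_within[OF P]]
    have "((\<lambda>x. P (2 * of_real pi * \<i> * complex_of_real x)) has_vector_derivative
        2 * of_real pi * \<i> * (F (?e x) * ?e x)) (at x within {0..1})"
      unfolding o_def .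
    moreover have "2 * of_real pi * \<i> * (F (?e x) * ?e x) = F (?e x) * (2 * of_real pi * \<i> * ?e x)"
      by (simp only: mult_ac)
    ultimately show "((\<lambda>x. P (2 * of_real pi * \<i> * complex_of_real x)) has_vector_derivative
        F (?e x) * (2 * of_real pi * \<i> * ?e x)) (at x within {0..1})"
      by (simp only:)
  qed simp
  then have "integral {0..1} (\<lambda>x. F (?e x) * (2 * of_real pi * \<i> * ?e x)) = P (2 * of_real pi * \<i>) - P 0"
    by (simp add: integral_unique)
  then show ?thesis
    unfolding const contour_integral_integral vector_derivative_circlepath
    unfolding circlepath by simp
qed

lemma exponential_primitive:
  assumes "F holomorphic_on - {0}"
  obtains P where "\<And>\<zeta>. (P has_field_derivative F (exp \<zeta>) * exp \<zeta>) (at \<zeta>)"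
proof -
  have "(F \<circ> exp) holomorphic_on UNIV"
    by (rule holomorphic_on_compose_gen[OF holomorphic_on_exp assms]) auto
  then have "(\<lambda>\<zeta>. F (exp \<zeta>) * exp \<zeta>) holomorphic_on UNIV"
    by (intro holomorphic_intros) (simp add: o_def)
  then show ?thesis
    using holomorphic_convex_primitive'[of UNIV "\<lambda>\<zeta>. F (exp \<zeta>) * exp \<zeta>"] that by (metis UNIV_I convex_UNIV open_UNIV)
qed

lemma contour_integral_unit_circle_rotate:
  assumes "F holomorphic_on - {0}" "a \<noteq> 0"
  shows "contour_integral (circlepath 0 1) (\<lambda>t. F (a * t) * a) = contour_integral (circlepath 0 1) F"
proof -
  obtain P where P: "\<And>\<zeta>. (P has_field_derivative F (exp \<zeta>) * exp \<zeta>) (at \<zeta>)"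
    using exponential_primitive[OF assms(1)] by blast
  have "((\<lambda>\<zeta>. P (Ln a + \<zeta>)) has_field_derivative F (a * exp \<zeta>) * a * exp \<zeta>) (at \<zeta>)" for \<zeta>
  proof -
    have "((\<lambda>\<zeta>. P (Ln a + \<zeta>)) has_field_derivative F (exp (Ln a + \<zeta>)) * exp (Ln a + \<zeta>) * 1) (at \<zeta>)"
      by (rule DERIV_chain2[OF P]) (auto intro!: derivative_eq_intros)
    then show ?thesis using assms(2) by (simp add: exp_add mult.assoc)
  qed
  from contour_integral_unit_circle_primitive[where F = "\<lambda>t. F (a * t) * a", OF this, of 0]
    contour_integral_unit_circle_primitive[OF P, of "Ln a"]
  show ?thesis by (simp add: add.assoc)
qed

lemma contour_integral_unit_circle_invert:
  assumes "F holomorphic_on - {0}"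
  shows "contour_integral (circlepath 0 1) (\<lambda>t. F (inverse t) / t^2) = contour_integral (circlepath 0 1) F"
proof -
  obtain P where P: "\<And>\<zeta>. (P has_field_derivative F (exp \<zeta>) * exp \<zeta>) (at \<zeta>)"
    using exponential_primitive[OF assms] by blast
  have "((\<lambda>\<zeta>. - P (- \<zeta>)) has_field_derivative (F (inverse (exp \<zeta>)) / (exp \<zeta>)^2) * exp \<zeta>) (at \<zeta>)" for \<zeta>
  proof -
    have "((\<lambda>\<zeta>. - P (- \<zeta>)) has_field_derivative - (F (exp (- \<zeta>)) * exp (- \<zeta>) * (-1))) (at \<zeta>)"
      by (intro DERIV_minus DERIV_chain2[OF P]) (auto intro!: derivative_eq_intros)
    then show ?thesis by (simp add: exp_minus field_simps power2_eq_square)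
  qed
  from contour_integral_unit_circle_primitive[where F = "\<lambda>t. F (inverse t) / t^2", OF this, of "- (2 * of_real pi * \<i>)"]
    contour_integral_unit_circle_primitive[OF P, of 0]
  show ?thesis by simp
qed

text \<open>
  The coefficient of \<open>t\<^sup>n\<close>.  Coefficients of negative index are those of \<open>\<lambda>t. f (inverse t)\<close>.
\<close>

definition laurent_coeff :: "(complex \<Rightarrow> complex) \<Rightarrow> nat \<Rightarrow> complex" where
  "laurent_coeff f n = contour_integral (circlepath 0 1) (\<lambda>t. f t / t ^ Suc n) / (2 * of_real pi * \<i>)"

lemma laurent_coeff_rotate:
  assumes "f holomorphic_on - {0}" "a \<noteq> 0"
  shows "laurent_coeff (\<lambda>t. f (a * t)) n = a ^ n * laurent_coeff f n"
proof -
  have "(\<lambda>t. f t / t ^ Suc n) holomorphic_on - {0}"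
    by (intro holomorphic_intros assms(1)) auto
  from contour_integral_unit_circle_rotate[OF this assms(2)]
  have "contour_integral (circlepath 0 1) (\<lambda>t. f t / t ^ Suc n) =
      contour_integral (circlepath 0 1) (\<lambda>t. f (a * t) / t ^ Suc n / a ^ n)"
    using assms(2) by (simp add: field_simps power_mult_distrib)
  also have "\<dots> = contour_integral (circlepath 0 1) (\<lambda>t. f (a * t) / t ^ Suc n) / a ^ n"
  proof (rule contour_integral_div)
    have "(\<lambda>t. f (a * t)) holomorphic_on - {0}"
      using assms(2) by (intro holomorphic_on_compose_gen[OF _ assms(1), unfolded o_def] holomorphic_intros) auto
    then have "(\<lambda>t. f (a * t) / t ^ Suc n) holomorphic_on - {0}"
      by (intro holomorphic_intros) auto
    then show "(\<lambda>t. f (a * t) / t ^ Suc n) contour_integrable_on circlepath 0 1"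
      by (intro contour_integrable_continuous_circlepath)
         (auto intro!: holomorphic_on_imp_continuous_on elim: holomorphic_on_subset)
  qed
  finally show ?thesis using assms(2) by (simp add: laurent_coeff_def)
qed

lemma holomorphic_punctured_circle_integrable:
  assumes "f holomorphic_on - {0}" "r > 0"
  shows "f contour_integrable_on circlepath 0 r"
  by (rule contour_integrable_continuous_circlepath)
     (use assms in \<open>auto intro!: holomorphic_on_imp_continuous_on elim: holomorphic_on_subset\<close>)

lemma contour_integral_circle_radius:
  assumes "f holomorphic_on - {0}" "r > 0" "s > 0"
  shows "contour_integral (circlepath 0 r) f = contour_integral (circlepath 0 s) f"
proof (cases "r \<le> s")
  case True
  then show ?thesis
    using contour_integral_circlepath_eq(3)[of UNIV f 0 r s] assms by (simp add: Compl_eq_Diff_UNIV)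
next
  case False
  then show ?thesis
    using contour_integral_circlepath_eq(3)[of UNIV f 0 s r] assms by (simp add: Compl_eq_Diff_UNIV)
qed

lemma contour_integral_circle_bound:
  assumes "continuous_on (sphere 0 r) f" "r > 0" "B \<ge> 0" "\<And>t. norm t = r \<Longrightarrow> norm (f t) \<le> B"
  shows "norm (contour_integral (circlepath 0 r) f) \<le> B * (2 * pi * r)"
proof -
  have "f contour_integrable_on circlepath 0 r"
    by (rule contour_integrable_continuous_circlepath) (use assms in simp)
  then have "(f has_contour_integral contour_integral (circlepath 0 r) f) (circlepath 0 r)"
    by (rule has_contour_integral_integral)
  then show ?thesis
    by (rule has_contour_integral_bound_circlepath) (use assms in auto)
qed

text \<open>
  Cauchy's formula for the annulus between the circles of radius \<open>1/2\<close> and \<open>2\<close>, with both Cauchy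
  kernels truncated to geometric sums.
\<close>

lemma laurent_truncation:
  assumes f: "f holomorphic_on - {0}" and M: "M \<ge> 0"
    and outer: "\<And>t. norm t = 2 \<Longrightarrow> norm (f t) \<le> M"
    and inner: "\<And>t. norm t = 1/2 \<Longrightarrow> norm (f t) \<le> M"
  shows "norm (f 1 - ((\<Sum>n<N. laurent_coeff f n) + (\<Sum>n<N. laurent_coeff (\<lambda>t. f (inverse t)) (Suc n))))
    \<le> 3 * M / 2 ^ N"
proof -
  let ?I = "\<lambda>r g. contour_integral (circlepath 0 r) g"
  let ?c = "2 * of_real pi * \<i> :: complex"
  have cont: "continuous_on (sphere 0 r) g" if "g holomorphic_on - {0}" "r > 0" for g r
    using that by (intro holomorphic_on_imp_continuous_on) (auto elim!: holomorphic_on_subset)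
  have f_cont: "continuous_on (sphere 0 r) f" if "r > 0" for r by (rule cont[OF f that])
  define D where "D t = (if t = 1 then deriv f 1 else (f t - f 1) / (t - 1))" for t
  have "D holomorphic_on - {0}"
    unfolding D_def by (rule pole_lemma[OF f]) (simp add: interior_open open_Compl)
  then have D_eq: "?I 2 D = ?I (1/2) D" by (rule contour_integral_circle_radius) auto
  have D_split: "?I r D = ?I r (\<lambda>t. f t / (t - 1)) - f 1 * ?I r (\<lambda>t. 1 / (t - 1))" if r: "r > 0" "r \<noteq> 1" for r
  proof -
    have "?I r D = ?I r (\<lambda>t. f t / (t - 1) - f 1 * (1 / (t - 1)))"
      by (rule contour_integral_cong) (use r in \<open>auto simp: D_def diff_divide_distrib\<close>)
    also have "\<dots> = ?I r (\<lambda>t. f t / (t - 1)) - ?I r (\<lambda>t. f 1 * (1 / (t - 1)))"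
      by (intro contour_integral_diff contour_integrable_continuous_circlepath continuous_intros)
         (use r f_cont in auto)
    also have "?I r (\<lambda>t. f 1 * (1 / (t - 1))) = f 1 * ?I r (\<lambda>t. 1 / (t - 1))"
      by (intro contour_integral_lmul contour_integrable_continuous_circlepath continuous_intros)
         (use r in auto)
    finally show ?thesis .
  qed
  have "((\<lambda>t. 1 / (t - 1)) has_contour_integral ?c * 1) (circlepath 0 2)"
    using Cauchy_integral_circlepath_simple[of "\<lambda>_. 1" 0 2 1] by simp
  then have out1: "?I 2 (\<lambda>t. 1 / (t - 1)) = ?c" using contour_integral_unique by fastforce
  have "((\<lambda>t. 1 / (t - 1)) has_contour_integral 0) (circlepath 0 (1/2))"
  proof (rule Cauchy_theorem_convex_simple[of _ "cball 0 (1/2)"])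
    show "(\<lambda>t. 1 / (t - 1)) holomorphic_on cball 0 (1/2)"
      by (intro holomorphic_intros) auto
  qed auto
  then have in1: "?I (1/2) (\<lambda>t. 1 / (t - 1)) = 0" by (rule contour_integral_unique)
  have cauchy: "?c * f 1 = ?I 2 (\<lambda>t. f t / (t - 1)) - ?I (1/2) (\<lambda>t. f t / (t - 1))"
  proof -
    have "?I 2 (\<lambda>t. f t / (t - 1)) - f 1 * ?c = ?I (1/2) (\<lambda>t. f t / (t - 1))"
      using D_eq D_split[of 2] D_split[of "1/2"] out1 in1 by simp
    then have "?I 2 (\<lambda>t. f t / (t - 1)) = ?I (1/2) (\<lambda>t. f t / (t - 1)) + f 1 * ?c"
      by (simp only: diff_eq_eq)
    then show ?thesis by (simp only: mult.commute add_diff_cancel_left')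
  qed
  have pow_hol: "(\<lambda>t. f t / t ^ Suc n) holomorphic_on - {0}" for n
    by (intro holomorphic_intros f) auto
  have coeff: "?I 2 (\<lambda>t. f t / t ^ Suc n) = ?c * laurent_coeff f n" for n
    using contour_integral_circle_radius[OF pow_hol, of 2 1 n] by (simp add: laurent_coeff_def)
  \<comment> \<open>The outer circle, where \<open>1 / (t - 1)\<close> expands in powers of \<open>1 / t\<close>.\<close>
  define R2 where "R2 = ?I 2 (\<lambda>t. f t / (t ^ N * (t - 1)))"
  have "?I 2 (\<lambda>t. f t / (t - 1)) = ?I 2 (\<lambda>t. (\<Sum>n<N. f t / t ^ Suc n) + f t / (t ^ N * (t - 1)))"
  proof (rule contour_integral_cong)
    fix t assume "t \<in> path_image (circlepath 0 2)"
    then have t: "t \<noteq> 0" "t \<noteq> 1" by auto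
    have "f t / (t - 1) = (\<Sum>n<k. f t / t ^ Suc n) + f t / (t ^ k * (t - 1))" for k
    proof (induction k)
      case (Suc k)
      have "f t / t ^ Suc k + f t / (t ^ Suc k * (t - 1)) = f t / (t ^ k * (t - 1))"
        using t by (simp add: field_simps)
      then show ?case using Suc by (simp add: add.assoc)
    qed simp
    then show "f t / (t - 1) = (\<Sum>n<N. f t / t ^ Suc n) + f t / (t ^ N * (t - 1))" .
  qed simp
  also have "\<dots> = ?I 2 (\<lambda>t. \<Sum>n<N. f t / t ^ Suc n) + R2"
    unfolding R2_def
    by (intro contour_integral_add contour_integrable_sum holomorphic_punctured_circle_integrable pow_hol
        contour_integrable_continuous_circlepath continuous_intros) (use f_cont in auto)
  also have "?I 2 (\<lambda>t. \<Sum>n<N. f t / t ^ Suc n) = (\<Sum>n<N. ?c * laurent_coeff f n)"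
    unfolding coeff[symmetric]
    by (intro contour_integral_sum holomorphic_punctured_circle_integrable pow_hol) auto
  finally have outer_eq: "?I 2 (\<lambda>t. f t / (t - 1)) = (\<Sum>n<N. ?c * laurent_coeff f n) + R2" .
  have "norm R2 \<le> (M / 2 ^ N) * (2 * pi * 2)"
    unfolding R2_def
  proof (rule contour_integral_circle_bound)
    show "continuous_on (sphere 0 2) (\<lambda>t. f t / (t ^ N * (t - 1)))"
      by (intro continuous_intros f_cont) auto
    fix t :: complex assume t: "norm t = 2"
    have "norm (t - 1) \<ge> 1" using norm_triangle_ineq2[of t 1] t by simp
    then have "norm (f t) / (2 ^ N * norm (t - 1)) \<le> M / (2 ^ N * 1)"
      using outer[OF t] M by (intro frac_le mult_left_mono) auto
    then show "norm (f t / (t ^ N * (t - 1))) \<le> M / 2 ^ N"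
      by (simp add: norm_divide norm_mult norm_power t)
  qed (use M in auto)
  then have R2: "norm R2 \<le> 2 * pi * (2 * M / 2 ^ N)" by (simp add: mult_ac)
  have mul_hol: "(\<lambda>t. f t * t ^ n) holomorphic_on - {0}" for n
    by (intro holomorphic_intros f)
  have coeff': "?I (1/2) (\<lambda>t. f t * t ^ n) = ?c * laurent_coeff (\<lambda>t. f (inverse t)) (Suc n)" for n
  proof -
    have "?I (1/2) (\<lambda>t. f t * t ^ n) = ?I 1 (\<lambda>t. f t * t ^ n)"
      by (rule contour_integral_circle_radius[OF mul_hol]) auto
    also have "\<dots> = ?I 1 (\<lambda>t. (f (inverse t) * inverse t ^ n) / t^2)"
      by (rule contour_integral_unit_circle_invert[OF mul_hol, symmetric])
    also have "\<dots> = ?I 1 (\<lambda>t. f (inverse t) / t ^ Suc (Suc n))"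
      by (rule contour_integral_cong) (auto simp: field_simps power2_eq_square)
    finally show ?thesis by (simp add: laurent_coeff_def)
  qed
  \<comment> \<open>The inner circle, where \<open>1 / (t - 1)\<close> expands in powers of \<open>t\<close>.\<close>
  define R1 where "R1 = ?I (1/2) (\<lambda>t. f t * t ^ N / (t - 1))"
  have "?I (1/2) (\<lambda>t. f t / (t - 1)) = ?I (1/2) (\<lambda>t. f t * t ^ N / (t - 1) - (\<Sum>n<N. f t * t ^ n))"
  proof (rule contour_integral_cong)
    fix t assume "t \<in> path_image (circlepath 0 (1/2))"
    then have t: "t \<noteq> 1" by auto
    have "f t / (t - 1) = f t * t ^ k / (t - 1) - (\<Sum>n<k. f t * t ^ n)" for k
    proof (induction k)
      case (Suc k)
      have "f t * t ^ Suc k / (t - 1) - f t * t ^ k = f t * t ^ k / (t - 1)"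
        using t by (simp add: field_simps)
      then show ?case using Suc by simp
    qed simp
    then show "f t / (t - 1) = f t * t ^ N / (t - 1) - (\<Sum>n<N. f t * t ^ n)" .
  qed simp
  also have "\<dots> = R1 - ?I (1/2) (\<lambda>t. \<Sum>n<N. f t * t ^ n)"
    unfolding R1_def
    by (intro contour_integral_diff contour_integrable_sum holomorphic_punctured_circle_integrable mul_hol
        contour_integrable_continuous_circlepath continuous_intros) (use f_cont in auto)
  also have "?I (1/2) (\<lambda>t. \<Sum>n<N. f t * t ^ n) = (\<Sum>n<N. ?c * laurent_coeff (\<lambda>t. f (inverse t)) (Suc n))"
    unfolding coeff'[symmetric]
    by (intro contour_integral_sum holomorphic_punctured_circle_integrable mul_hol) auto
  finally have inner_eq: "?I (1/2) (\<lambda>t. f t / (t - 1)) =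
      R1 - (\<Sum>n<N. ?c * laurent_coeff (\<lambda>t. f (inverse t)) (Suc n))" .
  have "norm R1 \<le> (2 * M / 2 ^ N) * (2 * pi * (1/2))"
    unfolding R1_def
  proof (rule contour_integral_circle_bound)
    show "continuous_on (sphere 0 (1/2)) (\<lambda>t. f t * t ^ N / (t - 1))"
      by (intro continuous_intros f_cont) auto
    fix t :: complex assume t: "norm t = 1/2"
    have "norm (t - 1) \<ge> 1/2" using norm_triangle_ineq2[of 1 t] t by (simp add: norm_minus_commute)
    then have "norm (f t) * (1/2) ^ N / norm (t - 1) \<le> M * (1/2) ^ N / (1/2)"
      using inner[OF t] M by (intro frac_le mult_right_mono) auto
    then show "norm (f t * t ^ N / (t - 1)) \<le> 2 * M / 2 ^ N"
      by (simp add: norm_divide norm_mult norm_power t power_divide mult.commute[of 2 M])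
  qed (use M in auto)
  then have R1: "norm R1 \<le> 2 * pi * (M / 2 ^ N)" by (simp add: mult_ac)
  let ?S = "(\<Sum>n<N. laurent_coeff f n) + (\<Sum>n<N. laurent_coeff (\<lambda>t. f (inverse t)) (Suc n))"
  have "?c * (f 1 - ?S) = R2 - R1"
    using cauchy outer_eq inner_eq by (simp add: sum_distrib_left[symmetric] algebra_simps)
  then have "2 * pi * norm (f 1 - ?S) = norm (R2 - R1)"
    by (metis (no_types, lifting) abs_of_nonneg norm_mult norm_ii norm_numeral norm_of_real mult.right_neutral pi_ge_zero)
  also have "\<dots> \<le> 2 * pi * (2 * M / 2 ^ N) + 2 * pi * (M / 2 ^ N)"
    using norm_triangle_ineq4[of R2 R1] R1 R2 by linarith
  also have "\<dots> = 2 * pi * (3 * M / 2 ^ N)" by (simp add: field_simps)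
  finally show ?thesis by (rule mult_left_le_imp_le) simp
qed

lemma continuous_on_laurent_coeff:
  assumes "continuous_on (U \<times> sphere 0 1) (\<lambda>(z, t). h z t)"
  shows "continuous_on U (\<lambda>z. laurent_coeff (h z) n)"
proof -
  let ?e = "\<lambda>x. exp (2 * of_real pi * \<i> * complex_of_real x)"
  have "continuous_on (U \<times> {0..1}) (\<lambda>p. (\<lambda>(z, t). h z t) (fst p, ?e (snd p)))"
    by (rule continuous_on_compose2[OF assms]) (auto intro!: continuous_intros)
  then have "continuous_on (U \<times> cbox 0 1) (\<lambda>(z, x). h z (?e x) / ?e x ^ Suc n * (2 * of_real pi * \<i> * ?e x))"
    by (auto intro!: continuous_intros simp: case_prod_unfold)
  then have "continuous_on U (\<lambda>z. integral (cbox 0 1)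
      (\<lambda>x. h z (?e x) / ?e x ^ Suc n * (2 * of_real pi * \<i> * ?e x)))"
    by (rule integral_continuous_on_param)
  then show ?thesis
    unfolding laurent_coeff_def contour_integral_integral vector_derivative_circlepath
    unfolding circlepath
    by (auto intro!: continuous_intros)
qed

text \<open>
  By Morera's theorem: the order of integration over a triangle and over the circle may be exchanged.
\<close>

lemma holomorphic_on_laurent_coeff:
  assumes cont: "continuous_on (UNIV \<times> sphere 0 1) (\<lambda>(z, t). h z t)"
    and hol: "\<And>t. norm t = 1 \<Longrightarrow> (\<lambda>z. h z t) holomorphic_on UNIV"
  shows "(\<lambda>z. laurent_coeff (h z) n) holomorphic_on UNIV"
proof -
  let ?G = "\<lambda>z. contour_integral (circlepath 0 1) (\<lambda>t. h z t / t ^ Suc n)"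
  have cont': "continuous_on (UNIV \<times> sphere 0 1) (\<lambda>(z, t). h z t / t ^ Suc n)"
    using cont by (auto intro!: continuous_intros simp: case_prod_unfold)
  have "continuous_on UNIV (\<lambda>z. laurent_coeff (h z) n * (2 * of_real pi * \<i>))"
    by (intro continuous_intros continuous_on_laurent_coeff[OF cont])
  then have G_cont: "continuous_on UNIV ?G" by (simp add: laurent_coeff_def)
  have "?G analytic_on UNIV"
  proof (rule Morera_triangle[OF G_cont open_UNIV], intro impI)
    fix a b c :: complex
    let ?L = "\<lambda>a b t. contour_integral (linepath a b) (\<lambda>z. h z t / t ^ Suc n)"
    have swap: "contour_integral (linepath a b) ?G = contour_integral (circlepath 0 1) (?L a b)"
      and int: "?L a b contour_integrable_on circlepath 0 1" for a b
    proof -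
      have c: "continuous_on (path_image (linepath a b) \<times> path_image (circlepath 0 1)) (\<lambda>(z, t). h z t / t ^ Suc n)"
        by (rule continuous_on_subset[OF cont']) auto
      show "contour_integral (linepath a b) ?G = contour_integral (circlepath 0 1) (?L a b)"
        by (rule contour_integral_swap[OF c]) (auto simp: vector_derivative_circlepath intro!: continuous_intros)
      have "continuous_on (sphere 0 1 \<times> cbox 0 1)
          (\<lambda>(t, x). h (linepath a b x) t / t ^ Suc n * (b - a))"
      proof -
        have "continuous_on (sphere 0 1 \<times> cbox 0 1) (\<lambda>p. (\<lambda>(z, t). h z t / t ^ Suc n) (linepath a b (snd p), fst p))"
          by (rule continuous_on_compose2[OF cont']) (auto intro!: continuous_intros simp: linepath_def)
        from continuous_on_mult[OF this continuous_on_const[of _ "b - a"]] show ?thesis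
          by (simp only: case_prod_unfold fst_conv snd_conv)
      qed
      then have "continuous_on (sphere 0 1) (\<lambda>t. integral (cbox 0 1) (\<lambda>x. h (linepath a b x) t / t ^ Suc n * (b - a)))"
        by (rule integral_continuous_on_param)
      then show "?L a b contour_integrable_on circlepath 0 1"
        by (intro contour_integrable_continuous_circlepath) (simp add: contour_integral_integral)
    qed
    have "?L a b t + ?L b c t + ?L c a t = 0" if "norm t = 1" for t
    proof -
      have "(\<lambda>z. h z t / t ^ Suc n) holomorphic_on convex hull {a, b, c}"
        using that by (intro holomorphic_intros holomorphic_on_subset[OF hol]) auto
      from Cauchy_theorem_triangle[OF this] have "contour_integral (linepath a b +++ linepath b c +++ linepath c a) (\<lambda>z. h z t / t ^ Suc n) = 0"
        by (rule contour_integral_unique)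
      moreover have "(\<lambda>z. h z t / t ^ Suc n) contour_integrable_on linepath x y" for x y
        using that by (intro contour_integrable_continuous_linepath holomorphic_on_imp_continuous_on
            holomorphic_intros holomorphic_on_subset[OF hol]) auto
      ultimately show ?thesis by (simp add: add.assoc)
    qed
    then have "contour_integral (circlepath 0 1) (\<lambda>t. ?L a b t + (?L b c t + ?L c a t)) =
        contour_integral (circlepath 0 1) (\<lambda>t. 0)"
      by (intro contour_integral_cong) (auto simp: add.assoc)
    then show "contour_integral (linepath a b) ?G + contour_integral (linepath b c) ?G +
        contour_integral (linepath c a) ?G = 0"
      unfolding swap
      by (simp only: contour_integral_add contour_integrable_add int add.assoc
        contour_integral_unique[OF has_contour_integral_0])
  qed
  then have "?G holomorphic_on UNIV" by (rule analytic_imp_holomorphic)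
  then show ?thesis unfolding laurent_coeff_def by (intro holomorphic_intros) auto
qed

lemma entire_polynomial_approximation:
  assumes G: "G holomorphic_on UNIV" and "R > 0" "e > 0"
  obtains a K where "\<And>z. norm z \<le> R \<Longrightarrow> norm (G z - (\<Sum>k<K. a k * z ^ k)) < e"
proof -
  define a where "a k = (deriv ^^ k) G 0 / fact k" for k
  have sums: "(\<lambda>k. a k * z ^ k) sums G z" for z
    using holomorphic_power_series[of G 0 "norm z + 1" z] G holomorphic_on_subset
    by (fastforce simp: a_def)
  have "summable (\<lambda>k. norm (a k * complex_of_real R ^ k))"
    by (rule powser_insidea[of _ "complex_of_real (R + 1)"]) (use sums[THEN sums_summable] assms in auto)
  then have "uniform_limit (cball 0 R) (\<lambda>n z. \<Sum>k<n. a k * z ^ k) (\<lambda>z. suminf (\<lambda>k. a k * z ^ k)) sequentially"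
  proof (rule Weierstrass_m_test[rotated])
    fix n and z :: complex assume "z \<in> cball 0 R"
    then show "norm (a n * z ^ n) \<le> norm (a n * complex_of_real R ^ n)"
      using assms(2) by (auto simp: norm_mult norm_power intro!: mult_left_mono power_mono)
  qed
  then have "uniform_limit (cball 0 R) (\<lambda>n z. \<Sum>k<n. a k * z ^ k) G sequentially"
    using sums by (simp add: sums_iff)
  from uniform_limitD[OF this assms(3)] obtain K where
    "\<And>z. z \<in> cball 0 R \<Longrightarrow> dist (\<Sum>k<K. a k * z ^ k) (G z) < e"
    unfolding eventually_sequentially by blast
  then show ?thesis by (intro that[of a K]) (auto simp: dist_norm norm_minus_commute)
qed

section \<open>Polynomial approximation on the quadric\<close>

text \<open>
  In null coordinates the quadric is \<open>c\<^sup>2 = 1 + a b\<close>, with the action \<open>(t a, b / t, c)\<close> of the nonzero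
  complex numbers \<open>t\<close>.
\<close>

definition null_quadric :: "(complex \<times> complex \<times> complex) set" where
  "null_quadric = {(a, b, c). c^2 = 1 + a * b}"

lemma compact_null_quadric_box:
  "compact (null_quadric \<inter> (cball 0 R1 \<times> cball 0 R2 \<times> cball 0 R3))"
proof (rule closed_Int_compact)
  have "closed {p :: complex \<times> complex \<times> complex. snd (snd p) ^ 2 = 1 + fst p * fst (snd p)}"
    by (intro closed_Collect_eq continuous_intros)
  then show "closed null_quadric" by (simp add: null_quadric_def case_prod_unfold)
qed (intro compact_Times compact_cball)

text \<open>
  Holomorphy is only used along holomorphic curves in the quadric: the orbits of the action, and the
  curves on which \<open>c\<close> varies and \<open>a\<close> or \<open>b\<close> is fixed.
\<close>

locale null_quadric_holomorphic =
  fixes g :: "complex \<Rightarrow> complex \<Rightarrow> complex \<Rightarrow> complex"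
  assumes cont: "continuous_on null_quadric (\<lambda>(a, b, c). g a b c)"
    and curves: "\<And>\<Omega> \<alpha> \<beta> \<kappa>. \<lbrakk>open \<Omega>; \<alpha> holomorphic_on \<Omega>; \<beta> holomorphic_on \<Omega>; \<kappa> holomorphic_on \<Omega>;
        \<And>z. z \<in> \<Omega> \<Longrightarrow> (\<kappa> z)^2 = 1 + \<alpha> z * \<beta> z\<rbrakk> \<Longrightarrow> (\<lambda>z. g (\<alpha> z) (\<beta> z) (\<kappa> z)) holomorphic_on \<Omega>"
begin

text \<open>
  The orbit on which this coefficient is taken is that of \<open>(1, c\<^sup>2 - 1, c)\<close>.
\<close>

definition plus_coeff :: "nat \<Rightarrow> complex \<Rightarrow> complex" where
  "plus_coeff n c = laurent_coeff (\<lambda>s. g s ((c^2 - 1) / s) c) n"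

lemma plus_coeff_entire: "plus_coeff n holomorphic_on UNIV"
  unfolding plus_coeff_def[abs_def]
proof (rule holomorphic_on_laurent_coeff)
  have "continuous_on (UNIV \<times> sphere 0 1)
      (\<lambda>p. (\<lambda>(a, b, c). g a b c) (snd p, ((fst p)^2 - 1) / snd p, fst p))"
    by (rule continuous_on_compose2[OF cont]) (auto intro!: continuous_intros simp: null_quadric_def)
  then show "continuous_on (UNIV \<times> sphere 0 1) (\<lambda>(c, s). g s ((c\<^sup>2 - 1) / s) c)"
    by (simp add: case_prod_unfold)
  fix s :: complex assume "norm s = 1"
  then have "s \<noteq> 0" by auto
  then show "(\<lambda>c. g s ((c\<^sup>2 - 1) / s) c) holomorphic_on UNIV"
    by (intro curves holomorphic_intros) auto
qed

lemma orbit_holomorphic: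
  assumes "c^2 = 1 + a * b"
  shows "(\<lambda>t. g (a * t) (b / t) c) holomorphic_on - {0}"
  by (rule curves) (use assms in \<open>auto intro!: holomorphic_intros simp: open_Compl\<close>)

text \<open>
  If \<open>a \<noteq> 0\<close>, then \<open>(a, b, c)\<close> lies on the orbit of \<open>(1, c\<^sup>2 - 1, c)\<close>, at the parameter \<open>t = a\<close>.
\<close>

lemma laurent_coeff_orbit:
  assumes "c^2 = 1 + a * b" "a \<noteq> 0"
  shows "laurent_coeff (\<lambda>t. g (a * t) (b / t) c) n = a ^ n * plus_coeff n c"
proof -
  have "c^2 = 1 + 1 * (c^2 - 1)" by simp
  from orbit_holomorphic[OF this]
  have "(\<lambda>s. g s ((c^2 - 1) / s) c) holomorphic_on - {0}" by simp
  from laurent_coeff_rotate[OF this assms(2), of n]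
  have "laurent_coeff (\<lambda>t. g (a * t) ((c^2 - 1) / (a * t)) c) n = a ^ n * plus_coeff n c"
    by (simp add: plus_coeff_def)
  moreover have "(c^2 - 1) / (a * t) = b / t" for t using assms by simp
  ultimately show ?thesis by simp
qed

end

lemma null_quadric_holomorphic_swap:
  assumes "null_quadric_holomorphic g"
  shows "null_quadric_holomorphic (\<lambda>a b c. g b a c)"
proof
  interpret null_quadric_holomorphic g by fact
  have "continuous_on null_quadric (\<lambda>p. (\<lambda>(a, b, c). g a b c) (fst (snd p), fst p, snd (snd p)))"
    by (rule continuous_on_compose2[OF cont])
       (auto intro!: continuous_intros simp: null_quadric_def mult.commute)
  then show "continuous_on null_quadric (\<lambda>(a, b, c). g b a c)" by (simp add: case_prod_unfold)
  show "(\<lambda>z. g (\<beta> z) (\<alpha> z) (\<kappa> z)) holomorphic_on \<Omega>"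
    if "open \<Omega>" "\<alpha> holomorphic_on \<Omega>" "\<beta> holomorphic_on \<Omega>" "\<kappa> holomorphic_on \<Omega>"
      "\<And>z. z \<in> \<Omega> \<Longrightarrow> (\<kappa> z)^2 = 1 + \<alpha> z * \<beta> z" for \<Omega> \<alpha> \<beta> \<kappa>
    by (rule curves) (use that in \<open>auto simp: mult.commute\<close>)
qed

context null_quadric_holomorphic
begin

interpretation swap: null_quadric_holomorphic "\<lambda>a b c. g b a c"
  by (rule null_quadric_holomorphic_swap) unfold_locales

definition partial_expansion :: "nat \<Rightarrow> complex \<Rightarrow> complex \<Rightarrow> complex \<Rightarrow> complex" where
  "partial_expansion N a b c =
    (\<Sum>n<N. a ^ n * plus_coeff n c) + (\<Sum>n<N. b ^ Suc n * swap.plus_coeff (Suc n) c)"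

text \<open>
  On the circles \<open>\<bar>t\<bar> = 2\<close> and \<open>\<bar>t\<bar> = 1/2\<close> the orbit of a point stays in the box of twice the size.
\<close>

lemma partial_expansion_error_generic:
  assumes abc: "c^2 = 1 + a * b" "a \<noteq> 0" "b \<noteq> 0"
    and R: "norm a \<le> R" "norm b \<le> R" "norm c \<le> R"
    and M: "\<And>a b c. \<lbrakk>c^2 = 1 + a * b; norm a \<le> 2 * R; norm b \<le> 2 * R; norm c \<le> R\<rbrakk> \<Longrightarrow> norm (g a b c) \<le> M"
  shows "norm (g a b c - partial_expansion N a b c) \<le> 3 * M / 2 ^ N"
proof -
  let ?f = "\<lambda>t. g (a * t) (b / t) c"
  have bound: "norm (?f t) \<le> M" if "norm t = 2 \<or> norm t = 1/2" for t
  proof (rule M)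
    have "t \<noteq> 0" using that by auto
    then show "c^2 = 1 + a * t * (b / t)" using abc by simp
    have "norm t \<le> 2 \<and> inverse (norm t) \<le> 2"
      using that by (elim disjE) (simp_all only:, simp_all)
    then have t: "norm t \<le> 2" "inverse (norm t) \<le> 2" by auto
    have "R \<ge> 0" using R(1) norm_ge_zero[of a] by linarith
    then show "norm (a * t) \<le> 2 * R" "norm (b / t) \<le> 2 * R"
      using mult_mono[OF R(1) t(1)] mult_mono[OF R(2) t(2)]
      by (simp_all add: norm_mult norm_inverse divide_inverse mult.commute)
  qed (rule R)
  have "M \<ge> 0" using order_trans[OF norm_ge_zero bound[of 2]] by simp
  have inv: "?f (inverse t) = (\<lambda>a b c. g b a c) (b * t) (a / t) c" for t
    by (simp add: field_simps)
  have "norm (?f 1 - ((\<Sum>n<N. laurent_coeff ?f n) + (\<Sum>n<N. laurent_coeff (\<lambda>t. ?f (inverse t)) (Suc n))))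
      \<le> 3 * M / 2 ^ N"
    by (rule laurent_truncation[OF orbit_holomorphic[OF abc(1)] \<open>M \<ge> 0\<close>]) (use bound in auto)
  moreover have "laurent_coeff ?f n = a ^ n * plus_coeff n c" for n
    using laurent_coeff_orbit[OF abc(1,2)] .
  moreover have "laurent_coeff (\<lambda>t. ?f (inverse t)) n = b ^ n * swap.plus_coeff n c" for n
    unfolding inv by (rule swap.laurent_coeff_orbit) (use abc in \<open>simp_all add: mult.commute\<close>)
  ultimately show ?thesis by (simp add: partial_expansion_def)
qed

text \<open>
  The points with \<open>a b \<noteq> 0\<close> are dense in the quadric: if \<open>a b = 0\<close>, then \<open>c\<^sup>2 = 1\<close>, and moving \<open>a\<close>
  and \<open>b\<close> by a small amount requires multiplying \<open>c\<close> by a square root close to \<open>1\<close>.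
\<close>

lemma partial_expansion_error:
  assumes abc: "c^2 = 1 + a * b"
    and R: "norm a < R" "norm b < R" "norm c < R"
    and M: "\<And>a b c. \<lbrakk>c^2 = 1 + a * b; norm a \<le> 2 * R; norm b \<le> 2 * R; norm c \<le> R\<rbrakk> \<Longrightarrow> norm (g a b c) \<le> M"
  shows "norm (g a b c - partial_expansion N a b c) \<le> 3 * M / 2 ^ N"
proof (cases "a * b = 0")
  case False
  then have "a \<noteq> 0" "b \<noteq> 0" by auto
  with abc show ?thesis
    by (rule partial_expansion_error_generic[where R = R]) (use R M in auto)
next
  case True
  define x where "x d = (a + d, b + d, c * csqrt (1 + (a + d) * (b + d)))" for d :: complex
  have x_in: "x d \<in> null_quadric" for d
    using abc True by (simp add: x_def null_quadric_def power_mult_distrib)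
  have comp: "((\<lambda>d. a + d) \<longlongrightarrow> a) (at 0)" "((\<lambda>d. b + d) \<longlongrightarrow> b) (at 0)"
    by (auto intro!: tendsto_eq_intros)
  have c_lim: "((\<lambda>d. c * csqrt (1 + (a + d) * (b + d))) \<longlongrightarrow> c) (at 0)"
  proof -
    have "((\<lambda>d. 1 + (a + d) * (b + d)) \<longlongrightarrow> 1 + a * b) (at 0)"
      by (intro tendsto_intros comp)
    then have "((\<lambda>d. csqrt (1 + (a + d) * (b + d))) \<longlongrightarrow> csqrt 1) (at 0)"
      using isCont_tendsto_compose[OF continuous_at_csqrt[of 1]] True by simp
    from tendsto_mult[OF tendsto_const this, of c] show ?thesis by simp
  qed
  have x_lim: "(x \<longlongrightarrow> (a, b, c)) (at 0)"
    unfolding x_def by (intro tendsto_Pair comp c_lim)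
  have h_cont: "continuous_on null_quadric (\<lambda>(a, b, c). g a b c - partial_expansion N a b c)"
  proof -
    have pc: "continuous_on UNIV (plus_coeff n)" "continuous_on UNIV (swap.plus_coeff n)" for n
      by (rule holomorphic_on_imp_continuous_on[OF plus_coeff_entire]
           holomorphic_on_imp_continuous_on[OF swap.plus_coeff_entire])+
    have "continuous_on null_quadric (\<lambda>p. partial_expansion N (fst p) (fst (snd p)) (snd (snd p)))"
      unfolding partial_expansion_def
      by (intro continuous_intros continuous_on_compose2[OF pc(1)] continuous_on_compose2[OF pc(2)]) auto
    from continuous_on_diff[OF cont[unfolded case_prod_unfold] this] show ?thesis
      by (simp only: case_prod_unfold)
  qed
  have "((\<lambda>d. (\<lambda>(a, b, c). g a b c - partial_expansion N a b c) (x d)) \<longlongrightarrow>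
      (\<lambda>(a, b, c). g a b c - partial_expansion N a b c) (a, b, c)) (at 0)"
    by (rule continuous_on_tendsto_compose[OF h_cont x_lim])
       (use abc x_in in \<open>auto simp: null_quadric_def\<close>)
  then have "((\<lambda>d. norm ((\<lambda>(a, b, c). g a b c - partial_expansion N a b c) (x d))) \<longlongrightarrow>
      norm (g a b c - partial_expansion N a b c)) (at 0)"
    using tendsto_norm by fastforce
  moreover have "\<forall>\<^sub>F d in at 0. norm ((\<lambda>(a, b, c). g a b c - partial_expansion N a b c) (x d)) \<le> 3 * M / 2 ^ N"
  proof -
    have "\<forall>\<^sub>F d in at 0. norm (a + d) < R" "\<forall>\<^sub>F d in at 0. norm (b + d) < R"
      "\<forall>\<^sub>F d in at 0. norm (c * csqrt (1 + (a + d) * (b + d))) < R"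
      using order_tendstoD(2)[OF tendsto_norm[OF comp(1)] R(1)]
        order_tendstoD(2)[OF tendsto_norm[OF comp(2)] R(2)]
        order_tendstoD(2)[OF tendsto_norm[OF c_lim] R(3)] by blast+
    moreover have "\<forall>\<^sub>F d in at 0. d \<noteq> - a" "\<forall>\<^sub>F d in at 0. d \<noteq> - b"
      by (rule eventually_neq_at_within)+
    ultimately show ?thesis
    proof eventually_elim
      case (elim d)
      then have "a + d \<noteq> 0" "b + d \<noteq> 0" by (simp_all add: add_eq_0_iff)
      then show ?case
        unfolding x_def prod.case using elim x_in[of d]
        by (intro partial_expansion_error_generic[where R = R]) (auto simp: x_def null_quadric_def intro: M)
    qed
  qed
  ultimately show ?thesis by (rule tendsto_upperbound) simp
qed

lemma polynomial_approximation:
  assumes "R > 0" "e > 0"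
  obtains N K1 K2 p q where
    "\<And>a b c. \<lbrakk>c^2 = 1 + a * b; norm a < R; norm b < R; norm c < R\<rbrakk> \<Longrightarrow>
      norm (g a b c - ((\<Sum>n<N. a ^ n * (\<Sum>k<K1 n. p n k * c ^ k)) +
                       (\<Sum>n<N. b ^ Suc n * (\<Sum>k<K2 n. q n k * c ^ k)))) < e"
proof -
  let ?B = "null_quadric \<inter> (cball 0 (2 * R) \<times> cball 0 (2 * R) \<times> cball 0 R)"
  have "compact ((\<lambda>(a, b, c). g a b c) ` ?B)"
    by (intro compact_continuous_image compact_null_quadric_box continuous_on_subset[OF cont]) auto
  from compact_imp_bounded[OF this]
  obtain M where M0: "M > 0" and "\<forall>y\<in>(\<lambda>(a, b, c). g a b c) ` ?B. norm y \<le> M"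
    unfolding bounded_pos by blast
  then have M: "norm (g a b c) \<le> M"
    if "c^2 = 1 + a * b" "norm a \<le> 2 * R" "norm b \<le> 2 * R" "norm c \<le> R" for a b c
    using that by (force simp: null_quadric_def)
  obtain N where "(1/2) ^ N < e / (6 * M)"
    using real_arch_pow_inv[of "e / (6 * M)" "1/2"] M0 assms(2) by auto
  then have N: "3 * M / 2 ^ N < e / 2" using M0 by (simp add: power_divide field_simps)
  define R' where "R' = R + 1"
  \<comment> \<open>Then two sums of \<open>N\<close> products of size at most \<open>R' ^ N * \<epsilon>\<close> have size at most \<open>e / 2\<close> together.\<close>
  define \<epsilon> where "\<epsilon> = e / (4 * (of_nat N + 1) * R' ^ N)"
  have R': "R' \<ge> 1" "R \<le> R'" using assms(1) by (auto simp: R'_def)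
  have eps: "\<epsilon> > 0" using assms(2) R' by (simp add: \<epsilon>_def)
  have "\<forall>n. \<exists>x. \<forall>z. norm z \<le> R \<longrightarrow> norm (plus_coeff n z - (\<Sum>k<fst x. snd x k * z ^ k)) < \<epsilon>"
  proof
    fix n
    obtain a K where "\<And>z. norm z \<le> R \<Longrightarrow> norm (plus_coeff n z - (\<Sum>k<K. a k * z ^ k)) < \<epsilon>"
      by (rule entire_polynomial_approximation[OF plus_coeff_entire[of n] assms(1) eps]) blast
    then show "\<exists>x. \<forall>z. norm z \<le> R \<longrightarrow> norm (plus_coeff n z - (\<Sum>k<fst x. snd x k * z ^ k)) < \<epsilon>"
      by (intro exI[of _ "(K, a)"]) simp
  qed
  from choice[OF this] obtain P where P: "\<And>n z. norm z \<le> R \<Longrightarrow>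
      norm (plus_coeff n z - (\<Sum>k<fst (P n). snd (P n) k * z ^ k)) < \<epsilon>"
    by blast
  have "\<forall>n. \<exists>x. \<forall>z. norm z \<le> R \<longrightarrow> norm (swap.plus_coeff (Suc n) z - (\<Sum>k<fst x. snd x k * z ^ k)) < \<epsilon>"
  proof
    fix n
    obtain a K where "\<And>z. norm z \<le> R \<Longrightarrow> norm (swap.plus_coeff (Suc n) z - (\<Sum>k<K. a k * z ^ k)) < \<epsilon>"
      by (rule entire_polynomial_approximation[OF swap.plus_coeff_entire[of "Suc n"] assms(1) eps]) blast
    then show "\<exists>x. \<forall>z. norm z \<le> R \<longrightarrow> norm (swap.plus_coeff (Suc n) z - (\<Sum>k<fst x. snd x k * z ^ k)) < \<epsilon>"
      by (intro exI[of _ "(K, a)"]) simp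
  qed
  from choice[OF this] obtain S where S: "\<And>n z. norm z \<le> R \<Longrightarrow>
      norm (swap.plus_coeff (Suc n) z - (\<Sum>k<fst (S n). snd (S n) k * z ^ k)) < \<epsilon>"
    by blast
  show ?thesis
  proof (rule that)
    fix a b c :: complex
    assume abc: "c^2 = 1 + a * b" and R: "norm a < R" "norm b < R" "norm c < R"
    let ?p = "\<lambda>n. \<Sum>k<fst (P n). snd (P n) k * c ^ k" and ?q = "\<lambda>n. \<Sum>k<fst (S n). snd (S n) k * c ^ k"
    have small: "norm (\<Sum>n<N. x n * y n) \<le> e / 4"
      if "\<And>n. n < N \<Longrightarrow> norm (x n) \<le> R' ^ N" "\<And>n. norm (y n) < \<epsilon>" for x y :: "nat \<Rightarrow> complex"
    proof -
      have "norm (\<Sum>n<N. x n * y n) \<le> (\<Sum>n<N. R' ^ N * \<epsilon>)"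
      proof (rule sum_norm_le)
        fix n assume "n \<in> {..<N}"
        then show "norm (x n * y n) \<le> R' ^ N * \<epsilon>"
          unfolding norm_mult using R' by (intro mult_mono that(1) less_imp_le[OF that(2)]) auto
      qed
      also have "\<dots> = of_nat N * (R' ^ N * \<epsilon>)" by simp
      also have "R' ^ N * \<epsilon> = e / (4 * (of_nat N + 1))" using R' by (simp add: \<epsilon>_def)
      also have "of_nat N * (e / (4 * (of_nat N + 1))) \<le> e / 4"
        using assms(2) by (simp add: divide_simps)
      finally show ?thesis .
    qed
    have pow: "norm (z ^ n) \<le> R' ^ N" if "norm z < R" "n \<le> N" for n and z :: complex
    proof -
      have "norm z ^ n \<le> R' ^ n" using that R' by (intro power_mono) auto
      also have "\<dots> \<le> R' ^ N" using that R' by (intro power_increasing) auto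
      finally show ?thesis by (simp add: norm_power)
    qed
    have "norm (\<Sum>n<N. a ^ n * (plus_coeff n c - ?p n)) \<le> e / 4"
      by (rule small) (use pow[OF R(1)] P R(3) in auto)
    moreover have "norm (\<Sum>n<N. b ^ Suc n * (swap.plus_coeff (Suc n) c - ?q n)) \<le> e / 4"
      by (rule small) (use pow[OF R(2)] S R(3) in \<open>simp_all del: power_Suc\<close>)
    moreover have "norm (g a b c - partial_expansion N a b c) \<le> 3 * M / 2 ^ N"
      by (rule partial_expansion_error[OF abc R M])
    moreover have "g a b c - ((\<Sum>n<N. a ^ n * ?p n) + (\<Sum>n<N. b ^ Suc n * ?q n)) =
        (g a b c - partial_expansion N a b c) + ((\<Sum>n<N. a ^ n * (plus_coeff n c - ?p n)) +
         (\<Sum>n<N. b ^ Suc n * (swap.plus_coeff (Suc n) c - ?q n)))"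
      by (simp add: partial_expansion_def right_diff_distrib sum_subtractf)
    moreover have "norm w < e" if "norm x \<le> e / 4" "norm y \<le> e / 4" "norm z \<le> 3 * M / 2 ^ N"
      "w = z + (x + y)" for w x y z :: complex
    proof -
      have "norm w \<le> norm z + (norm x + norm y)"
        unfolding that(4) by (intro order_trans[OF norm_triangle_ineq] add_left_mono norm_triangle_ineq)
      also have "\<dots> < e" using that(1-3) N assms(2) by linarith
      finally show ?thesis .
    qed
    ultimately show "norm (g a b c - ((\<Sum>n<N. a ^ n * ?p n) + (\<Sum>n<N. b ^ Suc n * ?q n))) < e"
      by blast
  qed
qed

end

context null_coordinates
begin

definition point :: "complex \<Rightarrow> complex \<Rightarrow> complex \<Rightarrow> complex^3" where
  "point a b c = a *s m1 + b *s m2 + c *s m3"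

lemma coordinates_point:
  "scalar_product \<alpha> (point a b c) = a" "scalar_product \<beta> (point a b c) = b"
  "scalar_product \<gamma> (point a b c) = c"
  by (simp_all add: point_def scalar_product_add_right scalar_product_scale_right dual)

lemma point_coordinates: "point (scalar_product \<alpha> v) (scalar_product \<beta> v) (scalar_product \<gamma> v) = v"
  unfolding point_def by (rule expansion[symmetric])

lemma point_in_quadric: "point a b c \<in> quadric Q \<longleftrightarrow> c^2 = 1 + a * b"
  by (auto simp: quadric_def value_eq coordinates_point algebra_simps)

lemma hol_on_quadric_continuous:
  assumes "hol_on f (quadric Q)"
  shows "continuous_on (quadric Q) f"
  unfolding continuous_on_eq_continuous_within
proof
  fix p assume p: "p \<in> quadric Q"
  then obtain W F where W: "p \<in> W" "ambient_holomorphic_on F W" "\<And>v. v \<in> W \<inter> quadric Q \<Longrightarrow> F v = f v"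
    using assms unfolding hol_on_def by metis
  then have "isCont F p" "open W"
    by (auto simp: ambient_holomorphic_on_iff intro: complex_differentiable_isCont)
  then have "continuous (at p within quadric Q) F" by (simp add: continuous_at_imp_continuous_at_within)
  moreover obtain r where "r > 0" "ball p r \<subseteq> W" using \<open>open W\<close> W(1) by (rule openE)
  moreover have "F x = f x" if "x \<in> quadric Q" "dist x p < r" for x
    using that \<open>ball p r \<subseteq> W\<close> by (intro W(3)) (auto simp: dist_commute)
  ultimately show "continuous (at p within quadric Q) f"
    using p by (intro continuous_transform_within[of p "quadric Q" F r f])
qed

lemma null_quadric_holomorphic_point:
  assumes f: "hol_on f (quadric Q)"
  shows "null_quadric_holomorphic (\<lambda>a b c. f (point a b c))"
proof
  have "continuous_on null_quadric (\<lambda>p. f (point (fst p) (fst (snd p)) (snd (snd p))))"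
    by (rule continuous_on_compose2[OF hol_on_quadric_continuous[OF f]])
       (auto simp: null_quadric_def point_in_quadric, auto simp: point_def intro!: continuous_intros)
  then show "continuous_on null_quadric (\<lambda>(a, b, c). f (point a b c))"
    by (simp add: case_prod_unfold)
  fix \<Omega> :: "complex set" and \<phi> \<psi> \<kappa> :: "complex \<Rightarrow> complex"
  assume \<Omega>: "open \<Omega>" and hol: "\<phi> holomorphic_on \<Omega>" "\<psi> holomorphic_on \<Omega>" "\<kappa> holomorphic_on \<Omega>"
    and eq: "\<And>z. z \<in> \<Omega> \<Longrightarrow> (\<kappa> z)^2 = 1 + \<phi> z * \<psi> z"
  let ?\<Gamma> = "\<lambda>z. point (\<phi> z) (\<psi> z) (\<kappa> z)"
  have in_quadric: "?\<Gamma> z \<in> quadric Q" if "z \<in> \<Omega>" for z using eq[OF that] by (simp add: point_in_quadric)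
  show "(\<lambda>z. f (?\<Gamma> z)) holomorphic_on \<Omega>"
    unfolding holomorphic_on_open[OF \<Omega>]
  proof
    fix z assume z: "z \<in> \<Omega>"
    obtain W F where W: "?\<Gamma> z \<in> W" "ambient_holomorphic_on F W" "\<And>v. v \<in> W \<inter> quadric Q \<Longrightarrow> F v = f v"
      using f in_quadric[OF z] unfolding hol_on_def by metis
    then have "open W" "complex_differentiable F (?\<Gamma> z)" by (auto simp: ambient_holomorphic_on_iff)
    then obtain D where D: "(F has_derivative D) (at (?\<Gamma> z))" "\<And>c u. D (c *s u) = c * D u"
      unfolding complex_differentiable_def by blast
    have deriv: "(h has_field_derivative deriv h z) (at z)" if "h holomorphic_on \<Omega>" for h
      using holomorphic_derivI[OF that \<Omega> z] .
    have cont: "continuous_on \<Omega> ?\<Gamma>"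
      unfolding point_def by (intro continuous_intros holomorphic_on_imp_continuous_on hol)
    have lin: "((\<lambda>z. h z *s m) has_derivative (\<lambda>u. (deriv h z * u) *s m)) (at z)"
      if "h holomorphic_on \<Omega>" for h and m :: "complex^3"
      using bounded_linear.has_derivative[OF bounded_bilinear.bounded_linear_left[OF bounded_bilinear_vector_scalar_mult]]
        deriv[OF that] unfolding has_field_derivative_def by blast
    have "(?\<Gamma> has_derivative (\<lambda>u. (deriv \<phi> z * u) *s m1 + (deriv \<psi> z * u) *s m2 + (deriv \<kappa> z * u) *s m3)) (at z)"
      unfolding point_def by (intro has_derivative_add lin hol)
    moreover have "(deriv \<phi> z * u) *s m1 + (deriv \<psi> z * u) *s m2 + (deriv \<kappa> z * u) *s m3 =
        u *s point (deriv \<phi> z) (deriv \<psi> z) (deriv \<kappa> z)" for u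
      by (simp add: point_def vec_eq_iff algebra_simps)
    ultimately have "(?\<Gamma> has_derivative (\<lambda>u. u *s point (deriv \<phi> z) (deriv \<psi> z) (deriv \<kappa> z))) (at z)"
      by simp
    from has_derivative_compose[OF this D(1)]
    have F: "((\<lambda>z. F (?\<Gamma> z)) has_field_derivative D (point (deriv \<phi> z) (deriv \<psi> z) (deriv \<kappa> z))) (at z)"
      unfolding has_field_derivative_def
      by (simp add: D(2) mult.commute[of _ "D (point (deriv \<phi> z) (deriv \<psi> z) (deriv \<kappa> z))"])
    have "open (\<Omega> \<inter> ?\<Gamma> -` W)" by (rule continuous_open_preimage[OF cont \<Omega> \<open>open W\<close>])
    then have "((\<lambda>z. f (?\<Gamma> z)) has_field_derivative D (point (deriv \<phi> z) (deriv \<psi> z) (deriv \<kappa> z))) (at z)"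
      by (rule has_field_derivative_transform_within_open[OF F])
         (use z W in_quadric in auto)
    then show "\<exists>d. ((\<lambda>z. f (?\<Gamma> z)) has_field_derivative d) (at z)" ..
  qed
qed

lemma hol_on_quadric_polynomial_approximation:
  assumes "hol_on f (quadric Q)" "compact K" "K \<subseteq> quadric Q" "e > 0"
  obtains p where "p \<in> polynomial_functions" "\<And>v. v \<in> K \<Longrightarrow> dist (p v) (f v) < e"
proof -
  interpret null_quadric_holomorphic "\<lambda>a b c. f (point a b c)"
    by (rule null_quadric_holomorphic_point[OF assms(1)])
  have "\<exists>B>0. \<forall>v\<in>K. norm (scalar_product a v) \<le> B" for a
  proof -
    have "compact (scalar_product a ` K)"
      by (intro compact_continuous_image assms(2) continuous_on_scalar_product continuous_on_id)
    from compact_imp_bounded[OF this] show ?thesis unfolding bounded_pos by blast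
  qed
  from this[of \<alpha>] this[of \<beta>] this[of \<gamma>] obtain B1 B2 B3 where B: "B1 > 0" "B2 > 0" "B3 > 0"
    "\<forall>v\<in>K. norm (scalar_product \<alpha> v) \<le> B1" "\<forall>v\<in>K. norm (scalar_product \<beta> v) \<le> B2"
    "\<forall>v\<in>K. norm (scalar_product \<gamma> v) \<le> B3" by blast
  define R where "R = B1 + B2 + B3"
  have R: "norm (scalar_product \<alpha> v) < R" "norm (scalar_product \<beta> v) < R" "norm (scalar_product \<gamma> v) < R"
    if "v \<in> K" for v
    using B(1-3) bspec[OF B(4) that] bspec[OF B(5) that] bspec[OF B(6) that] unfolding R_def by linarith+
  have "R > 0" using B(1-3) by (simp add: R_def)
  obtain N K1 K2 p q where pq:
    "\<And>a b c. \<lbrakk>c^2 = 1 + a * b; norm a < R; norm b < R; norm c < R\<rbrakk> \<Longrightarrow>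
      norm (f (point a b c) - ((\<Sum>n<N. a ^ n * (\<Sum>k<K1 n. p n k * c ^ k)) +
                       (\<Sum>n<N. b ^ Suc n * (\<Sum>k<K2 n. q n k * c ^ k)))) < e"
    by (rule polynomial_approximation[OF \<open>R > 0\<close> assms(4)]) blast
  let ?p = "\<lambda>v. (\<Sum>n<N. scalar_product \<alpha> v ^ n * (\<Sum>k<K1 n. p n k * scalar_product \<gamma> v ^ k)) +
      (\<Sum>n<N. scalar_product \<beta> v ^ Suc n * (\<Sum>k<K2 n. q n k * scalar_product \<gamma> v ^ k))"
  show ?thesis
  proof (rule that)
    show "?p \<in> polynomial_functions" by (intro polynomial_functions_intros)
    fix v assume v: "v \<in> K"
    then have "scalar_product \<gamma> v ^ 2 = 1 + scalar_product \<alpha> v * scalar_product \<beta> v"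
      using assms(3) point_in_quadric point_coordinates by (metis subsetD)
    from pq[OF this R[OF v]] show "dist (?p v) (f v) < e"
      unfolding point_coordinates by (simp only: dist_norm norm_minus_commute)
  qed
qed

end

section \<open>Totally real parts of the quadric\<close>

definition real_vector :: "real^3 \<Rightarrow> complex^3" where
  "real_vector x = (\<chi> i. complex_of_real (x $ i))"

text \<open>
  The matrix \<open>B\<close> maps \<open>\<real>\<^sup>3\<close> onto a real form of \<open>\<complex>\<^sup>3\<close> on which \<open>Q\<close> takes real values, and \<open>C\<close> is its
  inverse.
\<close>

locale real_form =
  fixes Q :: polynomial3 and B C :: "complex^3^3"
  assumes form: "quadratic_form Q"
    and inverse: "B ** C = mat 1" "C ** B = mat 1"
    and real_value: "poly_fun Q (B *v real_vector x) \<in> \<real>"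
begin

definition emb :: "real^3 \<Rightarrow> complex^3" where
  "emb x = B *v real_vector x"

definition re_part :: "complex^3 \<Rightarrow> real^3" where
  "re_part w = (\<chi> i. Re ((C *v w) $ i))"

definition im_part :: "complex^3 \<Rightarrow> real^3" where
  "im_part w = (\<chi> i. Im ((C *v w) $ i))"

definition real_locus :: "(complex^3) set" where
  "real_locus = quadric Q \<inter> range emb"

lemma linear_emb: "linear emb"
  by (rule linearI)
     (simp_all add: emb_def real_vector_def vec_eq_iff matrix_vector_mult_def distrib_left sum.distrib
        scaleR_sum_right, simp add: scaleR_conv_of_real mult_ac)

lemma linear_re_part: "linear re_part"
  by (rule linearI)
     (simp_all add: re_part_def vec_eq_iff matrix_vector_mult_def distrib_left sum.distrib
        scaleR_sum_right[symmetric])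

lemma linear_im_part: "linear im_part"
  by (rule linearI)
     (simp_all add: im_part_def vec_eq_iff matrix_vector_mult_def distrib_left sum.distrib
        scaleR_sum_right[symmetric])

lemma emb_scale: "emb (r *\<^sub>R x) = complex_of_real r *s emb x"
  by (simp add: emb_def real_vector_def vec_eq_iff matrix_vector_mult_def sum_distrib_left mult_ac)

lemma continuous_on_emb: "continuous_on X emb"
  and continuous_on_re_part: "continuous_on W re_part"
  and continuous_on_im_part: "continuous_on W im_part"
  using linear_continuous_on linear_conv_bounded_linear linear_emb linear_re_part linear_im_part by blast+

lemma inverse_emb: "C *v emb x = real_vector x"
  by (simp add: emb_def matrix_vector_mul_assoc inverse)

lemma re_part_emb [simp]: "re_part (emb x) = x" and im_part_emb [simp]: "im_part (emb x) = 0"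
  by (simp_all add: re_part_def im_part_def inverse_emb vec_eq_iff) (simp_all add: real_vector_def)

lemma decomposition: "emb (re_part w) + \<i> *s emb (im_part w) = w"
proof -
  have "real_vector (re_part w) + \<i> *s real_vector (im_part w) = C *v w"
    by (simp add: vec_eq_iff real_vector_def re_part_def im_part_def flip: complex_eq)
  then have "B *v (real_vector (re_part w) + \<i> *s real_vector (im_part w)) = w"
    by (simp add: matrix_vector_mul_assoc inverse)
  then show ?thesis by (simp add: emb_def matrix_vector_right_distrib vector_scalar_commute)
qed

lemma range_emb_iff: "w \<in> range emb \<longleftrightarrow> im_part w = 0"
proof
  assume "im_part w = 0"
  then have "emb (re_part w) = w"
    using decomposition[of w] linear_0[OF linear_emb] by simp
  then show "w \<in> range emb" by (metis rangeI)
qed auto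

lemma closed_real_locus: "closed real_locus"
proof -
  have "closed {w. im_part w = 0}"
    by (intro closed_Collect_eq continuous_on_im_part continuous_intros)
  moreover have "real_locus = quadric Q \<inter> {w. im_part w = 0}"
    using range_emb_iff by (auto simp: real_locus_def)
  ultimately show ?thesis using closed_quadric by auto
qed

definition q :: "real^3 \<Rightarrow> real" where
  "q x = Re (poly_fun Q (emb x))"

lemma value_emb: "poly_fun Q (emb x) = complex_of_real (q x)"
  using real_value[of x] by (simp add: q_def emb_def)

lemma continuous_on_q: "continuous_on X q"
  unfolding q_def
  by (intro continuous_intros continuous_on_compose2[OF continuous_on_poly_fun continuous_on_emb]) auto

lemma emb_in_real_locus: "emb x \<in> real_locus \<longleftrightarrow> q x = 1"
  by (simp add: real_locus_def quadric_def value_emb)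

lemma normalize_in_real_locus:
  assumes "q x > 0"
  shows "complex_of_real (1 / sqrt (q x)) *s emb x \<in> real_locus"
proof -
  have "poly_fun Q (complex_of_real (1 / sqrt (q x)) *s emb x) = complex_of_real ((1 / sqrt (q x))^2 * q x)"
    by (simp add: quadratic_form_scale[OF form] value_emb)
  also have "(1 / sqrt (q x))^2 * q x = 1" using assms by (simp add: power_divide)
  finally show ?thesis
    unfolding real_locus_def quadric_def emb_scale[symmetric] by simp
qed

text \<open>
  A point \<open>w = x + \<i> y\<close> near \<open>emb x0\<close>, with \<open>x\<close> and \<open>y\<close> in the real form, lies on the complex line
  \<open>z \<mapsto> x + z y\<close>.  Its points with real parameter \<open>z\<close> are real, and \<open>G\<close> vanishes there.
\<close>

lemma totally_real_identity:
  assumes "open T" "emb x0 \<in> T" and G: "\<And>w. w \<in> T \<Longrightarrow> complex_differentiable G w"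
    and zero: "\<And>x. emb x \<in> T \<Longrightarrow> G (emb x) = 0"
  shows "\<exists>r>0. \<forall>w\<in>ball (emb x0) r. w \<in> T \<and> G w = 0"
proof -
  obtain R where R: "R > 0" "ball (emb x0) R \<subseteq> T" using assms(1,2) by (rule openE)
  let ?V = "(\<lambda>w. emb (re_part w)) -` ball (emb x0) R"
  have "open ?V"
    by (intro open_vimage open_ball continuous_on_compose2[OF continuous_on_emb[of UNIV] continuous_on_re_part]) auto
  then have "open (ball (emb x0) R \<inter> ?V)" by (intro open_Int open_ball)
  moreover have "emb x0 \<in> ball (emb x0) R \<inter> ?V" using R(1) by simp
  ultimately obtain r where r: "r > 0" "ball (emb x0) r \<subseteq> ball (emb x0) R \<inter> ?V" by (rule openE)
  have "w \<in> T \<and> G w = 0" if "w \<in> ball (emb x0) r" for w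
  proof -
    define x y where "x = re_part w" and "y = im_part w"
    have w: "emb x + \<i> *s emb y = w" by (simp add: x_def y_def decomposition)
    define Z where "Z = (\<lambda>z. emb x + z *s emb y) -` ball (emb x0) R"
    have i: "\<i> \<in> Z" and z0: "0 \<in> Z" using that r(2) w by (auto simp: Z_def x_def)
    have "open Z"
      unfolding Z_def by (intro open_vimage open_ball continuous_intros)
    have "convex Z"
    proof -
      have "linear (\<lambda>z. z *s emb y)"
        by (rule linearI) (simp_all add: vec_eq_iff algebra_simps)
      then have "convex ((\<lambda>z. z *s emb y) -` ((+) (- emb x) ` ball (emb x0) R))"
        by (intro convex_linear_vimage convex_translation convex_ball)
      moreover have "Z = (\<lambda>z. z *s emb y) -` ((+) (- emb x) ` ball (emb x0) R)"
        unfolding Z_def by (force simp: image_iff)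
      ultimately show ?thesis by simp
    qed
    define g where "g z = G (emb x + z *s emb y)" for z
    have "g \<i> = 0"
    proof (rule analytic_continuation[where f = g and S = Z and \<xi> = 0
          and U = "complex_of_real ` {t. complex_of_real t \<in> Z}"])
      show "g holomorphic_on Z"
        unfolding holomorphic_on_def g_def
        using R(2) by (auto simp: Z_def intro!: field_differentiable_at_within complex_differentiable_line G)
      show "connected Z" using \<open>convex Z\<close> by (rule convex_connected)
      show "0 islimpt complex_of_real ` {t. complex_of_real t \<in> Z}"
        unfolding islimpt_approachable
      proof (intro allI impI)
        fix e :: real assume "e > 0"
        obtain d where d: "d > 0" "ball 0 d \<subseteq> Z" using \<open>open Z\<close> z0 by (rule openE)
        define t where "t = min d e / 2"
        have t: "t > 0" "t < d" "t < e" using d(1) \<open>e > 0\<close> by (auto simp: t_def)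
        then have "complex_of_real t \<in> Z" using d(2) by auto
        then show "\<exists>x'\<in>complex_of_real ` {t. complex_of_real t \<in> Z}. x' \<noteq> 0 \<and> dist x' 0 < e"
          using t by (intro bexI[of _ "complex_of_real t"]) auto
      qed
      fix z assume "z \<in> complex_of_real ` {t. complex_of_real t \<in> Z}"
      then obtain t where t: "z = complex_of_real t" "z \<in> Z" by auto
      then have "emb x + z *s emb y = emb (x + t *\<^sub>R y)"
        by (simp add: emb_scale linear_add[OF linear_emb])
      moreover from t(2) have "emb x + z *s emb y \<in> T" using R(2) by (auto simp: Z_def)
      ultimately show "g z = 0" using zero by (simp add: g_def)
    qed (use \<open>open Z\<close> i z0 in auto)
    then have "G w = 0" using w by (simp add: g_def)
    moreover have "w \<in> T" using that r(2) R(2) by blast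
    ultimately show ?thesis by blast
  qed
  then show ?thesis using r(1) by blast
qed

text \<open>
  The radial projection maps real points near the real locus into the real locus, as \<open>Q\<close> is real and
  positive there.  Composed with it, \<open>F1 - F2\<close> therefore vanishes at all real points near the locus.
\<close>

lemma hol_germ_unique:
  assumes U1: "openin (top_of_set (quadric Q)) U1" "real_locus \<subseteq> U1" "hol_on F1 U1"
    and U2: "openin (top_of_set (quadric Q)) U2" "real_locus \<subseteq> U2" "hol_on F2 U2"
    and eq: "\<And>v. v \<in> real_locus \<Longrightarrow> F1 v = F2 v"
  shows "\<exists>U. openin (top_of_set (quadric Q)) U \<and> real_locus \<subseteq> U \<and> U \<subseteq> U1 \<inter> U2 \<and> (\<forall>v\<in>U. F1 v = F2 v)"
proof -
  obtain T1 T2 where T: "open T1" "U1 = quadric Q \<inter> T1" "open T2" "U2 = quadric Q \<inter> T2"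
    using U1(1) U2(1) unfolding openin_open by blast
  let ?N = "\<lambda>T. {w \<in> radial_domain Q. radial_projection Q w \<in> T}"
  have hol: "ambient_holomorphic_on (\<lambda>w. F1 (radial_projection Q w)) (?N T1)"
    "ambient_holomorphic_on (\<lambda>w. F2 (radial_projection Q w)) (?N T2)"
    using U1(3) U2(3) hol_on_quadric_iff[OF form T(1), of F1] hol_on_quadric_iff[OF form T(3), of F2]
    by (simp_all add: T(2,4))
  define G where "G w = F1 (radial_projection Q w) - F2 (radial_projection Q w)" for w
  let ?T = "?N T1 \<inter> ?N T2"
  have "\<exists>r>0. \<forall>w\<in>ball p r. w \<in> ?T \<and> G w = 0" if p: "p \<in> real_locus" for p
  proof -
    obtain x0 where x0: "p = emb x0" using p by (auto simp: real_locus_def)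
    have pq: "p \<in> quadric Q" using p by (simp add: real_locus_def)
    show ?thesis
      unfolding x0
    proof (rule totally_real_identity)
      show "open ?T" using hol by (simp add: ambient_holomorphic_on_iff open_Int)
      show "emb x0 \<in> ?T"
        using p pq U1(2) U2(2) T quadric_subset_radial_domain[of Q] radial_projection_eq_self[OF pq] x0 by auto
      show "complex_differentiable G w" if "w \<in> ?T" for w
        unfolding G_def using hol that by (intro complex_differentiable_diff) (auto simp: ambient_holomorphic_on_iff)
      fix x assume x: "emb x \<in> ?T"
      then have "q x > 0" by (simp add: radial_domain_def value_emb)
      moreover from this have "radial_projection Q (emb x) = complex_of_real (1 / sqrt (q x)) *s emb x"
        by (simp add: radial_projection_def value_emb divide_inverse)
      ultimately have "radial_projection Q (emb x) \<in> real_locus"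
        using normalize_in_real_locus by simp
      then show "G (emb x) = 0" by (simp add: G_def eq)
    qed
  qed
  then have "\<forall>p\<in>real_locus. \<exists>r. r > 0 \<and> (\<forall>w\<in>ball p r. w \<in> ?T \<and> G w = 0)" by blast
  from bchoice[OF this] obtain r
    where r: "\<forall>p\<in>real_locus. r p > 0 \<and> (\<forall>w\<in>ball p (r p). w \<in> ?T \<and> G w = 0)" ..
  define U where "U = quadric Q \<inter> (\<Union>p\<in>real_locus. ball p (r p))"
  show ?thesis
  proof (rule exI[of _ U], intro conjI ballI)
    show "openin (top_of_set (quadric Q)) U" unfolding U_def
      by (intro openin_open_Int open_UN ballI open_ball)
    show "real_locus \<subseteq> U"
    proof
      fix p assume p: "p \<in> real_locus"
      then have "p \<in> ball p (r p)" using r by simp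
      then show "p \<in> U" using p unfolding U_def real_locus_def by blast
    qed
    have *: "v \<in> ?T \<and> G v = 0 \<and> v \<in> quadric Q" if "v \<in> U" for v
    proof -
      obtain p where p: "p \<in> real_locus" "v \<in> ball p (r p)" "v \<in> quadric Q"
        using \<open>v \<in> U\<close> unfolding U_def by blast
      from bspec[OF r p(1)] have "\<forall>w\<in>ball p (r p). w \<in> ?T \<and> G w = 0" by (rule conjunct2)
      from bspec[OF this p(2)] p(3) show ?thesis by (intro conjI) auto
    qed
    show "U \<subseteq> U1 \<inter> U2"
    proof
      fix v assume "v \<in> U"
      from *[OF this] show "v \<in> U1 \<inter> U2" using radial_projection_eq_self[of v Q] T by simp
    qed
    show "F1 v = F2 v" if "v \<in> U" for v
      using *[OF that] radial_projection_eq_self[of v Q] by (simp add: G_def)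
  qed
qed

text \<open>
  At real points the term of degree \<open>k\<close> is \<open>O(t'\<^sup>k)\<close> for some \<open>t' < t\<close>, by rescaling to the real locus.
  A point \<open>x + \<i> y\<close> lies on the complexified line through \<open>x\<close> with direction \<open>y\<close>, and Bernstein's
  inequality on a segment of it loses a factor \<open>s\<^sup>k\<close> with \<open>s\<close> close to \<open>1\<close> if \<open>y\<close> is short.
\<close>

lemma growth_near_real:
  assumes ser: "multipole_series real_locus c L f"
    and x0: "q x0 > 0" "q x0 < t^2" and t: "t > 0"
  shows "growth_near c L (emb x0) t"
proof -
  let ?T = "multipole_term c L"
  have "sqrt (q x0) < t" using x0 t by (intro real_less_lsqrt) auto
  then obtain t' where t': "sqrt (q x0) < t'" "t' < t" using dense by blast
  have "sqrt (q x0) > 0" using x0(1) by simp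
  then have "t' > 0" using t'(1) by linarith
  have "sqrt (q x0) ^ 2 < t' ^ 2" using t'(1) \<open>sqrt (q x0) > 0\<close> by (intro power_strict_mono) auto
  then have "q x0 < t'^2" using x0(1) by simp
  define m where "m = q x0 / 2"
  have m: "m > 0" "m < q x0" using x0(1) by (auto simp: m_def)
  have "open ({x. m < q x} \<inter> {x. q x < t'^2})"
    by (intro open_Int open_Collect_less continuous_intros continuous_on_q)
  moreover have "x0 \<in> {x. m < q x} \<inter> {x. q x < t'^2}" using m \<open>q x0 < t'^2\<close> by simp
  ultimately obtain r where r: "r > 0" "ball x0 r \<subseteq> {x. m < q x} \<inter> {x. q x < t'^2}" by (rule openE)
  have "compact (emb ` cball x0 r)" by (intro compact_continuous_image continuous_on_emb compact_cball)
  from compact_imp_bounded[OF this] obtain N where N: "N > 0" "\<And>x. x \<in> cball x0 r \<Longrightarrow> norm (emb x) \<le> N"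
    unfolding bounded_pos by blast
  define R where "R = N / sqrt m"
  have "compact (real_locus \<inter> cball 0 R)" by (simp add: closed_real_locus closed_Int_compact)
  then obtain M where M: "M > 0" "\<And>k v. v \<in> real_locus \<inter> cball 0 R \<Longrightarrow> norm (?T k v) \<le> M"
    using multipole_terms_bounded[OF ser, of "real_locus \<inter> cball 0 R"] by blast
  have real_bound: "norm (?T k (emb x)) \<le> M * t' ^ k" if x: "x \<in> ball x0 r" for x k
  proof -
    have qx: "m < q x" "q x < t'^2" using r(2) x by auto
    then have q0: "q x > 0" using m by linarith
    define s where "s = sqrt (q x)"
    have s: "s > 0" "s \<le> t'" "sqrt m \<le> s"
      using q0 qx \<open>t' > 0\<close> by (auto simp: s_def intro: real_le_lsqrt less_imp_le)
    have "norm (emb x) / s \<le> N / sqrt m"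
      using N x s m by (intro frac_le) auto
    then have "complex_of_real (1 / s) *s emb x \<in> real_locus \<inter> cball 0 R"
      using normalize_in_real_locus[OF q0] s(1)
      by (simp add: s_def[symmetric] R_def norm_vector_scalar_mult norm_divide)
    then have 1: "norm (?T k (complex_of_real (1 / s) *s emb x)) \<le> M" by (rule M(2))
    have "emb x = complex_of_real s *s (complex_of_real (1 / s) *s emb x)"
      using s(1) by (simp add: vec_eq_iff)
    then have "norm (?T k (emb x)) = s ^ k * norm (?T k (complex_of_real (1 / s) *s emb x))"
      using multipole_term_scale[of c L k "complex_of_real s" "complex_of_real (1 / s) *s emb x"] s(1)
      by (simp add: norm_mult norm_power)
    also have "\<dots> \<le> t' ^ k * M" using 1 s \<open>t' > 0\<close> by (intro mult_mono power_mono) auto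
    finally show ?thesis by (simp add: mult.commute)
  qed
  \<comment> \<open>Bernstein's inequality at the height where it costs the factor \<open>(t / t')\<^sup>k\<close>\<close>
  define s where "s = t' / t"
  have s: "0 < s" "s < 1" using \<open>t' > 0\<close> t'(2) t by (auto simp: s_def)
  define \<kappa> where "\<kappa> = (1 / s - s) / 2"
  have "1 / s > 1" using s by simp
  then have "s < 1 / s" using s by linarith
  then have \<kappa>: "\<kappa> > 0" by (simp add: \<kappa>_def)
  have "open {w. dist (re_part w) x0 < r / 2}" "open {w. norm (im_part w) < \<kappa> * (r / 2)}"
    by (intro open_Collect_less continuous_intros continuous_on_re_part continuous_on_im_part)+
  then have "open ({w. dist (re_part w) x0 < r / 2} \<inter> {w. norm (im_part w) < \<kappa> * (r / 2)})" by (rule open_Int)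
  moreover have "emb x0 \<in> {w. dist (re_part w) x0 < r / 2} \<inter> {w. norm (im_part w) < \<kappa> * (r / 2)}"
    using r(1) \<kappa> by simp
  ultimately obtain d where d: "d > 0"
    "ball (emb x0) d \<subseteq> {w. dist (re_part w) x0 < r / 2} \<inter> {w. norm (im_part w) < \<kappa> * (r / 2)}" by (rule openE)
  have "norm (?T k w) \<le> M * t ^ k" if w: "w \<in> ball (emb x0) d" for w k
  proof -
    define x y where "x = re_part w" and "y = (1 / \<kappa>) *\<^sub>R im_part w"
    have xy: "dist x x0 < r / 2" "norm y < r / 2"
      using d(2) w \<kappa> by (auto simp: x_def y_def divide_simps mult.commute)
    have "s ^ k * norm (?T k (emb x + (\<i> * of_real \<kappa>) *s emb y)) \<le> M * t' ^ k"
      unfolding \<kappa>_def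
    proof (rule bernstein_inequality)
      fix \<xi> :: real assume \<xi>: "-1 \<le> \<xi>" "\<xi> \<le> 1"
      have "norm (\<xi> *\<^sub>R y) \<le> 1 * norm y"
        unfolding norm_scaleR using \<xi> by (intro mult_right_mono) auto
      then have "dist x0 (x + \<xi> *\<^sub>R y) < r"
        using xy dist_triangle[of x0 "x + \<xi> *\<^sub>R y" x] by (simp add: dist_norm norm_minus_commute)
      then have "norm (?T k (emb (x + \<xi> *\<^sub>R y))) \<le> M * t' ^ k" by (intro real_bound) simp
      then show "norm (?T k (emb x + complex_of_real \<xi> *s emb y)) \<le> M * t' ^ k"
        by (simp add: linear_add[OF linear_emb] emb_scale)
    qed (use s in auto)
    moreover have "emb x + (\<i> * of_real \<kappa>) *s emb y = w"
    proof -
      have "(\<i> * of_real \<kappa>) *s emb y = \<i> *s emb (im_part w)"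
        using \<kappa> by (simp add: y_def emb_scale vec_eq_iff)
      then show ?thesis using decomposition[of w] by (simp add: x_def)
    qed
    ultimately have "s ^ k * norm (?T k w) \<le> M * t' ^ k" by simp
    also have "t' = s * t" using t by (simp add: s_def)
    finally have "s ^ k * norm (?T k w) \<le> s ^ k * (M * t ^ k)"
      by (simp add: power_mult_distrib mult_ac)
    then show ?thesis using s(1) by simp
  qed
  then show ?thesis unfolding growth_near_def using d(1) by blast
qed

text \<open>
  Real polynomial functions, as the Stone--Weierstrass theorem provides them, extend from the real form
  to complex polynomials on \<open>\<complex>\<^sup>3\<close>.
\<close>

lemma real_polynomial_function_emb:
  assumes "real_polynomial_function h"
  shows "\<exists>p\<in>polynomial_functions. \<forall>x. p (emb x) = complex_of_real (h x)"
  using assms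
proof induction
  case (linear h)
  have coord: "scalar_product (row i C) (emb x) = complex_of_real (x $ i)" for i x
  proof -
    have "scalar_product (row i C) (emb x) = (C *v emb x) $ i"
      by (simp add: scalar_product_def row_def matrix_vector_mult_def)
    then show ?thesis by (simp add: inverse_emb real_vector_def)
  qed
  have h_eq: "h x = (\<Sum>i\<in>UNIV. x $ i * h (axis i 1))" for x
  proof -
    have "h x = h (\<Sum>i\<in>UNIV. x $ i *\<^sub>R axis i 1)"
      using basis_expansion[of x] by (simp add: scalar_mult_eq_scaleR)
    also have "\<dots> = (\<Sum>i\<in>UNIV. x $ i * h (axis i 1))"
      using bounded_linear.linear[OF linear] by (simp add: linear_sum linear_scale)
    finally show ?thesis .
  qed
  have val: "(\<Sum>i\<in>UNIV. scalar_product (row i C) (emb x) * complex_of_real (h (axis i 1))) = complex_of_real (h x)" for x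
    by (subst h_eq[of x]) (simp add: coord)
  have pf: "(\<lambda>v. \<Sum>i\<in>UNIV. scalar_product (row i C) v * complex_of_real (h (axis i 1))) \<in> polynomial_functions"
    by (intro polynomial_functions_intros)
  show ?case by (rule bexI[OF _ pf]) (intro allI val)
next
  case (const c)
  show ?case by (intro bexI[of _ "\<lambda>v. complex_of_real c"] polynomial_functions_intros) simp
next
  case (add f g)
  then obtain p r where "p \<in> polynomial_functions" "\<forall>x. p (emb x) = complex_of_real (f x)"
    "r \<in> polynomial_functions" "\<forall>x. r (emb x) = complex_of_real (g x)" by blast
  then show ?case by (intro bexI[of _ "\<lambda>v. p v + r v"] polynomial_functions_intros) auto
next
  case (mult f g)
  then obtain p r where "p \<in> polynomial_functions" "\<forall>x. p (emb x) = complex_of_real (f x)"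
    "r \<in> polynomial_functions" "\<forall>x. r (emb x) = complex_of_real (g x)" by blast
  then show ?case by (intro bexI[of _ "\<lambda>v. p v * r v"] polynomial_functions_intros) auto
qed

lemma stone_weierstrass_real_locus:
  assumes f: "continuous_on real_locus f" and K: "compact K" "K \<subseteq> real_locus" and e: "e > 0"
  obtains p where "p \<in> polynomial_functions" "\<And>v. v \<in> K \<Longrightarrow> dist (p v) (f v) < e"
proof -
  have emb_re: "emb (re_part v) = v" if "v \<in> K" for v
    using K(2) that by (auto simp: real_locus_def)
  have "compact (re_part ` K)" by (intro compact_continuous_image continuous_on_re_part K)
  moreover have "continuous_on (re_part ` K) (\<lambda>x. f (emb x))"
    by (rule continuous_on_compose2[OF f continuous_on_emb]) (use emb_re K(2) in auto)
  ultimately have "\<exists>h. polynomial_function h \<and> (\<forall>x\<in>re_part ` K. norm (f (emb x) - h x) < e)"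
    using e by (rule Stone_Weierstrass_polynomial_function)
  then obtain h where h: "polynomial_function h" "\<And>x. x \<in> re_part ` K \<Longrightarrow> norm (f (emb x) - h x) < e"
    by blast
  have "real_polynomial_function (Re \<circ> h)" "real_polynomial_function (Im \<circ> h)"
    using h(1) bounded_linear_Re bounded_linear_Im unfolding polynomial_function_def by blast+
  from this[THEN real_polynomial_function_emb]
  obtain p r where p: "p \<in> polynomial_functions" "\<And>x. p (emb x) = complex_of_real (Re (h x))"
    and r: "r \<in> polynomial_functions" "\<And>x. r (emb x) = complex_of_real (Im (h x))"
    by (auto simp: o_def)
  show ?thesis
  proof (rule that)
    show "(\<lambda>v. p v + \<i> * r v) \<in> polynomial_functions" by (intro polynomial_functions_intros p r)
    fix v assume v: "v \<in> K"
    have "p v + \<i> * r v = h (re_part v)"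
      using p(2)[of "re_part v"] r(2)[of "re_part v"] by (simp add: emb_re[OF v] flip: complex_eq)
    then show "dist (p v + \<i> * r v) (f v) < e"
      using h(2)[of "re_part v"] v by (simp add: emb_re dist_norm norm_minus_commute)
  qed
qed

end

section \<open>Density and the extended series\<close>

lemma approximating_sequence:
  fixes Y :: "(complex^3) set"
  assumes Y: "closed Y"
    and approx: "\<And>K e. \<lbrakk>compact K; K \<subseteq> Y; e > 0\<rbrakk> \<Longrightarrow> \<exists>p\<in>A. \<forall>v\<in>K. dist (p v) (f v) < e"
  shows "\<exists>p. (\<forall>n. p n \<in> A) \<and> limitin (compact_convergence Y) p f sequentially"
proof -
  have "\<forall>n :: nat. \<exists>p. p \<in> A \<and> (\<forall>v\<in>Y \<inter> cball 0 (real n). dist (p v) (f v) < 1 / Suc n)"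
  proof
    fix n :: nat
    have "compact (Y \<inter> cball 0 (real n))" by (simp add: Y closed_Int_compact)
    then have "\<exists>p\<in>A. \<forall>v\<in>Y \<inter> cball 0 (real n). dist (p v) (f v) < 1 / Suc n"
      by (rule approx) simp_all
    then show "\<exists>p. p \<in> A \<and> (\<forall>v\<in>Y \<inter> cball 0 (real n). dist (p v) (f v) < 1 / Suc n)"
      unfolding Bex_def .
  qed
  from choice[OF this] obtain p
    where p: "\<forall>n :: nat. p n \<in> A \<and> (\<forall>v\<in>Y \<inter> cball 0 (real n). dist (p n v) (f v) < 1 / Suc n)" ..
  have "limitin (compact_convergence Y) p f sequentially"
    unfolding limitin_compact_convergence
  proof (intro allI impI uniform_limitI)
    fix K :: "(complex^3) set" and e :: real assume K: "compact K \<and> K \<subseteq> Y" and e: "e > 0"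
    obtain R where R: "\<forall>v\<in>K. norm v \<le> R" using K compact_imp_bounded[of K] unfolding bounded_iff by blast
    obtain N1 where N1: "R \<le> real N1" using real_arch_simple by blast
    obtain N2 where N2: "1 / real (Suc N2) < e" using nat_approx_posE[OF e] by blast
    have "dist (p n v) (f v) < e" if n: "n \<ge> max N1 N2" and v: "v \<in> K" for n v
    proof -
      have "norm v \<le> real n" using bspec[OF R v] N1 n by linarith
      then have "dist (p n v) (f v) < 1 / Suc n" using p K v by auto
      also have "1 / Suc n \<le> 1 / Suc N2" using n by (intro frac_le) auto
      finally show ?thesis using N2 by linarith
    qed
    then show "\<forall>\<^sub>F n in sequentially. \<forall>v\<in>K. dist (p n v) (f v) < e"
      unfolding eventually_sequentially by blast
  qed
  then show ?thesis using p by blast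
qed

lemma polynomial_approximating_sequence:
  assumes "closed Y"
    and "\<And>K e. \<lbrakk>compact K; K \<subseteq> Y; e > 0\<rbrakk> \<Longrightarrow> \<exists>p\<in>polynomial_functions. \<forall>v\<in>K. dist (p v) (f v) < e"
  shows "\<exists>P :: nat \<Rightarrow> polynomial3. limitin (compact_convergence Y) (\<lambda>n. poly_fun (P n)) f sequentially"
proof -
  obtain p where p: "\<forall>n :: nat. p n \<in> polynomial_functions"
    "limitin (compact_convergence Y) p f sequentially"
    using approximating_sequence[OF assms] by blast
  then have "\<forall>n. \<exists>P. p n = poly_fun P" unfolding polynomial_functions_def by blast
  from choice[OF this] obtain P where "\<forall>n. p n = poly_fun (P n)" ..
  then have "p = (\<lambda>n. poly_fun (P n))" by blast
  then show ?thesis using p(2) by blast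
qed

lemma dense_subset_compact_convergence:
  assumes "F \<subseteq> X"
    and approx: "\<And>f K e. \<lbrakk>f \<in> X; compact K; K \<subseteq> Y; e > 0\<rbrakk> \<Longrightarrow> \<exists>g\<in>F. \<forall>v\<in>K. dist (g v) (f v) < e"
  shows "dense_subset (compact_convergence Y) X F"
proof -
  have "f \<in> subtopology (compact_convergence Y) X closure_of F" if f: "f \<in> X" for f
    unfolding in_closure_of
  proof (intro conjI allI impI)
    fix T assume T: "f \<in> T \<and> openin (subtopology (compact_convergence Y) X) T"
    then obtain U where U: "openin (compact_convergence Y) U" "T = U \<inter> X"
      unfolding openin_subtopology by blast
    have "f \<in> U" using T U(2) by simp
    from bspec[OF U(1)[unfolded openin_compact_convergence] this]
    obtain K e where K: "compact K" "K \<subseteq> Y" "e > 0" "{g. \<forall>v\<in>K. dist (g v) (f v) < e} \<subseteq> U"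
      by (elim exE conjE)
    obtain g where g: "g \<in> F" "\<forall>v\<in>K. dist (g v) (f v) < e"
      using approx[OF f K(1-3)] by (elim bexE)
    have "g \<in> U" using K(4) g(2) by (intro subsetD[OF K(4)] CollectI)
    then show "\<exists>g. g \<in> F \<and> g \<in> T" using g(1) U(2) assms(1) by (intro exI[of _ g]) auto
  qed (use f in simp)
  moreover have "subtopology (compact_convergence Y) X closure_of F \<subseteq> X"
    using closure_of_subset_topspace[of "subtopology (compact_convergence Y) X" F] by simp
  ultimately show ?thesis using assms(1) unfolding dense_subset_def by blast
qed

lemma continuous_on_compact_limit:
  fixes Y :: "(complex^3) set"
  assumes Y: "closed Y" and p: "\<And>n. continuous_on Y (p n)"
    and lim: "limitin (compact_convergence Y) p f sequentially"
  shows "continuous_on Y f"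
  unfolding continuous_on_eq_continuous_within
proof
  fix v assume v: "v \<in> Y"
  let ?K = "Y \<inter> cball v 1"
  have "compact ?K" using Y by (simp add: closed_Int_compact)
  then have "uniform_limit ?K p f sequentially" using lim unfolding limitin_compact_convergence by blast
  then have "continuous_on ?K f"
    by (rule uniform_limit_theorem[rotated])
       (auto intro!: always_eventually continuous_on_subset[OF p])
  then have "continuous (at v within ?K) f"
    using v unfolding continuous_on_eq_continuous_within by simp
  moreover have "at v within ?K = at v within Y"
    by (rule at_within_nhd[of v "ball v 1"]) auto
  ultimately show "continuous (at v within Y) f" by simp
qed

text \<open>
  Sylvester's finite sum is a series whose remaining forms vanish.
\<close>

lemma (in null_coordinates) polynomial_multipole_functions:
  assumes Y: "Y \<subseteq> quadric Q" and p: "p \<in> polynomial_functions"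
  shows "p \<in> multipole_functions Y"
proof -
  obtain P where P: "p = poly_fun P" using p by (auto simp: polynomial_functions_def)
  obtain c0 d and L :: "nat \<Rightarrow> nat \<Rightarrow> complex^3" where L: "\<forall>v\<in>quadric Q. p v =
      c0 + (\<Sum>k=1..d. \<Prod>l=1..k. scalar_product (L k l) v)"
    unfolding P using polynomial_sylvester[of P] by blast
  define L' where "L' k l = (if k \<le> d then L k l else 0)" for k l
  have partial: "(\<Sum>k<n. multipole_term c0 L' k v) = p v" if n: "n \<ge> Suc d" and v: "v \<in> Y" for n v
  proof -
    have "(\<Sum>k<n. multipole_term c0 L' k v) = (\<Sum>k\<in>insert 0 {1..d}. multipole_term c0 L' k v)"
    proof (rule sum.mono_neutral_right)
      show "\<forall>k\<in>{..<n} - insert 0 {1..d}. multipole_term c0 L' k v = 0"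
      proof
        fix k assume "k \<in> {..<n} - insert 0 {1..d}"
        then have k: "k > 0" "k > d" by auto
        then have "scalar_product (L' k 1) v = 0" by (simp add: L'_def scalar_product_def)
        then have "(\<Prod>j=1..k. scalar_product (L' k j) v) = 0"
          using k(1) by (intro prod_zero bexI[of _ 1]) auto
        then show "multipole_term c0 L' k v = 0" using k(1) by (simp add: multipole_term_def)
      qed
    qed (use n in auto)
    also have "\<dots> = c0 + (\<Sum>k=1..d. multipole_term c0 L' k v)" by (simp add: multipole_term_def)
    also have "(\<Sum>k=1..d. multipole_term c0 L' k v) = (\<Sum>k=1..d. \<Prod>l=1..k. scalar_product (L k l) v)"
      by (rule sum.cong) (auto simp: multipole_term_def L'_def)
    finally show ?thesis using L v Y by auto
  qed
  have "multipole_series Y c0 L' p"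
    unfolding multipole_series_def limitin_compact_convergence
  proof (intro allI impI uniform_limitI)
    fix K and e :: real assume K: "compact K \<and> K \<subseteq> Y" and "e > 0"
    then have "\<forall>v\<in>K. dist (\<Sum>k<n. multipole_term c0 L' k v) (p v) < e" if "n \<ge> Suc d" for n
      using partial[OF that] by auto
    then show "\<forall>\<^sub>F n in sequentially. \<forall>v\<in>K. dist (\<Sum>k<n. multipole_term c0 L' k v) (p v) < e"
      unfolding eventually_sequentially by blast
  qed
  then show ?thesis unfolding multipole_functions_def by blast
qed

lemma multipole_functions_limit:
  assumes "f \<in> multipole_functions Y"
  obtains p where "\<And>n. p n \<in> polynomial_functions" "limitin (compact_convergence Y) p f sequentially"
proof -
  obtain c L where "limitin (compact_convergence Y) (\<lambda>n v. \<Sum>k<n. multipole_term c L k v) f sequentially"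
    using assms unfolding multipole_functions_def multipole_series_def by blast
  moreover have "(\<lambda>v. \<Sum>k<n. multipole_term c L k v) \<in> polynomial_functions" for n
    by (intro polynomial_functions_sum multipole_term_polynomial)
  ultimately show ?thesis by (rule that[rotated])
qed

lemma multipole_functions_scale:
  assumes "f \<in> multipole_functions Y"
  shows "(\<lambda>v. a * f v) \<in> multipole_functions Y"
proof -
  obtain c L where ser: "multipole_series Y c L f" using assms unfolding multipole_functions_def by blast
  \<comment> \<open>The scalar goes into the first factor of each product.\<close>
  define L' where "L' k j = (if j = 1 then a *s L k j else L k j)" for k j :: nat
  have "multipole_term (a * c) L' k v = a * multipole_term c L k v" for k v
  proof (cases k)
    case (Suc n)
    have "(\<Prod>j=Suc 1..k. scalar_product (L' k j) v) = (\<Prod>j=Suc 1..k. scalar_product (L k j) v)"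
      by (rule prod.cong) (auto simp: L'_def)
    moreover have "{1..k} = insert 1 {Suc 1..k}" using Suc by auto
    moreover have "scalar_product (L' k 1) v = a * scalar_product (L k 1) v"
      by (simp add: L'_def scalar_product_scale_left)
    ultimately show ?thesis using Suc by (simp add: multipole_term_def)
  qed (simp add: multipole_term_def)
  then have "multipole_series Y (a * c) L' (\<lambda>v. a * f v)"
    using ser unfolding multipole_series_def limitin_compact_convergence
    by (auto simp: sum_distrib_left[symmetric]
        intro!: bounded_linear.uniform_limit[OF bounded_linear_mult_right])
  then show ?thesis unfolding multipole_functions_def by blast
qed

lemma continuous_on_matrix_vector_mult: "continuous_on K (\<lambda>v. M *v v)" for M :: "complex^3^3"
proof -
  have "linear (\<lambda>v. M *v v)"
    by (rule linearI) (simp_all add: vec_eq_iff matrix_vector_mult_def distrib_left sum.distrib scaleR_sum_right)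
  then show ?thesis by (simp add: linear_continuous_on linear_conv_bounded_linear)
qed

text \<open>
  A linear map turns linear forms into linear forms, and an orthogonal one preserves the quadric together
  with its compact subsets.
\<close>

lemma multipole_functions_orthogonal:
  assumes f: "f \<in> multipole_functions (quadric Q)" and g: "g \<in> orthogonal_group Q"
  shows "(\<lambda>v. f (matrix_inv g *v v)) \<in> multipole_functions (quadric Q)"
proof -
  obtain c L where ser: "multipole_series (quadric Q) c L f" using f unfolding multipole_functions_def by blast
  let ?h = "\<lambda>v. matrix_inv g *v v"
  have "g ** matrix_inv g = mat 1"
    using g someI_ex[of "\<lambda>A'. g ** A' = mat 1 \<and> A' ** g = mat 1"]
    unfolding orthogonal_group_def invertible_def matrix_inv_def by blast
  then have gh: "g *v ?h v = v" for v by (simp add: matrix_vector_mul_assoc)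
  have h_quadric: "?h v \<in> quadric Q" if "v \<in> quadric Q" for v
  proof -
    have "poly_fun Q (?h v) = poly_fun Q (g *v ?h v)" using g by (simp add: orthogonal_group_def)
    then show ?thesis using that by (simp add: quadric_def gh)
  qed
  define L' where "L' k j = transpose (matrix_inv g) *v L k j" for k j
  have term_eq: "multipole_term c L' k v = multipole_term c L k (?h v)" for k v
    by (simp add: multipole_term_def L'_def scalar_product_transpose)
  have "multipole_series (quadric Q) c L' (\<lambda>v. f (?h v))"
    unfolding multipole_series_def limitin_compact_convergence term_eq
  proof (intro allI impI)
    fix K assume K: "compact K \<and> K \<subseteq> quadric Q"
    then have "compact (?h ` K) \<and> ?h ` K \<subseteq> quadric Q"
      using h_quadric by (auto intro!: compact_continuous_image continuous_on_matrix_vector_mult)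
    then have "uniform_limit (?h ` K) (\<lambda>n v. \<Sum>k<n. multipole_term c L k v) f sequentially"
      using ser unfolding multipole_series_def limitin_compact_convergence by blast
    then show "uniform_limit K (\<lambda>n v. \<Sum>k<n. multipole_term c L k (?h v)) (\<lambda>v. f (?h v)) sequentially"
      unfolding uniform_limit_iff by simp
  qed
  then show ?thesis unfolding multipole_functions_def by blast
qed

lemma multipole_series_sums:
  assumes "multipole_series Y c L f" "v \<in> Y"
  shows "(\<lambda>k. multipole_term c L k v) sums f v"
proof -
  have "uniform_limit {v} (\<lambda>n v. \<Sum>k<n. multipole_term c L k v) f sequentially"
    using assms(1)[unfolded multipole_series_def limitin_compact_convergence, rule_format, of "{v}"]
      assms(2) by simp
  then show ?thesis unfolding sums_def by (rule tendsto_uniform_limitI) simp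
qed

text \<open>
  The sum of the terms serves as \<open>F\<close> both on \<open>Y\<close> and off \<open>Y\<close>.  On a ray it is a power series, and its
  limit at the end point is Abel's theorem.
\<close>

lemma radial_extension:
  assumes ser: "multipole_series Y c L f"
    and hull: "\<And>p. p \<in> Z \<Longrightarrow> \<exists>t<1. 0 \<le> t \<and> growth_near c L p t"
    and multiples: "\<And>v a. \<lbrakk>v \<in> Y; a \<in> D\<rbrakk> \<Longrightarrow> a *s v \<in> Z"
  shows "\<exists>F. hol_on F Z \<and> (\<forall>v\<in>Y. F v = f v \<and>
    ((\<lambda>t. F (complex_of_real t *s v)) \<longlongrightarrow> f v) (at_left 1) \<and>
    (\<forall>a\<in>D. (\<lambda>k. a ^ k * multipole_term c L k v) sums F (a *s v)))"
proof (rule exI[of _ "\<lambda>w. suminf (\<lambda>k. multipole_term c L k w)"], intro conjI ballI allI impI)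
  let ?T = "multipole_term c L"
  show "hol_on (\<lambda>w. suminf (\<lambda>k. ?T k w)) Z" by (rule extension_by_series(1)[OF hull])
  fix v assume v: "v \<in> Y"
  then have sums: "(\<lambda>k. ?T k v) sums f v" by (rule multipole_series_sums[OF ser])
  then show "suminf (\<lambda>k. ?T k v) = f v" by (rule sums_unique[symmetric])
  show "((\<lambda>t. suminf (\<lambda>k. ?T k (complex_of_real t *s v))) \<longlongrightarrow> f v) (at_left 1)"
    using abel_limit_theorem[OF sums] by (simp add: multipole_term_scale)
  fix a assume "a \<in> D"
  then have "a *s v \<in> Z" by (rule multiples[OF v])
  then have "summable (\<lambda>k. ?T k (a *s v))"
    using extension_by_series(2)[where Y = Z, OF hull] by blast
  then show "(\<lambda>k. a ^ k * ?T k v) sums suminf (\<lambda>k. ?T k (a *s v))"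
    by (simp only: multipole_term_scale summable_sums)
qed

text \<open>
  A point \<open>l v\<close> with \<open>v\<close> on the quadric has \<open>Q (l v) = l\<^sup>2\<close>, which settles the case \<open>l \<noteq> 0\<close>.  The origin
  is reached from the growth near \<open>v\<close>.
\<close>

lemma growth_near_round_hull:
  assumes Q: "quadratic_form Q" and ser: "multipole_series (quadric Q) c L f"
    and p: "p \<in> round_hull (quadric Q)"
  shows "\<exists>t<1. 0 \<le> t \<and> growth_near c L p t"
proof -
  obtain l v where lv: "p = l *s v" "v \<in> quadric Q" "norm l < 1" using p by (auto simp: round_hull_def)
  then have Qv: "poly_fun Q v = 1" by (simp add: quadric_def)
  show ?thesis
  proof (cases "l = 0")
    case True
    have "growth_near c L v 2" by (rule growth_near_quadric[OF Q ser]) (simp_all add: Qv)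
    then have "growth_near c L 0 (1/2)" by (rule growth_near_zero) simp
    moreover have "p = 0" using True lv(1) by (simp add: vec_eq_iff)
    ultimately show ?thesis by (intro exI[of _ "1/2"]) auto
  next
    case False
    define t where "t = (norm l + 1) / 2"
    have t: "norm l < t" "t < 1" "t > 0" using lv(3) by (auto simp: t_def intro: add_nonneg_pos)
    have Qp: "poly_fun Q p = l^2" by (simp add: lv(1) quadratic_form_scale[OF Q] Qv)
    have "norm l ^ 2 < t ^ 2" using t(1) by (intro power_strict_mono) auto
    then have "growth_near c L p t"
      using t(3) False by (intro growth_near_quadric[OF Q ser]) (simp_all add: Qp norm_power)
    then show ?thesis using t by (intro exI[of _ t]) auto
  qed
qed

lemma (in real_form) growth_near_real_cone:
  assumes ser: "multipole_series real_locus c L f" and p: "p \<in> real_cone real_locus"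
  shows "\<exists>t<1. 0 \<le> t \<and> growth_near c L p t"
proof -
  obtain \<tau> x where x: "p = complex_of_real \<tau> *s emb x" "emb x \<in> real_locus" "\<bar>\<tau>\<bar> < 1"
    using p by (auto simp: real_cone_def real_locus_def)
  then have qx: "q x = 1" by (simp add: emb_in_real_locus)
  show ?thesis
  proof (cases "\<tau> = 0")
    case True
    have "growth_near c L (emb x) 2" by (rule growth_near_real[OF ser]) (simp_all add: qx)
    then have "growth_near c L 0 (1/2)" by (rule growth_near_zero) simp
    moreover have "p = 0" using True x(1) by (simp add: vec_eq_iff)
    ultimately show ?thesis by (intro exI[of _ "1/2"]) auto
  next
    case False
    define t where "t = (\<bar>\<tau>\<bar> + 1) / 2"
    have t: "\<bar>\<tau>\<bar> < t" "t < 1" "t > 0" using x(3) by (auto simp: t_def intro: add_nonneg_pos)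
    have "complex_of_real (q (\<tau> *\<^sub>R x)) = complex_of_real (\<tau>^2)"
      unfolding value_emb[symmetric] by (simp add: emb_scale quadratic_form_scale[OF form] value_emb qx)
    then have q\<tau>: "q (\<tau> *\<^sub>R x) = \<tau>^2" by (simp only: of_real_eq_iff)
    have "\<bar>\<tau>\<bar> ^ 2 < t ^ 2" using t(1) by (intro power_strict_mono) auto
    then have "growth_near c L (emb (\<tau> *\<^sub>R x)) t"
      using t(3) False by (intro growth_near_real[OF ser]) (simp_all add: q\<tau>)
    then show ?thesis using t by (intro exI[of _ t]) (auto simp: x(1) emb_scale)
  qed
qed

lemma multipole_extension_quadric:
  assumes "quadratic_form Q" "multipole_series (quadric Q) c L f"
  shows "\<exists>F. hol_on F (round_hull (quadric Q)) \<and> (\<forall>v\<in>quadric Q. F v = f v \<and>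
    ((\<lambda>t. F (complex_of_real t *s v)) \<longlongrightarrow> f v) (at_left 1) \<and>
    (\<forall>l. norm l < 1 \<longrightarrow> (\<lambda>k. l ^ k * multipole_term c L k v) sums F (l *s v)))"
proof -
  have "\<exists>F. hol_on F (round_hull (quadric Q)) \<and> (\<forall>v\<in>quadric Q. F v = f v \<and>
      ((\<lambda>t. F (complex_of_real t *s v)) \<longlongrightarrow> f v) (at_left 1) \<and>
      (\<forall>l\<in>{l. norm l < 1}. (\<lambda>k. l ^ k * multipole_term c L k v) sums F (l *s v)))"
    by (rule radial_extension[OF assms(2)], erule growth_near_round_hull[OF assms])
       (auto simp: round_hull_def)
  then show ?thesis by (simp only: Ball_def mem_Collect_eq)
qed

lemma (in real_form) multipole_extension_real_locus:
  assumes "multipole_series real_locus c L f"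
  shows "\<exists>F. hol_on F (real_cone real_locus) \<and> (\<forall>v\<in>real_locus. F v = f v \<and>
    ((\<lambda>t. F (complex_of_real t *s v)) \<longlongrightarrow> f v) (at_left 1) \<and>
    (\<forall>t :: real. \<bar>t\<bar> < 1 \<longrightarrow> (\<lambda>k. complex_of_real t ^ k * multipole_term c L k v)
       sums F (complex_of_real t *s v)))"
proof -
  have "\<exists>F. hol_on F (real_cone real_locus) \<and> (\<forall>v\<in>real_locus. F v = f v \<and>
      ((\<lambda>t. F (complex_of_real t *s v)) \<longlongrightarrow> f v) (at_left 1) \<and>
      (\<forall>a\<in>complex_of_real ` {t. \<bar>t\<bar> < 1}. (\<lambda>k. a ^ k * multipole_term c L k v) sums F (a *s v)))"
    by (rule radial_extension[OF assms], erule growth_near_real_cone[OF assms])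
       (auto simp: real_cone_def)
  then show ?thesis by simp
qed

section \<open>The two totally real surfaces\<close>

lemma (in real_form) real_locus_eq:
  "real_locus = {v \<in> quadric Q. \<forall>i. (C *v v) $ i \<in> \<real>}"
proof -
  have "v \<in> range emb \<longleftrightarrow> (\<forall>i. (C *v v) $ i \<in> \<real>)" for v
    unfolding range_emb_iff by (simp add: im_part_def vec_eq_iff complex_is_Real_iff)
  then show ?thesis unfolding real_locus_def by blast
qed

lemma upsilon_real_form:
  assumes "quadratic_form Q" "diagonalizes A Q"
  shows "\<exists>B C. real_form Q B C \<and> upsilon A = real_form.real_locus Q B"
proof -
  obtain A' where A': "A ** A' = mat 1" "A' ** A = mat 1"
    using assms(2) unfolding diagonalizes_def invertible_def by blast
  have val: "poly_fun Q v = scalar_product (transpose A *v v) (transpose A *v v)" for v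
    using assms(2) by (simp add: diagonalizes_def transpose_matrix_vector)
  have inv: "transpose A' ** transpose A = mat 1" "transpose A ** transpose A' = mat 1"
    by (simp_all add: A' transpose_mat flip: matrix_transpose_mul)
  interpret real_form Q "transpose A'" "transpose A"
  proof
    fix x
    have "transpose A *v (transpose A' *v real_vector x) = real_vector x"
      by (simp only: matrix_vector_mul_assoc inv matrix_vector_mul_lid)
    then have "poly_fun Q (transpose A' *v real_vector x) = scalar_product (real_vector x) (real_vector x)"
      by (simp only: val)
    then show "poly_fun Q (transpose A' *v real_vector x) \<in> \<real>"
      by (simp add: scalar_product_def real_vector_def)
  qed (use assms(1) inv in auto)
  have norm_eq: "norm w = 1 \<longleftrightarrow> scalar_product w w = 1" if "\<And>i. w $ i \<in> \<real>" for w :: "complex^3"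
  proof -
    have "w $ i * w $ i = complex_of_real (norm (w $ i) ^ 2)" for i
    proof -
      obtain r where "w $ i = complex_of_real r" using \<open>w $ i \<in> \<real>\<close> by (rule Reals_cases)
      then show ?thesis by (simp add: power2_eq_square flip: of_real_mult)
    qed
    then have "scalar_product w w = complex_of_real (\<Sum>i\<in>UNIV. norm (w $ i) ^ 2)"
      by (simp add: scalar_product_def)
    also have "(\<Sum>i\<in>UNIV. norm (w $ i) ^ 2) = norm w ^ 2"
      by (simp add: norm_vec_def L2_set_def sum_nonneg)
    finally have "scalar_product w w = complex_of_real (norm w ^ 2)" .
    moreover have "norm w \<noteq> - 1" using norm_ge_zero[of w] by linarith
    ultimately show ?thesis by (simp add: power2_eq_1_iff del: of_real_power)
  qed
  have "upsilon A = real_locus"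
    unfolding upsilon_def real_locus_eq quadric_def val transpose_matrix_vector[symmetric]
    using norm_eq by blast
  then show ?thesis using real_form_axioms by blast
qed

lemma real_quadric_real_form:
  assumes "quadratic_form Q" "real_coefficients Q"
  shows "\<exists>B C. real_form Q B C \<and> real_quadric Q = real_form.real_locus Q B"
proof -
  interpret real_form Q "mat 1" "mat 1"
  proof
    show "poly_fun Q (mat 1 *v real_vector x) \<in> \<real>" for x
      using assms(2) unfolding poly_fun_def real_coefficients_def
      by (auto simp: real_vector_def intro!: sum_in_Reals prod_in_Reals Reals_mult Reals_power)
  qed (use assms(1) in auto)
  have "real_quadric Q = real_locus" by (simp add: real_quadric_def real_locus_eq)
  then show ?thesis using real_form_axioms by blast
qed

theorem theorem19:
  fixes Q :: polynomial3
  assumes "quadratic_form Q" and "irreducible Q"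
  shows
    "(\<forall>f\<in>hol_functions (quadric Q). \<exists>P :: nat \<Rightarrow> polynomial3.
        limitin (compact_convergence (quadric Q)) (\<lambda>n. poly_fun (P n)) f sequentially) \<and>
     (\<forall>P :: polynomial3. \<exists>c0 d (L :: nat \<Rightarrow> nat \<Rightarrow> complex^3). \<forall>v\<in>quadric Q.
        poly_fun P v = c0 + (\<Sum>k=1..d. \<Prod>l=1..k. scalar_product (L k l) v)) \<and>

     dense_subset (compact_convergence (quadric Q))
        (hol_functions (quadric Q)) (multipole_functions (quadric Q)) \<and>
     (\<forall>f\<in>multipole_functions (quadric Q). \<forall>a :: complex.
        (\<lambda>v. a * f v) \<in> multipole_functions (quadric Q)) \<and>
     (\<forall>f\<in>multipole_functions (quadric Q). \<forall>g\<in>orthogonal_group Q.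
        (\<lambda>v. f (matrix_inv g *v v)) \<in> multipole_functions (quadric Q)) \<and>
     (\<forall>f c L. multipole_series (quadric Q) c L f \<longrightarrow>
        (\<exists>F. hol_on F (round_hull (quadric Q)) \<and>
             (\<forall>v\<in>quadric Q.
                F v = f v \<and>
                ((\<lambda>t. F (complex_of_real t *s v)) \<longlongrightarrow> f v) (at_left 1) \<and>
                (\<forall>l. norm l < 1 \<longrightarrow> (\<lambda>k. l ^ k * multipole_term c L k v) sums F (l *s v))))) \<and>

     (\<forall>H. (\<exists>A. diagonalizes A Q \<and> H = upsilon A) \<or> (real_coefficients Q \<and> H = real_quadric Q) \<longrightarrow>
        (\<forall>f\<in>cont_functions H. \<exists>P :: nat \<Rightarrow> polynomial3.
           limitin (compact_convergence H) (\<lambda>n. poly_fun (P n)) f sequentially) \<and>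
        dense_subset (compact_convergence H) (cont_functions H) (multipole_functions H) \<and>
        (\<forall>f c L. multipole_series H c L f \<longrightarrow>
           (\<exists>F. hol_on F (real_cone H) \<and>
                (\<forall>v\<in>H.
                   F v = f v \<and>
                   ((\<lambda>t. F (complex_of_real t *s v)) \<longlongrightarrow> f v) (at_left 1) \<and>
                   (\<forall>t :: real. \<bar>t\<bar> < 1 \<longrightarrow>
                      (\<lambda>k. complex_of_real t ^ k * multipole_term c L k v)
                        sums F (complex_of_real t *s v))))) \<and>

        (\<forall>f U1 F1 U2 F2.
           openin (top_of_set (quadric Q)) U1 \<and> H \<subseteq> U1 \<and> hol_on F1 U1 \<and> (\<forall>v\<in>H. F1 v = f v) \<and>
           openin (top_of_set (quadric Q)) U2 \<and> H \<subseteq> U2 \<and> hol_on F2 U2 \<and> (\<forall>v\<in>H. F2 v = f v) \<longrightarrow>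
           (\<exists>U. openin (top_of_set (quadric Q)) U \<and> H \<subseteq> U \<and> U \<subseteq> U1 \<inter> U2 \<and>
                (\<forall>v\<in>U. F1 v = F2 v))))"
proof -
  let ?S = "quadric Q"
  note Q = assms(1)
  obtain \<alpha> \<beta> \<gamma> m1 m2 m3 where "null_coordinates Q \<alpha> \<beta> \<gamma> m1 m2 m3"
    using irreducible_quadratic_form_null_coordinates[OF assms] .
  then interpret null_coordinates Q \<alpha> \<beta> \<gamma> m1 m2 m3 .
  have approx: "\<exists>p\<in>polynomial_functions. \<forall>v\<in>K. dist (p v) (f v) < e"
    if "f \<in> hol_functions ?S" "compact K" "K \<subseteq> ?S" "e > 0" for f K e
    by (rule hol_on_quadric_polynomial_approximation[of f K e])
       (use that in \<open>auto simp: hol_functions_def\<close>)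
  have part1: "\<forall>f\<in>hol_functions ?S. \<exists>P :: nat \<Rightarrow> polynomial3.
      limitin (compact_convergence ?S) (\<lambda>n. poly_fun (P n)) f sequentially"
    using polynomial_approximating_sequence[OF closed_quadric approx] by blast
  have "multipole_functions ?S \<subseteq> hol_functions ?S"
  proof
    fix f assume "f \<in> multipole_functions ?S"
    then obtain p where "\<And>n. p n \<in> polynomial_functions" "limitin (compact_convergence ?S) p f sequentially"
      by (rule multipole_functions_limit) blast
    then show "f \<in> hol_functions ?S"
      unfolding hol_functions_def using limit_of_polynomials_hol_on_quadric[OF Q] by blast
  qed
  moreover have "\<exists>g\<in>multipole_functions ?S. \<forall>v\<in>K. dist (g v) (f v) < e"
    if "f \<in> hol_functions ?S" "compact K" "K \<subseteq> ?S" "e > 0" for f K e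
    using approx[OF that] polynomial_multipole_functions[OF order_refl] by blast
  ultimately have part2: "dense_subset (compact_convergence ?S) (hol_functions ?S) (multipole_functions ?S)"
    by (rule dense_subset_compact_convergence)
  show ?thesis (is "_ \<and> _ \<and> _ \<and> _ \<and> _ \<and> _ \<and> (\<forall>H. ?surface H \<longrightarrow> ?claim H)")
  proof -
    have "?claim H" if H_surface: "?surface H" for H
    proof -
      obtain B C where BC: "real_form Q B C" "H = real_form.real_locus Q B"
        using H_surface
      proof (elim disjE exE conjE)
        fix A assume "diagonalizes A Q" "H = upsilon A"
        then show thesis using upsilon_real_form[OF Q] that by metis
      next
        assume "real_coefficients Q" "H = real_quadric Q"
        then show thesis using real_quadric_real_form[OF Q] that by metis
      qed
      interpret real_form Q B C by (rule BC(1))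
      have H_quadric: "real_locus \<subseteq> ?S" by (simp add: real_locus_def)
      have approx: "\<exists>p\<in>polynomial_functions. \<forall>v\<in>K. dist (p v) (f v) < e"
        if "f \<in> cont_functions real_locus" "compact K" "K \<subseteq> real_locus" "e > 0" for f K e
        by (rule stone_weierstrass_real_locus[of f K e]) (use that in \<open>auto simp: cont_functions_def\<close>)
      have "multipole_functions real_locus \<subseteq> cont_functions real_locus"
      proof
        fix f assume "f \<in> multipole_functions real_locus"
        then obtain p where "\<And>n. p n \<in> polynomial_functions"
          "limitin (compact_convergence real_locus) p f sequentially"
          by (rule multipole_functions_limit) blast
        then show "f \<in> cont_functions real_locus"
          unfolding cont_functions_def
          using continuous_on_compact_limit[OF closed_real_locus] polynomial_functions_continuous_on by blast
      qed
      moreover have "\<exists>g\<in>multipole_functions real_locus. \<forall>v\<in>K. dist (g v) (f v) < e"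
        if "f \<in> cont_functions real_locus" "compact K" "K \<subseteq> real_locus" "e > 0" for f K e
        using approx[OF that] polynomial_multipole_functions[OF H_quadric] by blast
      ultimately have dense: "dense_subset (compact_convergence real_locus) (cont_functions real_locus)
          (multipole_functions real_locus)"
        by (rule dense_subset_compact_convergence)
      have seq: "\<exists>P :: nat \<Rightarrow> polynomial3.
          limitin (compact_convergence real_locus) (\<lambda>n. poly_fun (P n)) f sequentially"
        if "f \<in> cont_functions real_locus" for f
        by (rule polynomial_approximating_sequence[OF closed_real_locus approx[OF that]])
      show ?thesis
        unfolding BC(2)
        by (intro conjI allI impI ballI seq dense multipole_extension_real_locus)
           (assumption | elim conjE, rule hol_germ_unique, auto)+
    qed
    then have part4: "\<forall>H. ?surface H \<longrightarrow> ?claim H" by (intro allI impI)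
    show ?thesis
      by (intro conjI part1 part2 part4; intro allI impI ballI polynomial_sylvester
          multipole_functions_scale multipole_functions_orthogonal multipole_extension_quadric[OF Q])
  qed
qed

end
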